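(* (Integral 2, difference equations.) Let $n\ge1$, $q\ge0$ be integers. (i) For partitions $\lambda,\mu$ with at most $n$ rows, the integrals $a_{\lambda\mu}(z)=\int_{U(n)}\mathbf s_\lambda(M)\mathbf s_\mu(\bar M)\det(I+M)^qe^{z\operatorname{Tr}\bar M}dM$ satisfy $$\sum_{i=1}^n(\lambda_i-i+n)a_{\lambda-e_i,\mu}-\sum_{i=1}^n(\mu_i-i+n+z+1)a_{\lambda,\mu+e_i}+(|\lambda|-|\mu|+nq)a_{\lambda\mu}-z\Big(\sum_{i=1}^na_{\lambda,\mu+2e_i}-\sum_{1\le i\le n-1,\ \mu_i=\mu_{i+1}}a_{\lambda,\mu+e_i+e_{i+1}}\Big)=0,$$ $$\sum_{i=1}^n(\mu_i-i+n)a_{\lambda,\mu-e_i}-\sum_{i=1}^n(\lambda_i-i+n+q+1)a_{\lambda+e_i,\mu}+(|\mu|-|\lambda|+nz)a_{\lambda\mu}+z\sum_{i=1}^na_{\lambda,\mu+e_i}=0.$$ (ii) For strictly increasing tuples $x=(x_1<\dots<x_n)$, $y=(y_1<\dots<y_n)$ in $\mathbb Z_{\ge0}$, define $b^{(k)}_{xy}$ by $a_{\lambda\mu}(z)=\sum_{k\ge0}b^{(k)}_{xy}\frac{z^k}{k!}$, where $x_i=\lambda_{n-i+1}+i-1$, $y_i=\mu_{n-i+1}+i-1$. Then for all $k\ge0$ $$\sum_{i=1}^n\Big(x_ib^{(k)}_{x-e_i,y}-(y_i+1)b^{(k)}_{x,y+e_i}+(x_i-y_i+q)b^{(k)}_{xy}\Big)+k\Big(-\sum_{i=1}^n\big(b^{(k-1)}_{x,y+e_i}+b^{(k-1)}_{x,y+2e_i}\big)+\sum_{1\le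 i\le n-1,\ y_{i+1}-y_i=1}b^{(k-1)}_{x,y+e_i+e_{i+1}}\Big)=0,$$ $$\sum_{i=1}^n\Big(y_ib^{(k)}_{x,y-e_i}-(x_i+1+q)b^{(k)}_{x+e_i,y}+(y_i-x_i)b^{(k)}_{xy}\Big)+k\sum_{i=1}^n\Big(b^{(k-1)}_{xy}+b^{(k-1)}_{x,y+e_i}\Big)=0.$$
   Context: $dM$ is normalized Haar measure on the unitary group $U(n)$, $\bar M$ the complex conjugate of $M$; $\mathbf s_\lambda(M)$ is the Schur function of $\lambda$ evaluated at the eigenvalues of $M$. $e_i$ is the $i$-th unit vector, $|\lambda|=\sum_i\lambda_i$. Conventions: $a_{\lambda\mu}=0$ if $\lambda$ or $\mu$ is not a partition (weakly decreasing with nonnegative entries, at most $n$ rows); $b^{(k)}_{xy}=0$ if $x$ or $y$ is not a strictly increasing tuple of nonnegative integers; terms multiplied by $k$ vanish for $k=0$. *)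

theory Defs
  imports "HOL-Probability.Probability" "HOL-Computational_Algebra.Computational_Algebra"
begin

definition cnj_matrix :: "complex ^ 'n ^ 'n \<Rightarrow> complex ^ 'n ^ 'n" where
  "cnj_matrix M = (\<chi> i j. cnj (M $ i $ j))"

definition unitary_group :: "(complex ^ 'n ^ 'n) set" where
  "unitary_group =
     {M. M ** transpose (cnj_matrix M) = mat 1 \<and> transpose (cnj_matrix M) ** M = mat 1}"

definition normalized_haar_measure :: "(complex ^ 'n ^ 'n) measure \<Rightarrow> bool" where
  "normalized_haar_measure H \<longleftrightarrow>
     prob_space H \<and>
     space H = unitary_group \<and>
     sets H = sets (restrict_space borel unitary_group) \<and>
     (\<forall>A\<in>unitary_group. distr H H (\<lambda>M. A ** M) = H)"

text \<open>Eigenvalues are counted with algebraic multiplicity, as the roots of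
  \<open>det (X I - M)\<close>.\<close>

definition eigenvalue_mset :: "complex ^ 'n ^ 'n \<Rightarrow> complex multiset" where
  "eigenvalue_mset M = proots (det (mat [:0, 1:] - (\<chi> i j. [:M $ i $ j:])))"

text \<open>The complete homogeneous symmetric function \<open>h\<^sub>k\<close>, evaluated at a finite multiset \<open>E\<close> of
  numbers, is the coefficient of \<open>t\<^sup>k\<close> in the product of \<open>1 / (1 - x t)\<close> over \<open>x\<close> in \<open>E\<close>;
  it vanishes for negative \<open>k\<close>.\<close>

definition complete_homogeneous :: "complex multiset \<Rightarrow> int \<Rightarrow> complex" where
  "complete_homogeneous E k =
     (if k < 0 then 0
      else fps_nth (\<Prod>x\<in>#E. inverse (1 - fps_const x * fps_X)) (nat k))"

text \<open>The Schur function as the Jacobi-Trudi determinant of the entries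
  \<open>h\<close> of index \<open>lam i - i + j\<close>, where \<open>i\<close> and \<open>j\<close> range over \<open>1..n\<close>.\<close>

definition schur :: "nat \<Rightarrow> (nat \<Rightarrow> int) \<Rightarrow> complex multiset \<Rightarrow> complex" where
  "schur n lam E =
     (\<Sum>p | p permutes {1..n}. of_int (sign p) *
        (\<Prod>i = 1..n. complete_homogeneous E (lam i - int i + int (p i))))"

abbreviation schur_matrix :: "(nat \<Rightarrow> int) \<Rightarrow> complex ^ 'n ^ 'n \<Rightarrow> complex" where
  "schur_matrix lam M \<equiv> schur CARD('n) lam (eigenvalue_mset M)"

text \<open>Tuples of length \<open>n\<close> are functions of which only the values at \<open>1..n\<close> matter.
  The entries are integers because subtracting a unit vector may produce \<open>-1\<close>.\<close>

definition is_partition :: "nat \<Rightarrow> (nat \<Rightarrow> int) \<Rightarrow> bool" where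
  "is_partition n lam \<longleftrightarrow>
     (\<forall>i\<in>{1..n}. 0 \<le> lam i) \<and> (\<forall>i\<in>{1..<n}. lam (Suc i) \<le> lam i)"

definition is_strict_tuple :: "nat \<Rightarrow> (nat \<Rightarrow> int) \<Rightarrow> bool" where
  "is_strict_tuple n x \<longleftrightarrow>
     (\<forall>i\<in>{1..n}. 0 \<le> x i) \<and> (\<forall>i\<in>{1..<n}. x i < x (Suc i))"

definition tuple_size :: "nat \<Rightarrow> (nat \<Rightarrow> int) \<Rightarrow> int" where
  "tuple_size n lam = (\<Sum>i = 1..n. lam i)"

definition unitary_integral ::
  "(complex ^ 'n ^ 'n) measure \<Rightarrow> nat \<Rightarrow> (nat \<Rightarrow> int) \<Rightarrow> (nat \<Rightarrow> int) \<Rightarrow> complex \<Rightarrow> complex" where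
  "unitary_integral H q lam mu z =
     (if is_partition CARD('n) lam \<and> is_partition CARD('n) mu
      then LINT M|H. schur_matrix lam M * schur_matrix mu (cnj_matrix M) *
             det (mat 1 + M) ^ q * exp (z * trace (cnj_matrix M))
      else 0)"

text \<open>The partition with \<open>x i = lam (n - i + 1) + i - 1\<close>.\<close>

definition partition_of_tuple :: "nat \<Rightarrow> (nat \<Rightarrow> int) \<Rightarrow> nat \<Rightarrow> int" where
  "partition_of_tuple n x = (\<lambda>i. x (n + 1 - i) - int (n - i))"

definition integral_coeff ::
  "(complex ^ 'n ^ 'n) measure \<Rightarrow> nat \<Rightarrow> nat \<Rightarrow> (nat \<Rightarrow> int) \<Rightarrow> (nat \<Rightarrow> int) \<Rightarrow> complex" where
  "integral_coeff H q k x y =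
     (if is_strict_tuple CARD('n) x \<and> is_strict_tuple CARD('n) y
      then (THE b. \<forall>z. (\<lambda>k. b k * z ^ k / fact k) sums
              unitary_integral H q (partition_of_tuple CARD('n) x)
                (partition_of_tuple CARD('n) y) z) k
      else 0)"

end

theory Submission
  imports Defs "HOL-Complex_Analysis.Cauchy_Integral_Formula"
begin

text \<open>
  Every equation is the statement that a divergence integrates to zero over the unitary group.
  On \<open>U(n)\<close> the complex conjugate of \<open>M\<close> has the same eigenvalues as the inverse of \<open>M\<close>, so the
  integrand is a function of \<open>M\<close> and its inverse that can be differentiated along the complex
  matrix flow \<open>M \<mapsto> M + t X M\<close> for any matrix \<open>X\<close>. Left invariance of Haar measure makes the integral
  of such a derivative vanish (\<open>haar_derivative_matrix_unit\<close>). Letting \<open>X\<close> depend on \<open>M\<close> adds a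
  divergence term (\<open>haar_divergence\<close>). The first equation comes from \<open>X = M\<^sup>-\<^sup>1 + 1\<close>, that is
  from the flow \<open>M \<mapsto> M + t (1 + M)\<close>, and the second one from \<open>X = M + 1\<close>, that is from
  \<open>M \<mapsto> M + t (M + M\<^sup>2)\<close>. The summand \<open>1\<close> is what makes the logarithmic derivative of
  \<open>det (1 + M)\<close> polynomial in \<open>M\<close>.

  It remains to differentiate Schur functions in the directions \<open>M\<^sup>-\<^sup>1\<close>, \<open>1\<close> and \<open>M\<close>. Newton's
  identity expresses the derivative of the generating function of the complete homogeneous
  functions through traces of powers of \<open>M\<close> (\<open>left_derivative_homogeneous\<close>). In the three
  directions this gives \<open>h\<^sub>k \<mapsto> (k - 1 + n) h\<^sub>k\<^sub>-\<^sub>1\<close>, \<open>h\<^sub>k \<mapsto> k h\<^sub>k\<close> and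
  \<open>h\<^sub>k \<mapsto> (k + 1) h\<^sub>k\<^sub>+\<^sub>1 - h\<^sub>1 h\<^sub>k\<close>. Inside a Jacobi-Trudi determinant the factor in front
  splits into a part that depends on the row only, which yields the shifted Schur functions, and a
  part that depends on the column. The second part is right multiplication of the rows by a fixed
  matrix \<open>B\<close> and contributes \<open>tr B\<close> times the determinant (\<open>perm_det_deriv_matrix_mult\<close>). Since
  the \<open>h\<^sub>k\<close> satisfy a linear recurrence of order \<open>n\<close>, shifting all rows is also such a
  multiplication, by a companion matrix, and the multiplication rules of Schur functions by the
  power sums of degree 1 and 2 follow from the same trace formula.

  The argument is carried out for the Taylor coefficients in \<open>z\<close> of the integrals, whose
  integrands contain \<open>(tr M\<^sup>-\<^sup>1)\<^sup>k\<close> instead of the exponential and are polynomial in the entries of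
  \<open>M\<close> and of its conjugate. Summation over \<open>k\<close> then gives part (i), and the substitution
  \<open>x\<^sub>i = \<lambda>\<^sub>n\<^sub>-\<^sub>i\<^sub>+\<^sub>1 + i - 1\<close> gives part (ii).
\<close>

text \<open>The symbol \<open>$\<close> is kept for the components of vectors and matrices only.\<close>

no_notation fps_nth (infixl \<open>$\<close> 75)

section \<open>Determinants and Jacobi-Trudi determinants\<close>

text \<open>Rows and columns are numbered by \<open>{1..n}\<close>, and not by a finite type, so that the entries of a
  Jacobi-Trudi matrix can be written with the index \<open>lam i - i + j\<close>.\<close>

definition perm_det :: "nat \<Rightarrow> (nat \<Rightarrow> nat \<Rightarrow> complex) \<Rightarrow> complex" where
  "perm_det n A = (\<Sum>p | p permutes {1..n}. of_int (sign p) * (\<Prod>i = 1..n. A i (p i)))"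

lemma perm_det_cong:
  assumes "\<And>i j. i \<in> {1..n} \<Longrightarrow> j \<in> {1..n} \<Longrightarrow> A i j = B i j"
  shows "perm_det n A = perm_det n B"
  unfolding perm_det_def
proof (intro sum.cong refl)
  fix p assume "p \<in> {p. p permutes {1..n}}"
  then have "p i \<in> {1..n}" if "i \<in> {1..n}" for i
    using that permutes_in_image by fastforce
  then show "of_int (sign p) * (\<Prod>i = 1..n. A i (p i)) = of_int (sign p) * (\<Prod>i = 1..n. B i (p i))"
    using assms by (metis (no_types, lifting) prod.cong)
qed

lemma perm_det_swap_columns:
  assumes "a \<in> {1..n}" "b \<in> {1..n}" "a \<noteq> b"
  shows "perm_det n (\<lambda>i j. A i (Transposition.transpose a b j)) = - perm_det n A"
proof -
  let ?t = "Transposition.transpose a b"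
  have t: "?t permutes {1..n}"
    using assms by (simp add: permutes_swap_id)
  have "perm_det n A = (\<Sum>p | p permutes {1..n}. of_int (sign (?t \<circ> p)) * (\<Prod>i = 1..n. A i ((?t \<circ> p) i)))"
    unfolding perm_det_def by (rule setum_permutations_compose_left [OF t])
  also have "\<dots> = (\<Sum>p | p permutes {1..n}. - (of_int (sign p) * (\<Prod>i = 1..n. A i (?t (p i)))))"
  proof (intro sum.cong refl)
    fix p assume "p \<in> {p. p permutes {1..n}}"
    then have "sign (?t \<circ> p) = sign ?t * sign p"
      using t by (intro sign_compose) (auto intro: permutes_imp_permutation)
    then show "of_int (sign (?t \<circ> p)) * (\<Prod>i = 1..n. A i ((?t \<circ> p) i)) =
        - (of_int (sign p) * (\<Prod>i = 1..n. A i (?t (p i)))::complex)"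
      using assms(3) by (simp add: sign_swap_id)
  qed
  finally show ?thesis
    by (simp add: perm_det_def sum_negf)
qed

lemma perm_det_swap_rows:
  assumes "a \<in> {1..n}" "b \<in> {1..n}" "a \<noteq> b"
  shows "perm_det n (\<lambda>i. A (Transposition.transpose a b i)) = - perm_det n A"
proof -
  let ?t = "Transposition.transpose a b"
  have t: "?t permutes {1..n}"
    using assms by (simp add: permutes_swap_id)
  have "perm_det n (\<lambda>i. A (?t i)) = (\<Sum>p | p permutes {1..n}. of_int (sign (p \<circ> ?t)) * (\<Prod>i = 1..n. A (?t i) ((p \<circ> ?t) i)))"
    unfolding perm_det_def by (rule sum_permutations_compose_right [OF t])
  also have "\<dots> = (\<Sum>p | p permutes {1..n}. - (of_int (sign p) * (\<Prod>i = 1..n. A i (p i))))"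
  proof (intro sum.cong refl)
    fix p assume "p \<in> {p. p permutes {1..n}}"
    then have "sign (p \<circ> ?t) = sign p * sign ?t"
      using t by (intro sign_compose) (auto intro: permutes_imp_permutation)
    moreover have "(\<Prod>i = 1..n. A (?t i) (p (?t i))) = (\<Prod>i = 1..n. A i (p i))"
      using prod.permute [OF t, of "\<lambda>i. A i (p i)"] by (simp add: o_def)
    ultimately show "of_int (sign (p \<circ> ?t)) * (\<Prod>i = 1..n. A (?t i) ((p \<circ> ?t) i)) =
        - (of_int (sign p) * (\<Prod>i = 1..n. A i (p i))::complex)"
      using assms(3) by (simp add: sign_swap_id)
  qed
  finally show ?thesis
    by (simp add: perm_det_def sum_negf)
qed

lemma perm_det_identical_rows:
  assumes "a \<in> {1..n}" "b \<in> {1..n}" "a \<noteq> b" "\<And>j. j \<in> {1..n} \<Longrightarrow> A a j = A b j"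
  shows "perm_det n A = 0"
proof -
  have "perm_det n (\<lambda>i. A (Transposition.transpose a b i)) = perm_det n A"
    using assms(4) by (intro perm_det_cong) (auto simp: Transposition.transpose_def)
  with perm_det_swap_rows [OF assms(1-3), of A] show ?thesis by simp
qed

lemma perm_det_identical_columns:
  assumes "a \<in> {1..n}" "b \<in> {1..n}" "a \<noteq> b" "\<And>i. i \<in> {1..n} \<Longrightarrow> A i a = A i b"
  shows "perm_det n A = 0"
proof -
  have "perm_det n (\<lambda>i j. A i (Transposition.transpose a b j)) = perm_det n A"
    using assms(4) by (intro perm_det_cong) (auto simp: Transposition.transpose_def)
  with perm_det_swap_columns [OF assms(1-3), of A] show ?thesis by simp
qed

lemma perm_det_row_expand:
  assumes "i \<in> {1..n}"
  shows "perm_det n (A(i := v)) =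
    (\<Sum>p | p permutes {1..n}. of_int (sign p) * (v (p i) * (\<Prod>k\<in>{1..n} - {i}. A k (p k))))"
  unfolding perm_det_def
proof (intro sum.cong refl arg_cong2[where f = "(*)"])
  fix p
  have "(\<Prod>k = 1..n. (A(i := v)) k (p k)) = (A(i := v)) i (p i) * (\<Prod>k\<in>{1..n} - {i}. (A(i := v)) k (p k))"
    using assms by (intro prod.remove) auto
  then show "(\<Prod>k = 1..n. (A(i := v)) k (p k)) = v (p i) * (\<Prod>k\<in>{1..n} - {i}. A k (p k))"
    by simp
qed

text \<open>The derivative of the determinant at \<open>A\<close> in the direction \<open>V\<close>.\<close>

definition perm_det_deriv ::
  "nat \<Rightarrow> (nat \<Rightarrow> nat \<Rightarrow> complex) \<Rightarrow> (nat \<Rightarrow> nat \<Rightarrow> complex) \<Rightarrow> complex" where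
  "perm_det_deriv n A V = (\<Sum>i = 1..n. perm_det n (A(i := V i)))"

lemma perm_det_row_add:
  assumes "i \<in> {1..n}"
  shows "perm_det n (A(i := \<lambda>j. u j + v j)) = perm_det n (A(i := u)) + perm_det n (A(i := v))"
  by (simp add: perm_det_row_expand[OF assms] algebra_simps sum.distrib)

lemma perm_det_row_scale:
  assumes "i \<in> {1..n}"
  shows "perm_det n (A(i := \<lambda>j. c * v j)) = c * perm_det n (A(i := v))"
  by (simp add: perm_det_row_expand[OF assms] sum_distrib_left mult_ac)

lemma perm_det_deriv_add:
  "perm_det_deriv n A (\<lambda>i j. U i j + V i j) = perm_det_deriv n A U + perm_det_deriv n A V"
  by (simp add: perm_det_deriv_def perm_det_row_add sum.distrib)

lemma perm_det_deriv_cong: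
  assumes "\<And>i j. i \<in> {1..n} \<Longrightarrow> j \<in> {1..n} \<Longrightarrow> A i j = A' i j"
    and "\<And>i j. i \<in> {1..n} \<Longrightarrow> j \<in> {1..n} \<Longrightarrow> V i j = V' i j"
  shows "perm_det_deriv n A V = perm_det_deriv n A' V'"
  unfolding perm_det_deriv_def by (intro sum.cong refl perm_det_cong) (use assms in auto)

text \<open>This is the derivative of \<open>det (A (1 + t B))\<close> at \<open>t = 0\<close>. Grouped by the column \<open>j\<close> that
  is changed, the sum consists of the determinants of \<open>A\<close> with column \<open>j\<close> replaced by column
  \<open>l\<close>, with weight \<open>B l j\<close>, and these vanish for \<open>l \<noteq> j\<close>.\<close>

lemma perm_det_deriv_matrix_mult:
  "perm_det_deriv n A (\<lambda>i j. \<Sum>l = 1..n. A i l * B l j) = (\<Sum>l = 1..n. B l l) * perm_det n A"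
proof -
  let ?P = "{p. p permutes {1..n}}"
  define R where "R = (\<lambda>p i. \<Prod>k\<in>{1..n} - {i}. A k (p k))"
  define col where "col = (\<lambda>j l. perm_det n (\<lambda>i k. A i (if k = j then l else k)))"
  \<comment> \<open>The sum over \<open>i\<close> becomes a sum over the column \<open>j = p i\<close>.\<close>
  have col_expand: "col j l = (\<Sum>p\<in>?P. of_int (sign p) * (A (inv p j) l * R p (inv p j)))"
    if j: "j \<in> {1..n}" for j l
    unfolding col_def perm_det_def
  proof (intro sum.cong refl arg_cong2[where f = "(*)"])
    fix p assume p: "p \<in> ?P"
    then have pj: "inv p j \<in> {1..n}" "p (inv p j) = j"
      using j permutes_in_image[OF permutes_inv] permutes_inverses(1) by fastforce+
    have "(\<Prod>i = 1..n. A i (if p i = j then l else p i)) =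
       A (inv p j) (if p (inv p j) = j then l else p (inv p j)) *
       (\<Prod>i\<in>{1..n} - {inv p j}. A i (if p i = j then l else p i))"
      using pj by (intro prod.remove) auto
    also have "(\<Prod>i\<in>{1..n} - {inv p j}. A i (if p i = j then l else p i)) = R p (inv p j)"
      unfolding R_def using p permutes_inverses(2)[of p "{1..n}"] by (intro prod.cong) auto
    finally show "(\<Prod>i = 1..n. A i (if p i = j then l else p i)) = A (inv p j) l * R p (inv p j)"
      using pj by simp
  qed
  have col_diag: "col j l = (if j = l then perm_det n A else 0)"
    if "j \<in> {1..n}" "l \<in> {1..n}" for j l
  proof (cases "j = l")
    case True
    then show ?thesis
      unfolding col_def by (auto intro: perm_det_cong)
  next
    case False
    then show ?thesis
      unfolding col_def using that by (subst perm_det_identical_columns[of j _ l]) auto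
  qed
  have "perm_det_deriv n A (\<lambda>i j. \<Sum>l = 1..n. A i l * B l j) =
      (\<Sum>i = 1..n. \<Sum>p\<in>?P. of_int (sign p) * ((\<Sum>l = 1..n. A i l * B l (p i)) * R p i))"
    unfolding perm_det_deriv_def R_def by (intro sum.cong refl perm_det_row_expand)
  also have "\<dots> = (\<Sum>p\<in>?P. \<Sum>i = 1..n. of_int (sign p) * ((\<Sum>l = 1..n. A i l * B l (p i)) * R p i))"
    by (rule sum.swap)
  also have "\<dots> = (\<Sum>p\<in>?P. \<Sum>j = 1..n. of_int (sign p) *
      ((\<Sum>l = 1..n. A (inv p j) l * B l j) * R p (inv p j)))"
  proof (rule sum.cong[OF refl])
    fix p assume "p \<in> ?P"
    then have p: "p permutes {1..n}" by simp
    show "(\<Sum>i = 1..n. of_int (sign p) * ((\<Sum>l = 1..n. A i l * B l (p i)) * R p i)) =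
      (\<Sum>j = 1..n. of_int (sign p) * ((\<Sum>l = 1..n. A (inv p j) l * B l j) * R p (inv p j)))"
      using sum.permute[OF p, of "\<lambda>j. of_int (sign p) * ((\<Sum>l = 1..n. A (inv p j) l * B l j) * R p (inv p j))"]
      by (simp add: o_def permutes_inverses(2)[OF p])
  qed
  also have "\<dots> = (\<Sum>j = 1..n. \<Sum>l = 1..n. B l j * col j l)"
  proof (subst sum.swap, intro sum.cong refl)
    fix j assume j: "j \<in> {1..n}"
    show "(\<Sum>p\<in>?P. of_int (sign p) * ((\<Sum>l = 1..n. A (inv p j) l * B l j) * R p (inv p j))) =
        (\<Sum>l = 1..n. B l j * col j l)"
      unfolding col_expand[OF j] sum_distrib_left sum_distrib_right
      by (subst sum.swap) (simp add: mult_ac)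
  qed
  also have "\<dots> = (\<Sum>j = 1..n. B j j * perm_det n A)"
    by (intro sum.cong refl) (simp add: col_diag if_distrib cong: if_cong)
  finally show ?thesis by (simp add: sum_distrib_right)
qed

definition jacobi_trudi :: "nat \<Rightarrow> (int \<Rightarrow> complex) \<Rightarrow> (nat \<Rightarrow> int) \<Rightarrow> complex" where
  "jacobi_trudi n h lam = perm_det n (\<lambda>i j. h (lam i - int i + int j))"

text \<open>The derivative of the Jacobi-Trudi determinant when \<open>h\<close> moves in the direction \<open>h'\<close>.\<close>

definition jacobi_trudi_deriv ::
  "nat \<Rightarrow> (int \<Rightarrow> complex) \<Rightarrow> (int \<Rightarrow> complex) \<Rightarrow> (nat \<Rightarrow> int) \<Rightarrow> complex" where
  "jacobi_trudi_deriv n h h' lam =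
     perm_det_deriv n (\<lambda>i j. h (lam i - int i + int j)) (\<lambda>i j. h' (lam i - int i + int j))"

lemma jacobi_trudi_update:
  "jacobi_trudi n h (lam(i := lam i + c)) =
     perm_det n ((\<lambda>i j. h (lam i - int i + int j))(i := \<lambda>j. h (lam i - int i + int j + c)))"
  unfolding jacobi_trudi_def by (intro perm_det_cong) (auto simp: algebra_simps)

lemma jacobi_trudi_weighted_shift:
  "perm_det_deriv n (\<lambda>i j. h (lam i - int i + int j))
     (\<lambda>i j. w i * h (lam i - int i + int j + c)) =
   (\<Sum>i = 1..n. w i * jacobi_trudi n h (lam(i := lam i + c)))"
  unfolding perm_det_deriv_def
  by (intro sum.cong refl) (simp add: jacobi_trudi_update perm_det_row_scale)

text \<open>In row \<open>i\<close> and column \<open>j\<close> the factor is \<open>(lam i - i) + j\<close>; its column part is a diagonal matrix,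
  whose trace cancels the sum of the \<open>- i\<close>.\<close>

lemma jacobi_trudi_deriv_euler:
  "jacobi_trudi_deriv n h (\<lambda>k. of_int k * h k) lam = of_int (tuple_size n lam) * jacobi_trudi n h lam"
proof -
  let ?A = "\<lambda>i j. h (lam i - int i + int j)"
  have "jacobi_trudi_deriv n h (\<lambda>k. of_int k * h k) lam =
     perm_det_deriv n ?A (\<lambda>i j. of_int (lam i - int i) * h (lam i - int i + int j + 0) +
        (\<Sum>l = 1..n. ?A i l * (if l = j then of_nat l else 0)))"
    unfolding jacobi_trudi_deriv_def
    by (intro perm_det_deriv_cong refl) (simp add: if_distrib algebra_simps cong: if_cong)
  also have "\<dots> = (\<Sum>i = 1..n. of_int (lam i - int i) * jacobi_trudi n h (lam(i := lam i + 0))) +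
      (\<Sum>l = 1..n. of_nat l) * jacobi_trudi n h lam"
    unfolding perm_det_deriv_add perm_det_deriv_matrix_mult
      jacobi_trudi_weighted_shift[of n h lam "\<lambda>i. of_int (lam i - int i)" 0]
    by (simp add: jacobi_trudi_def)
  also have "\<dots> = ((\<Sum>i = 1..n. of_int (lam i - int i)) + (\<Sum>i = 1..n. of_int (int i))) * jacobi_trudi n h lam"
    by (simp only: fun_upd_triv add_0_right of_int_of_nat_eq flip: sum_distrib_right) (simp only: distrib_right)
  also have "(\<Sum>i = 1..n. of_int (lam i - int i)) + (\<Sum>i = 1..n. of_int (int i)) = (of_int (tuple_size n lam) :: complex)"
    by (simp add: tuple_size_def flip: sum.distrib of_int_sum)
  finally show ?thesis .
qed

text \<open>The factor is \<open>(lam i - i + n) + (j - 1)\<close>; its column part moves column \<open>j - 1\<close> to column \<open>j\<close>,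
  which is a strictly triangular matrix and has trace zero.\<close>

lemma jacobi_trudi_deriv_down:
  "jacobi_trudi_deriv n h (\<lambda>k. of_int (k - 1 + int n) * h (k - 1)) lam =
     (\<Sum>i = 1..n. of_int (lam i - int i + int n) * jacobi_trudi n h (lam(i := lam i - 1)))"
proof -
  let ?A = "\<lambda>i j. h (lam i - int i + int j)"
  have "jacobi_trudi_deriv n h (\<lambda>k. of_int (k - 1 + int n) * h (k - 1)) lam =
     perm_det_deriv n ?A (\<lambda>i j. of_int (lam i - int i + int n) * h (lam i - int i + int j + (-1)) +
        (\<Sum>l = 1..n. ?A i l * (if j = Suc l then of_nat l else 0)))"
    unfolding jacobi_trudi_deriv_def
  proof (intro perm_det_deriv_cong refl)
    fix i j assume "i \<in> {1..n}" "j \<in> {1..n}"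
    then obtain m where m: "j = Suc m" "m \<le> n" by (cases j) auto
    have "(\<Sum>l = 1..n. ?A i l * (if j = Suc l then of_nat l else 0)) =
        (\<Sum>l = 1..n. if l = m then ?A i m * of_nat m else 0)"
      by (intro sum.cong refl) (auto simp: m)
    also have "\<dots> = ?A i m * of_nat m"
      using m by (subst sum.delta) auto
    finally show "of_int (lam i - int i + int j - 1 + int n) * h (lam i - int i + int j - 1) =
        of_int (lam i - int i + int n) * h (lam i - int i + int j + - 1) +
        (\<Sum>l = 1..n. ?A i l * (if j = Suc l then of_nat l else 0))"
      by (simp add: m algebra_simps)
  qed
  also have "\<dots> = (\<Sum>i = 1..n. of_int (lam i - int i + int n) * jacobi_trudi n h (lam(i := lam i + (-1))))"
    unfolding perm_det_deriv_add perm_det_deriv_matrix_mult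
      jacobi_trudi_weighted_shift[of n h lam "\<lambda>i. of_int (lam i - int i + int n)" "-1"] by simp
  finally show ?thesis by simp
qed

text \<open>The recurrence that \<open>h\<close> satisfies when its generating function is the reciprocal of the polynomial
  \<open>1 + d\<^sub>1 t + \<dots> + d\<^sub>n t\<^sup>n\<close>.\<close>

definition linear_recurrence :: "nat \<Rightarrow> (nat \<Rightarrow> complex) \<Rightarrow> (int \<Rightarrow> complex) \<Rightarrow> bool" where
  "linear_recurrence n d h \<longleftrightarrow> (\<forall>k\<ge>1. h k = - (\<Sum>m = 1..n. d m * h (k - int m)))"

text \<open>Right multiplication by this matrix advances \<open>n\<close> consecutive terms of the recurrence by one step.\<close>

definition companion :: "nat \<Rightarrow> (nat \<Rightarrow> complex) \<Rightarrow> nat \<Rightarrow> nat \<Rightarrow> complex" where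
  "companion n d l j = (if j = n then - d (n + 1 - l) else if l = Suc j then 1 else 0)"

lemma companion_shift:
  assumes rec: "linear_recurrence n d h" and k: "k \<ge> - int n" and j: "j \<in> {1..n}"
  shows "h (k + int j + 1) = (\<Sum>l = 1..n. h (k + int l) * companion n d l j)"
proof (cases "j = n")
  case True
  have "(\<Sum>l = 1..n. h (k + int l) * companion n d l j) = (\<Sum>l = 1..n. - (d (n + 1 - l) * h (k + int l)))"
    by (simp add: companion_def True mult_ac)
  also have "\<dots> = (\<Sum>m = 1..n. - (d m * h (k + int n + 1 - int m)))"
    by (rule sum.reindex_bij_witness[of _ "\<lambda>m. n + 1 - m" "\<lambda>m. n + 1 - m"]) (auto simp: of_nat_diff algebra_simps)
  also have "\<dots> = h (k + int n + 1)"
    using rec k by (simp add: linear_recurrence_def sum_negf)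
  finally show ?thesis by (simp add: True)
next
  case False
  have "(\<Sum>l = 1..n. h (k + int l) * companion n d l j) = (\<Sum>l = 1..n. if l = Suc j then h (k + int l) else 0)"
    using False by (intro sum.cong) (auto simp: companion_def)
  also have "\<dots> = h (k + int (Suc j))"
    using False j by (subst sum.delta) auto
  finally show ?thesis by (simp add: algebra_simps)
qed

lemma trace_companion:
  assumes "n \<ge> 1"
  shows "(\<Sum>l = 1..n. companion n d l l * w l) = - d 1 * w n"
proof -
  have "(\<Sum>l = 1..n. companion n d l l * w l) = (\<Sum>l = 1..n. if l = n then - d 1 * w n else 0)"
    by (intro sum.cong) (auto simp: companion_def)
  then show ?thesis using assms by simp
qed

lemma trace_companion_square:
  assumes n: "n \<ge> 1" and d: "n = 1 \<Longrightarrow> d 2 = 0"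
  shows "(\<Sum>l = 1..n. \<Sum>m = 1..n. companion n d l m * companion n d m l) = (d 1)\<^sup>2 - 2 * d 2"
proof -
  have eq: "companion n d l m * companion n d m l =
     (if m = n then if l = n then (d 1)\<^sup>2 else 0 else 0) +
     (if m = n then if Suc l = n then - d 2 else 0 else 0) +
     (if Suc m = n then if l = n then - d 2 else 0 else 0)" if "l \<in> {1..n}" "m \<in> {1..n}" for l m
    using that by (auto simp: companion_def power2_eq_square numeral_2_eq_2)
  obtain k where k: "n = Suc k" using n by (cases n) auto
  have "(\<Sum>l = 1..n. \<Sum>m = 1..n. companion n d l m * companion n d m l) =
     (\<Sum>l = 1..n. \<Sum>m = 1..n. (if m = n then if l = n then (d 1)\<^sup>2 else 0 else 0) +
     (if m = n then if Suc l = n then - d 2 else 0 else 0) +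
     (if Suc m = n then if l = n then - d 2 else 0 else 0))"
    by (intro sum.cong refl eq)
  also have "\<dots> = (d 1)\<^sup>2 - 2 * d 2"
    using d n by (cases "k = 0") (auto simp: k sum.distrib)
  finally show ?thesis .
qed

text \<open>Raising one row by one is right multiplication of this row by the companion matrix, so the sum is
  the trace of the companion matrix times the determinant.\<close>

lemma jacobi_trudi_pieri:
  assumes n: "n \<ge> 1" and rec: "linear_recurrence n d h"
    and lam: "\<And>i. i \<in> {1..n} \<Longrightarrow> lam i - int i \<ge> - int n"
  shows "(\<Sum>i = 1..n. jacobi_trudi n h (lam(i := lam i + 1))) = - d 1 * jacobi_trudi n h lam"
proof -
  let ?A = "\<lambda>i j. h (lam i - int i + int j)"
  have "(\<Sum>i = 1..n. jacobi_trudi n h (lam(i := lam i + 1))) =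
      perm_det_deriv n ?A (\<lambda>i j. 1 * h (lam i - int i + int j + 1))"
    using jacobi_trudi_weighted_shift[of n h lam "\<lambda>_. 1" 1] by simp
  also have "\<dots> = perm_det_deriv n ?A (\<lambda>i j. \<Sum>l = 1..n. ?A i l * companion n d l j)"
    by (intro perm_det_deriv_cong refl) (simp only: mult_1 companion_shift[OF rec lam])
  finally show ?thesis
    unfolding perm_det_deriv_matrix_mult
    using trace_companion[OF n, of d "\<lambda>_. 1"] by (simp add: jacobi_trudi_def)
qed

text \<open>As in \<open>jacobi_trudi_pieri\<close>, with the square of the companion matrix. For \<open>n = 1\<close> the value
  \<open>d 2\<close> lies outside the recurrence and has to be zero for the trace formula.\<close>

lemma jacobi_trudi_power_sum_2:
  assumes n: "n \<ge> 1" and rec: "linear_recurrence n d h" and d: "n = 1 \<Longrightarrow> d 2 = 0"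
    and lam: "\<And>i. i \<in> {1..n} \<Longrightarrow> lam i - int i \<ge> - int n"
  shows "(\<Sum>i = 1..n. jacobi_trudi n h (lam(i := lam i + 2))) =
    ((d 1)\<^sup>2 - 2 * d 2) * jacobi_trudi n h lam"
proof -
  let ?A = "\<lambda>i j. h (lam i - int i + int j)"
  have trace: "(\<Sum>l = 1..n. \<Sum>m = 1..n. companion n d l m * companion n d m l) = (d 1)\<^sup>2 - 2 * d 2"
    using trace_companion_square[of n d] n d by blast
  have "(\<Sum>i = 1..n. jacobi_trudi n h (lam(i := lam i + 2))) =
      perm_det_deriv n ?A (\<lambda>i j. 1 * h (lam i - int i + int j + 2))"
    using jacobi_trudi_weighted_shift[of n h lam "\<lambda>_. 1" 2] by simp
  also have "\<dots> = perm_det_deriv n ?A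
      (\<lambda>i j. \<Sum>l = 1..n. ?A i l * (\<Sum>m = 1..n. companion n d l m * companion n d m j))"
  proof (intro perm_det_deriv_cong refl)
    fix i j assume i: "i \<in> {1..n}" and j: "j \<in> {1..n}"
    have "h (lam i - int i + int j + 2) = h ((lam i - int i + 1) + int j + 1)"
      by (simp add: algebra_simps)
    also have "\<dots> = (\<Sum>m = 1..n. h (lam i - int i + 1 + int m) * companion n d m j)"
      using lam[OF i] by (intro companion_shift[OF rec _ j]) simp
    also have "\<dots> = (\<Sum>m = 1..n. h (lam i - int i + int m + 1) * companion n d m j)"
      by (simp add: algebra_simps)
    also have "\<dots> = (\<Sum>m = 1..n. (\<Sum>l = 1..n. ?A i l * companion n d l m) * companion n d m j)"
      by (intro sum.cong refl) (simp only: companion_shift[OF rec lam[OF i]])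
    also have "\<dots> = (\<Sum>l = 1..n. ?A i l * (\<Sum>m = 1..n. companion n d l m * companion n d m j))"
      unfolding sum_distrib_left sum_distrib_right by (subst sum.swap) (simp only: mult_ac)
    finally show "1 * h (lam i - int i + int j + 2) = \<dots>" by simp
  qed
  finally show ?thesis
    unfolding perm_det_deriv_matrix_mult trace jacobi_trudi_def .
qed

text \<open>The factor is \<open>(lam i - i + 1) + j\<close>; its column part is the companion matrix times the diagonal
  matrix of the \<open>j\<close>. Its trace \<open>- n d\<^sub>1\<close> cancels the contribution of the term \<open>d 1 * h k\<close>.\<close>

lemma jacobi_trudi_deriv_up:
  assumes n: "n \<ge> 1" and rec: "linear_recurrence n d h"
    and lam: "\<And>i. i \<in> {1..n} \<Longrightarrow> lam i - int i \<ge> - int n"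
  shows "jacobi_trudi_deriv n h (\<lambda>k. of_int (k + 1) * h (k + 1) + d 1 * h k) lam =
    (\<Sum>i = 1..n. of_int (lam i - int i + 1) * jacobi_trudi n h (lam(i := lam i + 1)))"
proof -
  let ?A = "\<lambda>i j. h (lam i - int i + int j)"
  have "jacobi_trudi_deriv n h (\<lambda>k. of_int (k + 1) * h (k + 1) + d 1 * h k) lam =
     perm_det_deriv n ?A (\<lambda>i j. of_int (lam i - int i + 1) * h (lam i - int i + int j + 1) +
        ((\<Sum>l = 1..n. ?A i l * (companion n d l j * of_nat j)) +
         (\<Sum>l = 1..n. ?A i l * (if l = j then d 1 else 0))))"
    unfolding jacobi_trudi_deriv_def
  proof (intro perm_det_deriv_cong refl)
    fix i j assume i: "i \<in> {1..n}" and j: "j \<in> {1..n}"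
    have "(\<Sum>l = 1..n. ?A i l * (companion n d l j * of_nat j)) = of_nat j * h (lam i - int i + int j + 1)"
      using companion_shift[OF rec lam[OF i] j] by (simp add: sum_distrib_left mult_ac)
    moreover have "(\<Sum>l = 1..n. ?A i l * (if l = j then d 1 else 0)) = ?A i j * d 1"
      using j by (simp add: if_distrib cong: if_cong)
    ultimately show "of_int (lam i - int i + int j + 1) * h (lam i - int i + int j + 1) +
       d 1 * h (lam i - int i + int j) =
       of_int (lam i - int i + 1) * h (lam i - int i + int j + 1) +
        ((\<Sum>l = 1..n. ?A i l * (companion n d l j * of_nat j)) +
         (\<Sum>l = 1..n. ?A i l * (if l = j then d 1 else 0)))"
      by (simp add: algebra_simps)
  qed
  also have "\<dots> = (\<Sum>i = 1..n. of_int (lam i - int i + 1) * jacobi_trudi n h (lam(i := lam i + 1)))"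
    unfolding perm_det_deriv_add perm_det_deriv_matrix_mult
      jacobi_trudi_weighted_shift[of n h lam "\<lambda>i. of_int (lam i - int i + 1)" 1]
    using trace_companion[OF n, of d of_nat] n by simp
  finally show ?thesis .
qed

lemma jacobi_trudi_repeated:
  assumes "i \<in> {1..<n}" "lam (Suc i) = lam i + 1"
  shows "jacobi_trudi n h lam = 0"
  unfolding jacobi_trudi_def
  by (rule perm_det_identical_rows[of i _ "Suc i"]) (use assms in auto)

text \<open>The two determinants differ by an exchange of the rows \<open>i\<close> and \<open>i + 1\<close>.\<close>

lemma jacobi_trudi_straighten:
  assumes i: "i \<in> {1..<n}" and eq: "lam i = lam (Suc i)"
  shows "jacobi_trudi n h (lam(Suc i := lam (Suc i) + 2)) =
    - jacobi_trudi n h (lam(i := lam i + 1, Suc i := lam (Suc i) + 1))"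
proof -
  have "jacobi_trudi n h (lam(Suc i := lam (Suc i) + 2)) =
    perm_det n (\<lambda>k. (\<lambda>k j. h ((lam(i := lam i + 1, Suc i := lam (Suc i) + 1)) k - int k + int j))
       (Transposition.transpose i (Suc i) k))"
    unfolding jacobi_trudi_def using eq
    by (intro perm_det_cong) (auto simp: Transposition.transpose_def algebra_simps)
  also have "\<dots> = - perm_det n (\<lambda>k j. h ((lam(i := lam i + 1, Suc i := lam (Suc i) + 1)) k - int k + int j))"
    using i by (intro perm_det_swap_rows) auto
  finally show ?thesis by (simp add: jacobi_trudi_def)
qed

section \<open>The characteristic polynomial and Newton's identity\<close>

text \<open>The derivative of \<open>det ((1 + t B) A)\<close> at \<open>t = 0\<close>.\<close>

lemma sum_det_row_mult:
  fixes A B :: "'a::comm_ring_1 ^ 'n ^ 'n"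
  shows "(\<Sum>k\<in>UNIV. det (\<chi> i. if i = k then (B ** A) $ i else A $ i)) = trace B * det A"
proof -
  have row: "(B ** A) $ i = (\<Sum>l\<in>UNIV. B $ i $ l *s A $ l)" for i
    by (simp add: vec_eq_iff matrix_matrix_mult_def)
  have "det (\<chi> i. if i = k then (B ** A) $ i else A $ i) = B $ k $ k * det A" for k
  proof -
    have diag: "det (\<chi> i. if i = k then A $ l else A $ i) = (if l = k then det A else 0)" for l
    proof (cases "l = k")
      case True
      have "(\<chi> i. if i = k then A $ l else A $ i) = A"
        using True by (simp add: vec_eq_iff)
      then show ?thesis using True by simp
    next
      case False
      have "det (\<chi> i. if i = k then A $ l else A $ i) = 0"
        by (rule det_identical_rows[OF False]) (use False in \<open>simp add: row_def\<close>)
      then show ?thesis using False by simp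
    qed
    have "det (\<chi> i. if i = k then (B ** A) $ i else A $ i) =
        det (\<chi> i. if i = k then \<Sum>l\<in>UNIV. B $ i $ l *s A $ l else A $ i)"
      by (simp only: row)
    also have "\<dots> = (\<Sum>l\<in>UNIV. det (\<chi> i. if i = k then B $ i $ l *s A $ l else A $ i))"
      by (rule det_linear_row_sum) simp
    also have "\<dots> = (\<Sum>l\<in>UNIV. B $ k $ l * det (\<chi> i. if i = k then A $ l else A $ i))"
      by (intro sum.cong refl, subst det_row_mul[symmetric]) (simp cong: if_cong)
    also have "\<dots> = B $ k $ k * det A"
      by (simp add: diag if_distrib cong: if_cong)
    finally show ?thesis .
  qed
  then show ?thesis
    by (simp add: trace_def sum_distrib_right)
qed

lemma fps_deriv_prod:
  fixes f :: "'b \<Rightarrow> complex fps"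
  assumes "finite S"
  shows "fps_deriv (prod f S) = (\<Sum>k\<in>S. \<Prod>i\<in>S. if i = k then fps_deriv (f i) else f i)"
  using assms
proof (induction S rule: finite_induct)
  case (insert x S)
  have "(\<Sum>k\<in>S. \<Prod>i\<in>insert x S. if i = k then fps_deriv (f i) else f i) =
     (\<Sum>k\<in>S. f x * (\<Prod>i\<in>S. if i = k then fps_deriv (f i) else f i))"
    using insert.hyps by (intro sum.cong refl) auto
  moreover have "(\<Prod>i\<in>S. if i = x then fps_deriv (f i) else f i) = prod f S"
    using insert.hyps by (intro prod.cong) auto
  ultimately have "(\<Sum>k\<in>insert x S. \<Prod>i\<in>insert x S. if i = k then fps_deriv (f i) else f i) =
     fps_deriv (f x) * prod f S + f x * fps_deriv (prod f S)"
    using insert by (simp add: sum_distrib_left)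
  then show ?case
    using insert.hyps by (simp add: add.commute)
qed simp

lemma fps_deriv_det:
  fixes A :: "complex fps ^ 'n ^ 'n"
  shows "fps_deriv (det A) =
    (\<Sum>k\<in>UNIV. det (\<chi> i. if i = k then (\<chi> j. fps_deriv (A $ i $ j)) else A $ i))"
proof -
  let ?P = "{p. p permutes (UNIV :: 'n set)}"
  have sgn: "fps_deriv (of_int m * F) = of_int m * fps_deriv F" for m and F :: "complex fps"
    by (simp add: fps_of_int[symmetric])
  have "fps_deriv (det A) =
    (\<Sum>p\<in>?P. of_int (sign p) * fps_deriv (\<Prod>i\<in>UNIV. A $ i $ p i))"
    by (simp add: det_def fps_deriv_sum sgn)
  also have "\<dots> = (\<Sum>p\<in>?P. \<Sum>k\<in>UNIV. of_int (sign p) *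
      (\<Prod>i\<in>UNIV. (if i = k then (\<chi> j. fps_deriv (A $ i $ j)) else A $ i) $ p i))"
    by (simp add: fps_deriv_prod sum_distrib_left if_distrib[of "\<lambda>v. vec_nth v (p i)" for p i] cong: if_cong)
  also have "\<dots> = (\<Sum>k\<in>UNIV. \<Sum>p\<in>?P. of_int (sign p) *
      (\<Prod>i\<in>UNIV. (if i = k then (\<chi> j. fps_deriv (A $ i $ j)) else A $ i) $ p i))"
    by (rule sum.swap)
  finally show ?thesis
    by (simp add: det_def)
qed

primrec matrix_power :: "complex ^ 'n ^ 'n \<Rightarrow> nat \<Rightarrow> complex ^ 'n ^ 'n" where
  "matrix_power M 0 = mat 1"
| "matrix_power M (Suc r) = M ** matrix_power M r"

lemma matrix_power_commute: "matrix_power M r ** M = M ** matrix_power M r"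
  by (induction r) (simp_all add: matrix_mul_assoc[symmetric])

text \<open>This is \<open>det (1 - t M)\<close> as a polynomial in \<open>t\<close>.\<close>

definition reverse_charpoly :: "complex ^ 'n ^ 'n \<Rightarrow> complex poly" where
  "reverse_charpoly M = det (\<chi> i j. [:mat 1 $ i $ j, - M $ i $ j:])"

lemma poly_det: "poly (det A) t = det (\<chi> i j. poly (A $ i $ j) t)"
  for A :: "'a::comm_ring_1 poly ^ 'n ^ 'n"
  by (simp add: det_def poly_sum poly_prod)

lemma fps_of_poly_det: "fps_of_poly (det A) = det (\<chi> i j. fps_of_poly (A $ i $ j))"
  for A :: "complex poly ^ 'n ^ 'n"
  by (simp add: det_def fps_of_poly_sum fps_of_poly_prod of_int_poly fps_of_poly_smult fps_of_int)

lemma poly_reverse_charpoly: "poly (reverse_charpoly M) t = det (\<chi> i j. mat 1 $ i $ j - t * M $ i $ j)"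
  by (simp add: reverse_charpoly_def poly_det)

text \<open>The reversed polynomial of \<open>chi = det (t - M)\<close> and \<open>det (1 - t M)\<close> agree up to powers of \<open>t\<close>. Both
  have a nonzero constant term, so the powers agree as well; this also shows that \<open>chi\<close> is monic of
  degree \<open>n\<close>.\<close>

lemma reverse_charpoly_eigenvalues:
  fixes M :: "complex ^ 'n ^ 'n"
  shows "reverse_charpoly M = (\<Prod>x\<in>#eigenvalue_mset M. [:1, - x:])"
    and "degree (reverse_charpoly M) \<le> CARD('n)"
proof -
  define chi where "chi = det (mat [:0, 1:] - (\<chi> i j. [:M $ i $ j:]))"
  let ?D = "reverse_charpoly M" and ?n = "CARD('n)"
  have D0: "poly ?D 0 = 1"
    using det_I[where ?'a = complex and ?'n = 'n] by (simp add: poly_reverse_charpoly mat_def)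
  have chi: "poly chi s = det (\<chi> i j. s * mat 1 $ i $ j - M $ i $ j)" for s
    unfolding chi_def poly_det by (intro arg_cong[where f = det]) (simp add: vec_eq_iff mat_def)
  have scale: "poly ?D t = t ^ ?n * poly chi (inverse t)" if "t \<noteq> 0" for t
  proof -
    have "poly ?D t = det (\<chi> i. t *s (\<chi> j. inverse t * mat 1 $ i $ j - M $ i $ j))"
      unfolding poly_reverse_charpoly using that
      by (intro arg_cong[where f = det]) (simp add: vec_eq_iff algebra_simps)
    then show ?thesis
      unfolding det_rows_mul chi by simp
  qed
  have roots: "poly (monom 1 ?n * reflect_poly chi) t = poly (monom 1 (degree chi) * ?D) t" if "t \<in> - {0}" for t
    using that by (simp add: poly_reflect_poly_nz scale poly_monom)
  have eq: "monom 1 ?n * reflect_poly chi = monom 1 (degree chi) * ?D"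
  proof (rule ccontr)
    let ?P = "monom 1 ?n * reflect_poly chi - monom 1 (degree chi) * ?D"
    assume "\<not> ?thesis"
    then have "finite {t. poly ?P t = 0}"
      by (intro poly_roots_finite) simp
    moreover have "- {0} \<subseteq> {t. poly ?P t = 0}"
      using roots by auto
    ultimately have "finite (- {0::complex})"
      by (rule rev_finite_subset)
    then show False
      by (simp add: infinite_UNIV_char_0 Compl_eq_Diff_UNIV)
  qed
  have chi0: "chi \<noteq> 0"
  proof
    assume "chi = 0"
    then have "?D = 0" using eq by simp
    then show False using D0 by simp
  qed
  have "order 0 (monom 1 ?n * reflect_poly chi) = ?n"
    using chi0 by (subst order_mult) (auto simp: order_0_monom order_0I)
  moreover have "order 0 (monom 1 (degree chi) * ?D) = degree chi"
    using D0 by (subst order_mult) (auto simp: order_0_monom order_0I)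
  ultimately have deg: "degree chi = ?n"
    using eq by simp
  with eq have D: "?D = reflect_poly chi"
    by simp
  then have "lead_coeff chi = 1"
    using D0 by simp
  then have "chi = (\<Prod>x\<in>#eigenvalue_mset M. [:-x, 1:])"
    using complex_poly_decompose_multiset[of chi] by (simp add: chi_def eigenvalue_mset_def)
  moreover have "reflect_poly (\<Prod>x\<in>#E. [:-x, 1:]) = (\<Prod>x\<in>#E. [:1, -x:])" for E :: "complex multiset"
    by (induction E) (simp_all add: reflect_poly_mult reflect_poly_pCons' monom_altdef del: mult_pCons_left)
  ultimately show "?D = (\<Prod>x\<in>#eigenvalue_mset M. [:1, - x:])"
    using D by simp
  show "degree ?D \<le> ?n"
    using degree_reflect_poly_le[of chi] D deg by simp
qed

lemma fps_of_reverse_charpoly: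
  "fps_of_poly (reverse_charpoly M) = (\<Prod>x\<in>#eigenvalue_mset M. 1 - fps_const x * fps_X)"
proof -
  have "fps_of_poly (\<Prod>x\<in>#E. [:1, - x:]) = (\<Prod>x\<in>#E. 1 - fps_const x * fps_X)" for E :: "complex multiset"
    by (induction E) (simp_all add: fps_of_poly_mult fps_of_poly_pCons del: mult_pCons_left flip: fps_const_neg)
  then show ?thesis
    by (simp add: reverse_charpoly_eigenvalues)
qed

text \<open>The generating function of the complete homogeneous functions of the eigenvalues of \<open>M\<close>.\<close>

definition homogeneous_fps :: "complex ^ 'n ^ 'n \<Rightarrow> complex fps" where
  "homogeneous_fps M = inverse (fps_of_poly (reverse_charpoly M))"

lemma complete_homogeneous_eigenvalues:
  "complete_homogeneous (eigenvalue_mset M) k = (if k < 0 then 0 else fps_nth (homogeneous_fps M) (nat k))"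
proof -
  have "(\<Prod>x\<in>#E. inverse (1 - fps_const x * fps_X)) = inverse (\<Prod>x\<in>#E. 1 - fps_const x * fps_X)" for E :: "complex multiset"
    by (induction E) (simp_all add: fps_inverse_mult)
  then show ?thesis
    by (simp add: complete_homogeneous_def homogeneous_fps_def fps_of_reverse_charpoly)
qed

lemma reverse_charpoly_0: "fps_nth (fps_of_poly (reverse_charpoly M)) 0 = 1"
proof -
  have "fps_nth (\<Prod>x\<in>#E. 1 - fps_const x * fps_X) 0 = 1" for E :: "complex multiset"
    by (induction E) simp_all
  then show ?thesis by (simp only: fps_of_reverse_charpoly)
qed

lemma homogeneous_fps_mult: "fps_of_poly (reverse_charpoly M) * homogeneous_fps M = 1"
  unfolding homogeneous_fps_def
  by (rule inverse_mult_eq_1') (simp add: reverse_charpoly_0 del: fps_of_poly_nth)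

lemma homogeneous_fps_0 [simp]: "fps_nth (homogeneous_fps M) 0 = 1"
  using arg_cong[OF homogeneous_fps_mult[of M], of "\<lambda>F. fps_nth F 0"] reverse_charpoly_0[of M]
  by (simp del: fps_of_poly_nth)

definition power_sum_fps :: "complex ^ 'n ^ 'n \<Rightarrow> complex fps" where
  "power_sum_fps M = Abs_fps (\<lambda>r. trace (matrix_power M (Suc r)))"

text \<open>Jacobi's formula. With \<open>A = 1 - t M\<close> and \<open>B = - M (1 - t M)\<^sup>-\<^sup>1\<close>, the derivative of \<open>A\<close> with
  respect to \<open>t\<close> is \<open>B A\<close>, so that of the determinant is the trace of \<open>B\<close> times the
  determinant.\<close>

lemma fps_deriv_reverse_charpoly:
  fixes M :: "complex ^ 'n ^ 'n"
  shows "fps_deriv (fps_of_poly (reverse_charpoly M)) = - power_sum_fps M * fps_of_poly (reverse_charpoly M)"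
proof -
  define A :: "complex fps ^ 'n ^ 'n" where
    "A = (\<chi> i j. fps_const (mat 1 $ i $ j) - fps_const (M $ i $ j) * fps_X)"
  define B :: "complex fps ^ 'n ^ 'n" where
    "B = (\<chi> i j. - Abs_fps (\<lambda>r. matrix_power M (Suc r) $ i $ j))"
  have D: "fps_of_poly (reverse_charpoly M) = det A"
    unfolding reverse_charpoly_def fps_of_poly_det A_def
    by (intro arg_cong[where f = det]) (simp add: vec_eq_iff fps_of_poly_pCons flip: fps_const_neg)
  have BA: "(B ** A) $ i $ j = fps_deriv (A $ i $ j)" for i j
  proof (rule fps_ext)
    fix r
    have shift: "fps_nth (F * (fps_const c - fps_const e * fps_X)) m =
        fps_nth F m * c - (if m = 0 then 0 else fps_nth F (m - 1) * e)" for F c m and e :: complex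
      by (simp add: right_diff_distrib flip: mult.assoc)
    have "fps_nth ((B ** A) $ i $ j) r =
      (\<Sum>l\<in>UNIV. - (matrix_power M (Suc r) $ i $ l * mat 1 $ l $ j) +
         (if r = 0 then 0 else matrix_power M r $ i $ l * M $ l $ j))"
      by (cases r) (simp_all add: matrix_matrix_mult_def A_def B_def fps_sum_nth shift del: matrix_power.simps)
    also have "\<dots> = - (matrix_power M (Suc r) ** mat 1) $ i $ j + (if r = 0 then 0 else (matrix_power M r ** M) $ i $ j)"
      by (simp add: matrix_matrix_mult_def[of _ "mat 1"] matrix_matrix_mult_def[of "matrix_power M r" M]
          sum.distrib sum_negf sum_subtractf del: matrix_power.simps matrix_mul_rid)
    also have "\<dots> = (if r = 0 then - M $ i $ j else 0)"
      by (simp add: matrix_power_commute)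
    also have "\<dots> = fps_nth (fps_deriv (A $ i $ j)) r"
      by (simp add: A_def)
    finally show "fps_nth ((B ** A) $ i $ j) r = fps_nth (fps_deriv (A $ i $ j)) r" .
  qed
  have row: "(\<chi> j. fps_deriv (A $ i $ j)) = (B ** A) $ i" for i
    by (simp add: vec_eq_iff BA)
  have "fps_deriv (det A) = (\<Sum>k\<in>UNIV. det (\<chi> i. if i = k then (B ** A) $ i else A $ i))"
    unfolding fps_deriv_det row ..
  also have "\<dots> = trace B * det A"
    by (rule sum_det_row_mult)
  also have "trace B = - power_sum_fps M"
    by (rule fps_ext) (simp add: trace_def B_def power_sum_fps_def fps_sum_nth sum_negf)
  finally show ?thesis
    by (simp add: D)
qed

text \<open>Newton's identity between complete homogeneous functions and power sums.\<close>

lemma fps_deriv_homogeneous: "fps_deriv (homogeneous_fps M) = power_sum_fps M * homogeneous_fps M"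
proof -
  let ?D = "fps_of_poly (reverse_charpoly M)" and ?H = "homogeneous_fps M"
  have "?D * fps_deriv ?H - power_sum_fps M * (?D * ?H) = 0"
    using arg_cong[OF homogeneous_fps_mult[of M], of fps_deriv]
    by (simp add: fps_deriv_reverse_charpoly algebra_simps)
  then have "?D * (fps_deriv ?H - power_sum_fps M * ?H) = 0"
    by (simp add: algebra_simps)
  moreover have "?D \<noteq> 0"
    using reverse_charpoly_0[of M] by auto
  ultimately show ?thesis by simp
qed

lemma homogeneous_linear_recurrence:
  fixes M :: "complex ^ 'n ^ 'n"
  shows "linear_recurrence CARD('n) (coeff (reverse_charpoly M)) (complete_homogeneous (eigenvalue_mset M))"
  unfolding linear_recurrence_def
proof (intro allI impI)
  fix k :: int assume k: "k \<ge> 1"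
  let ?h = "complete_homogeneous (eigenvalue_mset M)" and ?d = "coeff (reverse_charpoly M)"
  obtain m where m: "k = int m" "m \<ge> 1"
    using k by (metis nat_0_le of_nat_1 of_nat_le_iff zero_le_one order_trans)
  define N where "N = max m CARD('n)"
  have "0 = (\<Sum>i = 0..m. ?d i * fps_nth (homogeneous_fps M) (m - i))"
    using arg_cong[OF homogeneous_fps_mult[of M], of "\<lambda>F. fps_nth F m"] m
    by (simp add: fps_mult_nth)
  also have "\<dots> = (\<Sum>i = 0..m. ?d i * ?h (k - int i))"
    by (intro sum.cong) (auto simp: complete_homogeneous_eigenvalues m nat_diff_distrib)
  also have "\<dots> = (\<Sum>i = 0..N. ?d i * ?h (k - int i))"
    by (intro sum.mono_neutral_left) (auto simp: complete_homogeneous_eigenvalues m N_def)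
  also have "\<dots> = (\<Sum>i = 0..CARD('n). ?d i * ?h (k - int i))"
    using reverse_charpoly_eigenvalues(2)[of M]
    by (intro sum.mono_neutral_right) (auto simp: N_def coeff_eq_0)
  also have "\<dots> = ?h k + (\<Sum>i = 1..CARD('n). ?d i * ?h (k - int i))"
    using reverse_charpoly_0[of M] by (simp add: sum.atLeast_Suc_atMost)
  finally show "?h k = - (\<Sum>i = 1..CARD('n). ?d i * ?h (k - int i))"
    by (simp add: eq_neg_iff_add_eq_0)
qed

lemma reverse_charpoly_traces:
  fixes M :: "complex ^ 'n ^ 'n"
  shows "coeff (reverse_charpoly M) 1 = - trace M"
    and "(coeff (reverse_charpoly M) 1)\<^sup>2 - 2 * coeff (reverse_charpoly M) 2 = trace (M ** M)"
    and "CARD('n) = 1 \<Longrightarrow> coeff (reverse_charpoly M) 2 = 0"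
proof -
  note eq = fps_deriv_reverse_charpoly[of M]
  show 1: "coeff (reverse_charpoly M) 1 = - trace M"
    using arg_cong[OF eq, of "\<lambda>F. fps_nth F 0"] reverse_charpoly_0[of M]
    by (simp add: power_sum_fps_def)
  show "(coeff (reverse_charpoly M) 1)\<^sup>2 - 2 * coeff (reverse_charpoly M) 2 = trace (M ** M)"
    using arg_cong[OF eq, of "\<lambda>F. fps_nth F 1"] reverse_charpoly_0[of M] 1
    by (simp add: power_sum_fps_def fps_mult_nth power2_eq_square algebra_simps numeral_2_eq_2)
  show "CARD('n) = 1 \<Longrightarrow> coeff (reverse_charpoly M) 2 = 0"
    using reverse_charpoly_eigenvalues(2)[of M] by (intro coeff_eq_0) simp
qed

section \<open>Derivatives along one-parameter subgroups of the unitary group\<close>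

abbreviation adjoint_matrix :: "complex ^ 'n ^ 'n \<Rightarrow> complex ^ 'n ^ 'n" where
  "adjoint_matrix M \<equiv> Finite_Cartesian_Product.transpose (cnj_matrix M)"

lemma adjoint_matrix_nth: "adjoint_matrix M $ i $ j = cnj (M $ j $ i)"
  by (simp add: Finite_Cartesian_Product.transpose_def cnj_matrix_def)

lemma adjoint_matrix_mult: "adjoint_matrix (A ** B) = adjoint_matrix B ** adjoint_matrix A"
  by (simp add: vec_eq_iff adjoint_matrix_nth matrix_matrix_mult_def mult.commute)

lemma unitary_group_iff: "M \<in> unitary_group \<longleftrightarrow> M ** adjoint_matrix M = mat 1 \<and> adjoint_matrix M ** M = mat 1"
  by (simp add: unitary_group_def)

lemma unitary_group_mult:
  assumes "A \<in> unitary_group" "B \<in> unitary_group"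
  shows "A ** B \<in> unitary_group"
proof -
  have "A ** B ** (adjoint_matrix B ** adjoint_matrix A) = A ** (B ** adjoint_matrix B) ** adjoint_matrix A"
    "adjoint_matrix B ** adjoint_matrix A ** (A ** B) = adjoint_matrix B ** (adjoint_matrix A ** A) ** B"
    by (simp_all only: matrix_mul_assoc)
  then show ?thesis
    using assms by (simp add: unitary_group_iff adjoint_matrix_mult)
qed

lemma compact_unitary_group: "compact (unitary_group :: (complex ^ 'n ^ 'n) set)"
proof -
  have "unitary_group = (\<Inter>i. \<Inter>j. {M :: complex ^ 'n ^ 'n.
      (M ** adjoint_matrix M) $ i $ j = mat 1 $ i $ j} \<inter> {M. (adjoint_matrix M ** M) $ i $ j = mat 1 $ i $ j})"
    by (auto simp: unitary_group_def vec_eq_iff)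
  also have "closed \<dots>"
    unfolding matrix_matrix_mult_def vec_lambda_beta adjoint_matrix_nth
    by (intro closed_INT ballI closed_Int closed_Collect_eq continuous_intros)
  finally have "closed (unitary_group :: (complex ^ 'n ^ 'n) set)" .
  moreover have "bounded (unitary_group :: (complex ^ 'n ^ 'n) set)"
  proof (rule boundedI)
    fix M :: "complex ^ 'n ^ 'n" assume M: "M \<in> unitary_group"
    have "norm (M $ i) = 1" for i
    proof -
      have "complex_of_real (\<Sum>j\<in>UNIV. (cmod (M $ i $ j))\<^sup>2) = (M ** adjoint_matrix M) $ i $ i"
        by (simp add: matrix_matrix_mult_def adjoint_matrix_nth flip: complex_norm_square of_real_power)
      also have "\<dots> = 1"
        using M by (simp add: unitary_group_iff mat_def)
      finally show ?thesis
        by (simp add: norm_vec_def L2_set_def flip: of_real_sum)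
    qed
    then show "norm M \<le> sqrt CARD('n)"
      by (simp add: norm_vec_def[of M] L2_set_def)
  qed
  ultimately show ?thesis
    by (simp add: compact_eq_bounded_closed)
qed

definition unit_vector :: "complex ^ 'n \<Rightarrow> bool" where
  "unit_vector v \<longleftrightarrow> (\<Sum>i\<in>UNIV. v $ i * cnj (v $ i)) = 1"

definition line_projection :: "complex ^ 'n \<Rightarrow> complex ^ 'n ^ 'n" where
  "line_projection v = (\<chi> i j. v $ i * cnj (v $ j))"

text \<open>The rotation \<open>1 + (exp (\<i> t) - 1) v v\<^sup>*\<close> by a phase along the line of \<open>v\<close> is the one-parameter
  subgroup generated by \<open>\<i> v v\<^sup>*\<close>. These generators span all matrices over the complex numbers, so
  they replace the matrix exponential.\<close>

definition phase_rotation :: "complex ^ 'n \<Rightarrow> real \<Rightarrow> complex ^ 'n ^ 'n" where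
  "phase_rotation v t = (\<chi> i j. mat 1 $ i $ j + (iexp t - 1) * line_projection v $ i $ j)"

lemma phase_rotation_unitary:
  assumes v: "unit_vector v"
  shows "phase_rotation v t \<in> unitary_group"
proof -
  define w where "w = iexp t - 1"
  have "iexp t * cnj (iexp t) = 1"
    using complex_norm_square[of "iexp t"] by simp
  then have w: "w + cnj w + w * cnj w = 0"
    by (simp add: w_def algebra_simps)
  have prod: "(\<Sum>l\<in>UNIV. (mat 1 $ i $ l + x * (v $ i * cnj (v $ l))) * (mat 1 $ l $ j + y * (v $ l * cnj (v $ j)))) =
      mat 1 $ i $ j + (x + y + x * y) * (v $ i * cnj (v $ j))" for x y i j
  proof -
    have "(\<Sum>l\<in>UNIV. (mat 1 $ i $ l + x * (v $ i * cnj (v $ l))) * (mat 1 $ l $ j + y * (v $ l * cnj (v $ j)))) =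
      (mat 1 ** mat 1) $ i $ j + (\<Sum>l\<in>UNIV. mat 1 $ i $ l * (y * (v $ l * cnj (v $ j)))) +
      (\<Sum>l\<in>UNIV. x * (v $ i * cnj (v $ l)) * mat 1 $ l $ j) +
      x * y * (v $ i * cnj (v $ j)) * (\<Sum>l\<in>UNIV. v $ l * cnj (v $ l))"
      unfolding matrix_matrix_mult_def sum_distrib_left vec_lambda_beta
      by (simp add: algebra_simps flip: sum.distrib)
    also have "(\<Sum>l\<in>UNIV. mat 1 $ i $ l * (y * (v $ l * cnj (v $ j)))) = y * (v $ i * cnj (v $ j))"
      by (simp add: mat_def if_distrib[of "\<lambda>c. c * _"] cong: if_cong)
    also have "(\<Sum>l\<in>UNIV. x * (v $ i * cnj (v $ l)) * mat 1 $ l $ j) = x * (v $ i * cnj (v $ j))"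
      by (simp add: mat_def if_distrib cong: if_cong)
    finally show ?thesis
      using v by (simp add: unit_vector_def algebra_simps)
  qed
  have R: "phase_rotation v t $ i $ j = mat 1 $ i $ j + w * (v $ i * cnj (v $ j))"
    "adjoint_matrix (phase_rotation v t) $ i $ j = mat 1 $ i $ j + cnj w * (v $ i * cnj (v $ j))" for i j
    by (simp_all add: phase_rotation_def line_projection_def w_def adjoint_matrix_nth mat_def)
  have w': "cnj w + w + cnj w * w = 0"
    using w by (simp add: algebra_simps)
  show ?thesis
    unfolding unitary_group_iff vec_eq_iff matrix_matrix_mult_def vec_lambda_beta R prod w w' by simp
qed

definition matrix_unit :: "'n \<Rightarrow> 'n \<Rightarrow> complex ^ 'n ^ 'n" where
  "matrix_unit i j = (\<chi> k l. if k = i \<and> l = j then 1 else 0)"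

text \<open>\<open>D X M\<close> stands for the derivative of \<open>F\<close> along \<open>M \<mapsto> M + t X M\<close>, extended from skew-Hermitian
  \<open>X\<close> to all \<open>X\<close> by complex linearity. The derivative is required along the phase rotations only, in
  the form of a quadratic error bound that is uniform in \<open>M\<close>. Such bounds are preserved by sums and
  products and allow the passage to the limit under the integral without dominated convergence.\<close>

definition left_derivative ::
  "(complex ^ 'n ^ 'n \<Rightarrow> complex) \<Rightarrow> (complex ^ 'n ^ 'n \<Rightarrow> complex ^ 'n ^ 'n \<Rightarrow> complex) \<Rightarrow> bool" where
  "left_derivative F D \<longleftrightarrow>
     continuous_on unitary_group F \<and>
     (\<forall>X. continuous_on unitary_group (D X)) \<and>
     (\<forall>M\<in>unitary_group. \<forall>X. D X M = (\<Sum>i\<in>UNIV. \<Sum>j\<in>UNIV. X $ i $ j * D (matrix_unit i j) M)) \<and>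
     (\<forall>v. unit_vector v \<longrightarrow> (\<exists>K. \<forall>M\<in>unitary_group. \<forall>t. \<bar>t\<bar> \<le> 1 \<longrightarrow>
        cmod (F (phase_rotation v t ** M) - F M - \<i> * of_real t * D (line_projection v) M) \<le> K * t\<^sup>2))"

lemma left_derivative_continuous:
  assumes "left_derivative F D"
  shows "continuous_on unitary_group F" "continuous_on unitary_group (D X)"
  using assms unfolding left_derivative_def by blast+

lemma left_derivative_linear:
  assumes "left_derivative F D" "M \<in> unitary_group"
  shows "D X M = (\<Sum>i\<in>UNIV. \<Sum>j\<in>UNIV. X $ i $ j * D (matrix_unit i j) M)"
  using assms unfolding left_derivative_def by blast

lemma left_derivative_quadratic:
  assumes "left_derivative F D" "unit_vector v"
  obtains K where "\<And>M t. M \<in> unitary_group \<Longrightarrow> \<bar>t\<bar> \<le> 1 \<Longrightarrow>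
    cmod (F (phase_rotation v t ** M) - F M - \<i> * of_real t * D (line_projection v) M) \<le> K * t\<^sup>2"
  using assms unfolding left_derivative_def by blast

lemma left_derivative_cong:
  assumes "left_derivative F D" "\<And>M. M \<in> unitary_group \<Longrightarrow> F M = F' M"
    "\<And>X M. M \<in> unitary_group \<Longrightarrow> D X M = D' X M"
  shows "left_derivative F' D'"
  unfolding left_derivative_def
proof (intro conjI allI ballI impI)
  show "continuous_on unitary_group F'" "continuous_on unitary_group (D' X)" for X
    using left_derivative_continuous[OF assms(1)] assms(2,3) by (simp_all cong: continuous_on_cong)
  show "D' X M = (\<Sum>i\<in>UNIV. \<Sum>j\<in>UNIV. X $ i $ j * D' (matrix_unit i j) M)"
    if M: "M \<in> unitary_group" for M X
    using left_derivative_linear[OF assms(1) M, of X] unfolding assms(3)[OF M] .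
  fix v :: "complex ^ 'a" assume v: "unit_vector v"
  obtain K where K: "cmod (F (phase_rotation v t ** M) - F M - \<i> * of_real t * D (line_projection v) M) \<le> K * t\<^sup>2"
    if "M \<in> unitary_group" "\<bar>t\<bar> \<le> 1" for M t
    using left_derivative_quadratic[OF assms(1) v] by blast
  show "\<exists>K. \<forall>M\<in>unitary_group. \<forall>t. \<bar>t\<bar> \<le> 1 \<longrightarrow>
      cmod (F' (phase_rotation v t ** M) - F' M - \<i> * of_real t * D' (line_projection v) M) \<le> K * t\<^sup>2"
  proof (intro exI ballI allI impI)
    fix M :: "complex ^ 'a ^ 'a" and t :: real assume M: "M \<in> unitary_group" and t: "\<bar>t\<bar> \<le> 1"
    show "cmod (F' (phase_rotation v t ** M) - F' M - \<i> * of_real t * D' (line_projection v) M) \<le> K * t\<^sup>2"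
      using K[OF M t]
      by (simp only: assms(2)[OF M] assms(3)[OF M] assms(2)[OF unitary_group_mult[OF phase_rotation_unitary[OF v] M]])
  qed
qed

lemma left_derivative_const: "left_derivative (\<lambda>_. c) (\<lambda>_ _. 0)"
  by (auto simp: left_derivative_def intro!: exI[of _ 0])

lemma left_derivative_add:
  assumes "left_derivative F D" "left_derivative F' D'"
  shows "left_derivative (\<lambda>M. F M + F' M) (\<lambda>X M. D X M + D' X M)"
  unfolding left_derivative_def
proof (intro conjI allI ballI impI)
  show "continuous_on unitary_group (\<lambda>M. F M + F' M)" "continuous_on unitary_group (\<lambda>M. D X M + D' X M)" for X
    by (intro continuous_intros left_derivative_continuous[OF assms(1)] left_derivative_continuous[OF assms(2)])+
  show "D X M + D' X M = (\<Sum>i\<in>UNIV. \<Sum>j\<in>UNIV. X $ i $ j * (D (matrix_unit i j) M + D' (matrix_unit i j) M))"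
    if "M \<in> unitary_group" for M X
    using left_derivative_linear[OF assms(1) that, of X] left_derivative_linear[OF assms(2) that, of X]
    by (simp only: distrib_left sum.distrib)
  fix v :: "complex ^ 'a" assume v: "unit_vector v"
  obtain K where K: "cmod (F (phase_rotation v t ** M) - F M - \<i> * of_real t * D (line_projection v) M) \<le> K * t\<^sup>2"
    if "M \<in> unitary_group" "\<bar>t\<bar> \<le> 1" for M t
    using left_derivative_quadratic[OF assms(1) v] by blast
  obtain K' where K': "cmod (F' (phase_rotation v t ** M) - F' M - \<i> * of_real t * D' (line_projection v) M) \<le> K' * t\<^sup>2"
    if "M \<in> unitary_group" "\<bar>t\<bar> \<le> 1" for M t
    using left_derivative_quadratic[OF assms(2) v] by blast
  have "cmod (F (phase_rotation v t ** M) + F' (phase_rotation v t ** M) - (F M + F' M) -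
      \<i> * of_real t * (D (line_projection v) M + D' (line_projection v) M)) \<le> (K + K') * t\<^sup>2"
    if "M \<in> unitary_group" "\<bar>t\<bar> \<le> 1" for M t
    using norm_triangle_mono[OF K[OF that] K'[OF that]] by (simp add: algebra_simps)
  then show "\<exists>K. \<forall>M\<in>unitary_group. \<forall>t. \<bar>t\<bar> \<le> 1 \<longrightarrow>
      cmod (F (phase_rotation v t ** M) + F' (phase_rotation v t ** M) - (F M + F' M) -
      \<i> * of_real t * (D (line_projection v) M + D' (line_projection v) M)) \<le> K * t\<^sup>2"
    by blast
qed

lemma unitary_group_continuous_bounded:
  fixes F :: "complex ^ 'n ^ 'n \<Rightarrow> complex"
  assumes "continuous_on unitary_group F"
  obtains B where "B \<ge> 0" "\<And>M. M \<in> unitary_group \<Longrightarrow> cmod (F M) \<le> B"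
proof -
  have "bounded (F ` unitary_group)"
    using assms compact_unitary_group compact_continuous_image compact_imp_bounded by blast
  then obtain B where "\<forall>x\<in>F ` unitary_group. cmod x \<le> B"
    by (auto simp: bounded_iff)
  then show thesis
    by (intro that[of "max B 0"]) (auto simp: le_max_iff_disj)
qed

lemma left_derivative_mult:
  assumes "left_derivative F D" "left_derivative F' D'"
  shows "left_derivative (\<lambda>M. F M * F' M) (\<lambda>X M. D X M * F' M + F M * D' X M)"
  unfolding left_derivative_def
proof (intro conjI allI ballI impI)
  show "continuous_on unitary_group (\<lambda>M. F M * F' M)"
    "continuous_on unitary_group (\<lambda>M. D X M * F' M + F M * D' X M)" for X
    by (intro continuous_intros left_derivative_continuous[OF assms(1)] left_derivative_continuous[OF assms(2)])+
  show "D X M * F' M + F M * D' X M =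
      (\<Sum>i\<in>UNIV. \<Sum>j\<in>UNIV. X $ i $ j * (D (matrix_unit i j) M * F' M + F M * D' (matrix_unit i j) M))"
    if M: "M \<in> unitary_group" for M X
  proof -
    have "D X M = (\<Sum>i\<in>UNIV. \<Sum>j\<in>UNIV. X $ i $ j * D (matrix_unit i j) M)"
      "D' X M = (\<Sum>i\<in>UNIV. \<Sum>j\<in>UNIV. X $ i $ j * D' (matrix_unit i j) M)"
      using left_derivative_linear[OF _ M] assms by blast+
    then show ?thesis
      by (simp only: distrib_left sum.distrib sum_distrib_left sum_distrib_right mult_ac)
  qed
  fix v :: "complex ^ 'a" assume v: "unit_vector v"
  obtain K where K: "cmod (F (phase_rotation v t ** M) - F M - \<i> * of_real t * D (line_projection v) M) \<le> K * t\<^sup>2"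
    if "M \<in> unitary_group" "\<bar>t\<bar> \<le> 1" for M t
    using left_derivative_quadratic[OF assms(1) v] by blast
  obtain K' where K': "cmod (F' (phase_rotation v t ** M) - F' M - \<i> * of_real t * D' (line_projection v) M) \<le> K' * t\<^sup>2"
    if "M \<in> unitary_group" "\<bar>t\<bar> \<le> 1" for M t
    using left_derivative_quadratic[OF assms(2) v] by blast
  obtain B where B: "B \<ge> 0" "\<And>M. M \<in> unitary_group \<Longrightarrow> cmod (F M) \<le> B"
    using unitary_group_continuous_bounded[OF left_derivative_continuous(1)[OF assms(1)]] by metis
  obtain B' where B': "B' \<ge> 0" "\<And>M. M \<in> unitary_group \<Longrightarrow> cmod (F' M) \<le> B'"
    using unitary_group_continuous_bounded[OF left_derivative_continuous(1)[OF assms(2)]] by metis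
  obtain C where C: "C \<ge> 0" "\<And>M. M \<in> unitary_group \<Longrightarrow> cmod (D (line_projection v) M) \<le> C"
    using unitary_group_continuous_bounded[OF left_derivative_continuous(2)[OF assms(1)]] by metis
  obtain C' where C': "C' \<ge> 0" "\<And>M. M \<in> unitary_group \<Longrightarrow> cmod (D' (line_projection v) M) \<le> C'"
    using unitary_group_continuous_bounded[OF left_derivative_continuous(2)[OF assms(2)]] by metis
  have "cmod (F (phase_rotation v t ** M) * F' (phase_rotation v t ** M) - F M * F' M -
      \<i> * of_real t * (D (line_projection v) M * F' M + F M * D' (line_projection v) M)) \<le>
      (C * C' + K * B' + (B + C) * K') * t\<^sup>2"
    if M: "M \<in> unitary_group" and t: "\<bar>t\<bar> \<le> 1" for M t
  proof -
    let ?E = "D (line_projection v) M" and ?E' = "D' (line_projection v) M"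
    define G where "G = F (phase_rotation v t ** M)"
    define G' where "G' = F' (phase_rotation v t ** M)"
    define s where "s = \<i> * of_real t"
    have s: "cmod s = \<bar>t\<bar>" "cmod (s\<^sup>2) = t\<^sup>2"
      by (simp_all add: s_def norm_mult norm_power)
    have G': "cmod G' \<le> B'"
      unfolding G'_def by (intro B'(2) unitary_group_mult phase_rotation_unitary v M)
    have "cmod (F M + s * ?E) \<le> B + 1 * C"
    proof (intro norm_triangle_mono B M)
      show "cmod (s * ?E) \<le> 1 * C"
        unfolding norm_mult s(1) using C(2)[OF M] t by (intro mult_mono) auto
    qed
    then have 1: "cmod ((F M + s * ?E) * (G' - F' M - s * ?E')) \<le> (B + C) * (K' * t\<^sup>2)"
      unfolding norm_mult using K'[OF M t] B(1) C(1) by (intro mult_mono) (auto simp: G'_def s_def)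
    have "K * t\<^sup>2 \<ge> 0"
      using K[OF M t] norm_ge_zero order_trans by blast
    then have 2: "cmod ((G - F M - s * ?E) * G') \<le> K * t\<^sup>2 * B'"
      unfolding norm_mult using K[OF M t] G' by (intro mult_mono) (auto simp: G_def s_def)
    have 3: "cmod (s\<^sup>2 * (?E * ?E')) \<le> t\<^sup>2 * (C * C')"
      unfolding norm_mult[of "s\<^sup>2"] s norm_mult using C(2)[OF M] C'(2)[OF M] C(1) by (intro mult_mono) auto
    \<comment> \<open>the error of the product in terms of the errors of the factors\<close>
    have "G * G' - F M * F' M - s * (?E * F' M + F M * ?E') =
       s\<^sup>2 * (?E * ?E') + (G - F M - s * ?E) * G' + (F M + s * ?E) * (G' - F' M - s * ?E')"
      by (simp add: algebra_simps power2_eq_square)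
    also have "cmod \<dots> \<le> t\<^sup>2 * (C * C') + K * t\<^sup>2 * B' + (B + C) * (K' * t\<^sup>2)"
      by (intro norm_triangle_mono 1 2 3)
    finally show ?thesis
      by (simp add: G_def G'_def s_def algebra_simps)
  qed
  then show "\<exists>K. \<forall>M\<in>unitary_group. \<forall>t. \<bar>t\<bar> \<le> 1 \<longrightarrow>
      cmod (F (phase_rotation v t ** M) * F' (phase_rotation v t ** M) - F M * F' M -
      \<i> * of_real t * (D (line_projection v) M * F' M + F M * D' (line_projection v) M)) \<le> K * t\<^sup>2"
    by blast
qed

lemma left_derivative_entry: "left_derivative (\<lambda>M. M $ i $ j) (\<lambda>X M. (X ** M) $ i $ j)"
  unfolding left_derivative_def
proof (intro conjI allI ballI impI)
  show "continuous_on unitary_group (\<lambda>M. M $ i $ j :: complex)"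
    by (intro continuous_intros)
  show "continuous_on unitary_group (\<lambda>M. (X ** M) $ i $ j)" for X :: "complex ^ 'a ^ 'a"
    unfolding matrix_matrix_mult_def vec_lambda_beta by (intro continuous_intros)
  show "(X ** M) $ i $ j = (\<Sum>k\<in>UNIV. \<Sum>l\<in>UNIV. X $ k $ l * (matrix_unit k l ** M) $ i $ j)"
    for X M :: "complex ^ 'a ^ 'a"
  proof -
    have unit: "(matrix_unit k l ** M) $ i $ j = (if k = i then M $ l $ j else 0)" for k l
      by (cases "k = i")
        (auto simp: matrix_matrix_mult_def matrix_unit_def if_distrib[of "\<lambda>c. c * _"] cong: if_cong)
    have "(\<Sum>k\<in>UNIV. \<Sum>l\<in>UNIV. X $ k $ l * (matrix_unit k l ** M) $ i $ j) =
        (\<Sum>k\<in>UNIV. if k = i then \<Sum>l\<in>UNIV. X $ k $ l * M $ l $ j else 0)"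
      unfolding unit by (intro sum.cong refl) simp
    then show ?thesis
      by (simp add: matrix_matrix_mult_def)
  qed
  fix v :: "complex ^ 'a" assume "unit_vector v"
  have "continuous_on unitary_group (\<lambda>M. (line_projection v ** M) $ i $ j)"
    unfolding matrix_matrix_mult_def vec_lambda_beta by (intro continuous_intros)
  then obtain B where B: "B \<ge> 0" "\<And>M. M \<in> unitary_group \<Longrightarrow> cmod ((line_projection v ** M) $ i $ j) \<le> B"
    using unitary_group_continuous_bounded by metis
  have "cmod ((phase_rotation v t ** M) $ i $ j - M $ i $ j - \<i> * of_real t * (line_projection v ** M) $ i $ j) \<le> B * t\<^sup>2"
    if M: "M \<in> unitary_group" for M t
  proof -
    have "phase_rotation v t ** M = M + (\<chi> i j. (iexp t - 1) * (line_projection v ** M) $ i $ j)"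
    proof -
      have "phase_rotation v t ** M = mat 1 ** M + (\<chi> i j. (iexp t - 1) * (line_projection v ** M) $ i $ j)"
        by (simp add: vec_eq_iff phase_rotation_def matrix_matrix_mult_def sum.distrib distrib_right sum_distrib_left mult.assoc)
      then show ?thesis by simp
    qed
    then have "(phase_rotation v t ** M) $ i $ j - M $ i $ j - \<i> * of_real t * (line_projection v ** M) $ i $ j =
       (iexp t - (1 + \<i> * of_real t)) * (line_projection v ** M) $ i $ j"
      by (simp add: algebra_simps)
    also have "cmod \<dots> \<le> t\<^sup>2 * B"
      unfolding norm_mult
    proof (intro mult_mono B M)
      show "cmod (iexp t - (1 + \<i> * of_real t)) \<le> t\<^sup>2"
      proof -
        have "cmod (iexp t - (1 + \<i> * of_real t)) \<le> t\<^sup>2 / 2"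
          using iexp_approx1[of t 1] by (simp add: numeral_2_eq_2)
        then show ?thesis
          using zero_le_power2[of t] by linarith
      qed
    qed auto
    finally show ?thesis by (simp add: mult.commute)
  qed
  then show "\<exists>K. \<forall>M\<in>unitary_group. \<forall>t. \<bar>t\<bar> \<le> 1 \<longrightarrow>
    cmod ((phase_rotation v t ** M) $ i $ j - M $ i $ j - \<i> * of_real t * (line_projection v ** M) $ i $ j) \<le> K * t\<^sup>2"
    by blast
qed

text \<open>Conjugation turns the complex linear dependence on \<open>X\<close> into an antilinear one. Composition with
  the map \<open>X \<mapsto> - X\<^sup>*\<close>, which fixes the generators \<open>\<i> v v\<^sup>*\<close>, makes it linear again.\<close>

lemma left_derivative_cnj:
  assumes "left_derivative F D"
  shows "left_derivative (\<lambda>M. cnj (F M)) (\<lambda>X M. - cnj (D (adjoint_matrix X) M))"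
  unfolding left_derivative_def
proof (intro conjI allI ballI impI)
  show "continuous_on unitary_group (\<lambda>M. cnj (F M))"
    "continuous_on unitary_group (\<lambda>M. - cnj (D (adjoint_matrix X) M))" for X
    by (intro continuous_intros left_derivative_continuous[OF assms])+
  have unit: "adjoint_matrix (matrix_unit i j) = matrix_unit j i" for i j :: 'a
    by (auto simp: vec_eq_iff adjoint_matrix_nth matrix_unit_def)
  show "- cnj (D (adjoint_matrix X) M) =
      (\<Sum>i\<in>UNIV. \<Sum>j\<in>UNIV. X $ i $ j * - cnj (D (adjoint_matrix (matrix_unit i j)) M))"
    if M: "M \<in> unitary_group" for M X
  proof -
    have "D (adjoint_matrix X) M = (\<Sum>i\<in>UNIV. \<Sum>j\<in>UNIV. cnj (X $ j $ i) * D (matrix_unit i j) M)"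
      using left_derivative_linear[OF assms M] unfolding adjoint_matrix_nth[symmetric] .
    then have "- cnj (D (adjoint_matrix X) M) = (\<Sum>i\<in>UNIV. \<Sum>j\<in>UNIV. X $ j $ i * - cnj (D (matrix_unit i j) M))"
      by (simp add: sum_negf)
    then show ?thesis
      unfolding unit by (subst sum.swap)
  qed
  fix v :: "complex ^ 'a" assume v: "unit_vector v"
  obtain K where K: "cmod (F (phase_rotation v t ** M) - F M - \<i> * of_real t * D (line_projection v) M) \<le> K * t\<^sup>2"
    if "M \<in> unitary_group" "\<bar>t\<bar> \<le> 1" for M t
    using left_derivative_quadratic[OF assms(1) v] by blast
  have self: "adjoint_matrix (line_projection v) = line_projection v"
    by (simp add: vec_eq_iff adjoint_matrix_nth line_projection_def)
  have "cmod (cnj (F (phase_rotation v t ** M)) - cnj (F M) -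
      \<i> * of_real t * - cnj (D (adjoint_matrix (line_projection v)) M)) \<le> K * t\<^sup>2"
    if "M \<in> unitary_group" "\<bar>t\<bar> \<le> 1" for M t
  proof -
    have "cnj (F (phase_rotation v t ** M)) - cnj (F M) -
      \<i> * of_real t * - cnj (D (adjoint_matrix (line_projection v)) M) =
      cnj (F (phase_rotation v t ** M) - F M - \<i> * of_real t * D (line_projection v) M)"
      by (simp add: self)
    then show ?thesis
      using K[OF that] by (simp only: complex_mod_cnj)
  qed
  then show "\<exists>K. \<forall>M\<in>unitary_group. \<forall>t. \<bar>t\<bar> \<le> 1 \<longrightarrow>
    cmod (cnj (F (phase_rotation v t ** M)) - cnj (F M) -
      \<i> * of_real t * - cnj (D (adjoint_matrix (line_projection v)) M)) \<le> K * t\<^sup>2"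
    by blast
qed

lemma left_derivative_sum:
  assumes "\<And>i. i \<in> S \<Longrightarrow> left_derivative (F i) (D i)"
  shows "left_derivative (\<lambda>M. \<Sum>i\<in>S. F i M) (\<lambda>X M. \<Sum>i\<in>S. D i X M)"
  using assms
proof (induction S rule: infinite_finite_induct)
  case (insert x S)
  have "left_derivative (\<lambda>M. F x M + (\<Sum>i\<in>S. F i M)) (\<lambda>X M. D x X M + (\<Sum>i\<in>S. D i X M))"
    using insert by (intro left_derivative_add) auto
  then show ?case using insert.hyps by simp
qed (simp_all add: left_derivative_const)

lemma left_derivative_scale:
  assumes "left_derivative F D"
  shows "left_derivative (\<lambda>M. c * F M) (\<lambda>X M. c * D X M)"
  using left_derivative_mult[OF left_derivative_const assms, of c] by simp

lemma left_derivative_prod: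
  assumes "finite S" "\<And>i. i \<in> S \<Longrightarrow> left_derivative (F i) (D i)"
  shows "left_derivative (\<lambda>M. \<Prod>i\<in>S. F i M)
    (\<lambda>X M. \<Sum>k\<in>S. \<Prod>i\<in>S. if i = k then D i X M else F i M)"
  using assms
proof (induction S rule: finite_induct)
  case empty
  then show ?case by (simp add: left_derivative_const)
next
  case (insert x S)
  have "left_derivative (\<lambda>M. F x M * (\<Prod>i\<in>S. F i M))
     (\<lambda>X M. D x X M * (\<Prod>i\<in>S. F i M) + F x M * (\<Sum>k\<in>S. \<Prod>i\<in>S. if i = k then D i X M else F i M))"
    using insert by (intro left_derivative_mult) auto
  then show ?case
  proof (rule left_derivative_cong)
    fix X M
    have "(\<Sum>k\<in>S. \<Prod>i\<in>insert x S. if i = k then D i X M else F i M) =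
       (\<Sum>k\<in>S. F x M * (\<Prod>i\<in>S. if i = k then D i X M else F i M))"
      using insert.hyps by (intro sum.cong refl) auto
    moreover have "(\<Prod>i\<in>S. if i = x then D i X M else F i M) = (\<Prod>i\<in>S. F i M)"
      using insert.hyps by (intro prod.cong) auto
    ultimately show "D x X M * (\<Prod>i\<in>S. F i M) + F x M * (\<Sum>k\<in>S. \<Prod>i\<in>S. if i = k then D i X M else F i M) =
        (\<Sum>k\<in>insert x S. \<Prod>i\<in>insert x S. if i = k then D i X M else F i M)"
      using insert.hyps by (simp add: sum_distrib_left)
  qed (use insert.hyps in simp)
qed

lemma left_derivative_power:
  assumes "left_derivative F D"
  shows "left_derivative (\<lambda>M. F M ^ k) (\<lambda>X M. of_nat k * F M ^ (k - 1) * D X M)"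
proof (induction k)
  case 0
  then show ?case by (simp add: left_derivative_const)
next
  case (Suc k)
  show ?case
  proof (rule left_derivative_cong[OF left_derivative_mult[OF assms Suc.IH]])
    show "D X M * F M ^ k + F M * (of_nat k * F M ^ (k - 1) * D X M) =
        of_nat (Suc k) * F M ^ (Suc k - 1) * D X M" for X M
      by (cases k) (simp_all add: algebra_simps)
  qed simp
qed

section \<open>Infinitesimal invariance of Haar measure\<close>

lemma haar_integrable:
  fixes F :: "complex ^ 'n ^ 'n \<Rightarrow> complex"
  assumes haar: "normalized_haar_measure H" and F: "continuous_on unitary_group F"
  shows "integrable H F"
proof -
  interpret prob_space H
    using haar by (simp add: normalized_haar_measure_def)
  have "F \<in> borel_measurable (restrict_space borel unitary_group)"
    using F by (rule borel_measurable_continuous_on_restrict)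
  moreover have "sets H = sets (restrict_space borel unitary_group)"
    using haar by (simp add: normalized_haar_measure_def)
  ultimately have "F \<in> borel_measurable H"
    using measurable_cong_sets by blast
  moreover obtain B where "\<And>M. M \<in> unitary_group \<Longrightarrow> cmod (F M) \<le> B"
    using unitary_group_continuous_bounded[OF F] by metis
  then have "AE M in H. cmod (F M) \<le> B"
    using haar by (intro AE_I2) (simp add: normalized_haar_measure_def)
  ultimately show ?thesis
    by (intro integrable_const_bound)
qed

lemma continuous_on_left_translate:
  fixes F :: "complex ^ 'n ^ 'n \<Rightarrow> 'a::topological_space"
  assumes F: "continuous_on unitary_group F" and A: "A \<in> unitary_group"
  shows "continuous_on unitary_group (\<lambda>M. F (A ** M))"
proof (rule continuous_on_compose2[OF F])
  show "continuous_on unitary_group (\<lambda>M :: complex ^ 'n ^ 'n. A ** M)"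
    unfolding matrix_matrix_mult_def
    by (intro continuous_intros continuous_on_vec_lambda)
  show "(\<lambda>M. A ** M) ` unitary_group \<subseteq> unitary_group"
    using A by (auto intro: unitary_group_mult)
qed

lemma haar_left_translate:
  fixes F :: "complex ^ 'n ^ 'n \<Rightarrow> complex"
  assumes haar: "normalized_haar_measure H" and F: "continuous_on unitary_group F"
    and A: "A \<in> unitary_group"
  shows "(LINT M|H. F (A ** M)) = (LINT M|H. F M)"
proof -
  have eq: "distr H H (\<lambda>M. A ** M) = H" and sp: "space H = unitary_group"
    and st: "sets H = sets (restrict_space borel unitary_group)"
    using haar A by (auto simp: normalized_haar_measure_def)
  have "(\<lambda>M :: complex ^ 'n ^ 'n. A ** M) \<in> restrict_space borel unitary_group \<rightarrow>\<^sub>M restrict_space borel unitary_group"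
    using continuous_on_left_translate[OF continuous_on_id A] A
    by (intro measurable_restrict_space2 borel_measurable_continuous_on_restrict)
      (auto simp: space_restrict_space intro: unitary_group_mult)
  then have "(\<lambda>M. A ** M) \<in> H \<rightarrow>\<^sub>M H"
    using measurable_cong_sets[OF st st] by blast
  moreover have "F \<in> borel_measurable H"
    using haar_integrable[OF haar F] by (rule borel_measurable_integrable)
  ultimately have "(LINT M|distr H H (\<lambda>M. A ** M). F M) = (LINT M|H. F (A ** M))"
    by (rule integral_distr)
  then show ?thesis
    by (simp only: eq)
qed

text \<open>By invariance, \<open>\<i> t\<close> times the integral of the derivative equals minus the integral of the
  quadratic error, and \<open>t\<close> tends to zero.\<close>

lemma haar_derivative_line_projection:
  assumes haar: "normalized_haar_measure H" and F: "left_derivative F D" and v: "unit_vector v"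
  shows "(LINT M|H. D (line_projection v) M) = 0"
proof -
  interpret prob_space H
    using haar by (simp add: normalized_haar_measure_def)
  have sp: "space H = unitary_group"
    using haar by (simp add: normalized_haar_measure_def)
  obtain K where K: "cmod (F (phase_rotation v t ** M) - F M - \<i> * of_real t * D (line_projection v) M) \<le> K * t\<^sup>2"
    if "M \<in> unitary_group" "\<bar>t\<bar> \<le> 1" for M t
    using left_derivative_quadratic[OF F v] by blast
  define I where "I = (LINT M|H. D (line_projection v) M)"
  have bound: "cmod I \<le> K * t" if t: "0 < t" "t \<le> 1" for t
  proof -
    let ?R = "phase_rotation v t"
    have int: "integrable H (\<lambda>M. F (?R ** M))" "integrable H F" "integrable H (D (line_projection v))"
      by (intro haar_integrable[OF haar] continuous_on_left_translate phase_rotation_unitary v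
          left_derivative_continuous[OF F])+
    have "(LINT M|H. F (?R ** M) - F M - \<i> * of_real t * D (line_projection v) M) =
        (LINT M|H. F (?R ** M)) - (LINT M|H. F M) - \<i> * of_real t * I"
      using int by (simp add: I_def)
    also have "\<dots> = - \<i> * of_real t * I"
      using haar_left_translate[OF haar left_derivative_continuous(1)[OF F] phase_rotation_unitary[OF v]]
      by simp
    finally have "t * cmod I = cmod (LINT M|H. F (?R ** M) - F M - \<i> * of_real t * D (line_projection v) M)"
      using t by (simp add: norm_mult)
    also have "\<dots> \<le> (LINT M|H. cmod (F (?R ** M) - F M - \<i> * of_real t * D (line_projection v) M))"
      by (rule integral_norm_bound)
    also have "\<dots> \<le> K * t\<^sup>2"
      using int K t sp by (intro integral_le_const AE_I2) auto
    finally show ?thesis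
      using t by (simp add: power2_eq_square mult.left_commute)
  qed
  have "(\<lambda>t. K * t) \<midarrow>0\<rightarrow> K * 0"
    by (intro tendsto_intros)
  then have "((\<lambda>t. K * t) \<longlongrightarrow> 0) (at_right 0)"
    by (auto intro: tendsto_within_subset)
  moreover have "eventually (\<lambda>t. cmod I \<le> K * t) (at_right 0)"
    using bound by (auto simp: eventually_at_right_field intro!: exI[of _ 1])
  ultimately have "cmod I \<le> 0"
    by (intro tendsto_lowerbound[of _ _ "at_right 0"]) auto
  then show ?thesis by (simp add: I_def)
qed

lemma haar_derivative_linear:
  assumes haar: "normalized_haar_measure H" and F: "left_derivative F D"
  shows "(LINT M|H. D X M) = (\<Sum>i\<in>UNIV. \<Sum>j\<in>UNIV. X $ i $ j * (LINT M|H. D (matrix_unit i j) M))"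
proof -
  have sp: "space H = unitary_group"
    using haar by (simp add: normalized_haar_measure_def)
  have "(LINT M|H. D X M) = (LINT M|H. (\<Sum>i\<in>UNIV. \<Sum>j\<in>UNIV. X $ i $ j * D (matrix_unit i j) M))"
    using left_derivative_linear[OF F, of _ X] sp by (intro Bochner_Integration.integral_cong refl) auto
  also have "\<dots> = (\<Sum>i\<in>UNIV. \<Sum>j\<in>UNIV. X $ i $ j * (LINT M|H. D (matrix_unit i j) M))"
    using haar_integrable[OF haar left_derivative_continuous(2)[OF F]] by simp
  finally show ?thesis .
qed

text \<open>Polarization: the projections onto the lines spanned by \<open>e\<^sub>j\<close>, \<open>(e\<^sub>j + e\<^sub>k) / \<surd>2\<close> and
  \<open>(e\<^sub>j + \<i> e\<^sub>k) / \<surd>2\<close> span all matrix units.\<close>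

lemma haar_derivative_matrix_unit:
  assumes haar: "normalized_haar_measure H" and F: "left_derivative F D"
  shows "(LINT M|H. D (matrix_unit j k) M) = 0"
proof -
  define L where "L = (\<lambda>i j. LINT M|H. D (matrix_unit i j) M)"
  have proj: "(\<Sum>a\<in>UNIV. \<Sum>b\<in>UNIV. v $ a * cnj (v $ b) * L a b) = 0" if "unit_vector v" for v
    using haar_derivative_line_projection[OF haar F that] haar_derivative_linear[OF haar F, of "line_projection v"]
    by (simp add: line_projection_def L_def)
  have two: "x * cnj x * L j j + x * cnj y * L j k + y * cnj x * L k j + y * cnj y * L k k = 0"
    if jk: "j \<noteq> k" and xy: "x * cnj x + y * cnj y = 1" for j k x y
  proof -
    define v :: "complex ^ 'a" where "v = (\<chi> a. (if a = j then x else 0) + (if a = k then y else 0))"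
    have split: "(\<Sum>a\<in>UNIV. v $ a * f a) = x * f j + y * f k" for f
      by (simp add: v_def distrib_right sum.distrib if_distrib[of "\<lambda>c. c * _"] cong: if_cong)
    have split': "(\<Sum>b\<in>UNIV. cnj (v $ b) * f b) = cnj x * f j + cnj y * f k" for f
      by (simp add: v_def distrib_right sum.distrib if_distrib[of "\<lambda>c. cnj c * _"] if_distrib[of cnj] if_distrib[of "\<lambda>c. c * _"] cong: if_cong)
    have "unit_vector v"
      unfolding unit_vector_def split using jk xy by (simp add: v_def)
    from proj[OF this] have "(\<Sum>a\<in>UNIV. v $ a * (\<Sum>b\<in>UNIV. cnj (v $ b) * L a b)) = 0"
      by (simp add: sum_distrib_left mult.assoc)
    then show ?thesis
      unfolding split split' by (simp add: algebra_simps)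
  qed
  have diag: "L j j = 0" for j
  proof -
    have "unit_vector (\<chi> a. if a = j then 1 else 0)"
      by (simp add: unit_vector_def if_distrib[of cnj] if_distrib[of "\<lambda>c. c * _"] cong: if_cong)
    moreover have "(\<Sum>b\<in>UNIV. if a = j then if b = j then L j j else 0 else 0) = (if a = j then L j j else 0)" for a
      by simp
    ultimately show ?thesis
      using proj[of "\<chi> a. if a = j then 1 else 0"]
      by (simp add: if_distrib[of cnj] if_distrib[of "\<lambda>c. c * _"] cong: if_cong)
  qed
  show ?thesis
  proof (cases "j = k")
    case True
    then show ?thesis using diag by (simp add: L_def)
  next
    case False
    have "(complex_of_real (1 / sqrt 2))\<^sup>2 = 1 / 2"
      by (simp add: power_divide flip: of_real_power)
    then have r: "complex_of_real (1 / sqrt 2) * of_real (1 / sqrt 2) = 1 / 2"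
      by (simp add: power2_eq_square)
    \<comment> \<open>the unit vectors \<open>(e\<^sub>j + e\<^sub>k) / \<surd>2\<close> and \<open>(e\<^sub>j + \<i> e\<^sub>k) / \<surd>2\<close>\<close>
    have "L j k + L k j = 0"
      using two[OF False, of "of_real (1 / sqrt 2)" "of_real (1 / sqrt 2)"] r diag
      by (simp add: field_simps)
    moreover have "- L j k + L k j = 0"
      using two[OF False, of "of_real (1 / sqrt 2)" "\<i> * of_real (1 / sqrt 2)"] r diag
      by (simp add: field_simps)
    ultimately have "L j k = 0"
      by (simp add: add_eq_0_iff)
    then show ?thesis by (simp add: L_def)
  qed
qed

text \<open>The divergence theorem for the vector field \<open>M \<mapsto> Y(M) M\<close>: apply the vanishing of integrated
  derivatives to each product \<open>Y(M)\<^sub>i\<^sub>j F(M)\<close> in the direction of the matrix unit \<open>(i, j)\<close>.\<close>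

lemma haar_divergence:
  assumes haar: "normalized_haar_measure H" and F: "left_derivative F D"
    and Y: "\<And>i j. left_derivative (\<lambda>M. Y M $ i $ j) (DY i j)"
  shows "(LINT M|H. D (Y M) M + F M * (\<Sum>i\<in>UNIV. \<Sum>j\<in>UNIV. DY i j (matrix_unit i j) M)) = 0"
proof -
  have sp: "space H = unitary_group"
    using haar by (simp add: normalized_haar_measure_def)
  have "left_derivative (\<lambda>M. Y M $ i $ j * F M) (\<lambda>X M. DY i j X M * F M + Y M $ i $ j * D X M)" for i j
    by (intro left_derivative_mult Y F)
  note zero = haar_derivative_matrix_unit[OF haar this] 
    and int = haar_integrable[OF haar left_derivative_continuous(2)[OF this]]
  have "(LINT M|H. D (Y M) M + F M * (\<Sum>i\<in>UNIV. \<Sum>j\<in>UNIV. DY i j (matrix_unit i j) M)) =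
     (LINT M|H. (\<Sum>i\<in>UNIV. \<Sum>j\<in>UNIV. DY i j (matrix_unit i j) M * F M + Y M $ i $ j * D (matrix_unit i j) M))"
  proof (intro Bochner_Integration.integral_cong refl)
    fix M assume "M \<in> space H"
    then have D: "D (Y M) M = (\<Sum>i\<in>UNIV. \<Sum>j\<in>UNIV. Y M $ i $ j * D (matrix_unit i j) M)"
      using left_derivative_linear[OF F] sp by blast
    show "D (Y M) M + F M * (\<Sum>i\<in>UNIV. \<Sum>j\<in>UNIV. DY i j (matrix_unit i j) M) =
       (\<Sum>i\<in>UNIV. \<Sum>j\<in>UNIV. DY i j (matrix_unit i j) M * F M + Y M $ i $ j * D (matrix_unit i j) M)"
      by (subst D) (simp add: sum.distrib sum_distrib_left mult.commute)
  qed
  also have "\<dots> = (\<Sum>i\<in>UNIV. \<Sum>j\<in>UNIV. LINT M|H. DY i j (matrix_unit i j) M * F M + Y M $ i $ j * D (matrix_unit i j) M)"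
    using int by (simp add: Bochner_Integration.integral_sum Bochner_Integration.integrable_sum del: Bochner_Integration.integral_add)
  also have "\<dots> = 0"
    using zero by simp
  finally show ?thesis .
qed

section \<open>Derivatives of Schur functions\<close>

lemma matrix_power_add: "matrix_power M a ** matrix_power M b = matrix_power M (a + b)"
  by (induction a) (simp_all add: matrix_mul_assoc[symmetric])

text \<open>The derivative of the power \<open>M\<^sup>r\<close> in the direction \<open>X M\<close>.\<close>

primrec matrix_power_variation ::
  "complex ^ 'n ^ 'n \<Rightarrow> complex ^ 'n ^ 'n \<Rightarrow> nat \<Rightarrow> complex ^ 'n ^ 'n" where
  "matrix_power_variation X M 0 = 0"
| "matrix_power_variation X M (Suc r) = X ** matrix_power M (Suc r) + M ** matrix_power_variation X M r"

lemma left_derivative_matrix_power: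
  "left_derivative (\<lambda>M. matrix_power M r $ i $ j) (\<lambda>X M. matrix_power_variation X M r $ i $ j)"
proof (induction r arbitrary: i j)
  case 0
  then show ?case by (simp add: left_derivative_const)
next
  case (Suc r)
  have "left_derivative (\<lambda>M. \<Sum>l\<in>UNIV. M $ i $ l * matrix_power M r $ l $ j)
     (\<lambda>X M. \<Sum>l\<in>UNIV. (X ** M) $ i $ l * matrix_power M r $ l $ j + M $ i $ l * matrix_power_variation X M r $ l $ j)"
    by (intro left_derivative_sum left_derivative_mult left_derivative_entry Suc.IH)
  then show ?case
  proof (rule left_derivative_cong)
    fix X M :: "complex ^ 'a ^ 'a"
    show "(\<Sum>l\<in>UNIV. M $ i $ l * matrix_power M r $ l $ j) = matrix_power M (Suc r) $ i $ j"
      by (simp add: matrix_matrix_mult_def)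
    have "(\<Sum>l\<in>UNIV. (X ** M) $ i $ l * matrix_power M r $ l $ j) = (X ** M ** matrix_power M r) $ i $ j"
      by (simp add: matrix_matrix_mult_def[of "X ** M"])
    moreover have "(\<Sum>l\<in>UNIV. M $ i $ l * matrix_power_variation X M r $ l $ j) = (M ** matrix_power_variation X M r) $ i $ j"
      by (simp add: matrix_matrix_mult_def)
    ultimately show "(\<Sum>l\<in>UNIV. (X ** M) $ i $ l * matrix_power M r $ l $ j + M $ i $ l * matrix_power_variation X M r $ l $ j) =
        matrix_power_variation X M (Suc r) $ i $ j"
      by (simp add: sum.distrib matrix_mul_assoc)
  qed
qed

lemma trace_matrix_power_variation:
  "trace (matrix_power M a ** matrix_power_variation X M r) = of_nat r * trace (X ** matrix_power M (a + r))"
proof (induction r arbitrary: a)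
  case 0
  then show ?case by (simp add: trace_def matrix_matrix_mult_def)
next
  case (Suc r)
  let ?V = "matrix_power_variation X M r"
  have "matrix_power M a ** matrix_power_variation X M (Suc r) =
      matrix_power M a ** (X ** matrix_power M (Suc r)) + matrix_power M (Suc a) ** ?V"
    by (simp add: matrix_add_ldistrib matrix_mul_assoc matrix_power_commute)
  moreover have "trace (matrix_power M a ** (X ** matrix_power M (Suc r))) = trace (X ** matrix_power M (a + Suc r))"
    by (subst trace_mul_sym) (simp only: matrix_mul_assoc[symmetric] matrix_power_add add.commute)
  ultimately show ?case
    by (simp add: trace_add Suc.IH distrib_right del: matrix_power.simps matrix_power_variation.simps)
qed

lemma left_derivative_trace_power:
  "left_derivative (\<lambda>M. trace (matrix_power M r)) (\<lambda>X M. of_nat r * trace (X ** matrix_power M r))"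
proof (rule left_derivative_cong)
  show "left_derivative (\<lambda>M. \<Sum>i\<in>UNIV. matrix_power M r $ i $ i)
      (\<lambda>X M. \<Sum>i\<in>UNIV. matrix_power_variation X M r $ i $ i)"
    by (intro left_derivative_sum left_derivative_matrix_power)
  show "(\<Sum>i\<in>UNIV. matrix_power_variation X M r $ i $ i) = of_nat r * trace (X ** matrix_power M r)" for X M :: "complex ^ 'a ^ 'a"
    using trace_matrix_power_variation[of M 0 X r] by (simp add: trace_def)
qed (simp add: trace_def)

lemma left_derivative_trace: "left_derivative trace (\<lambda>X M. trace (X ** M))"
  using left_derivative_trace_power[of 1] by simp

text \<open>If \<open>M\<close> moves in the direction \<open>X M\<close>, then the logarithm of \<open>1 / det (1 - t M)\<close> moves by
  \<open>t tr (M (1 - t M)\<^sup>-\<^sup>1 X)\<close>, which is the series in the second factor.\<close>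

definition homogeneous_variation :: "complex ^ 'n ^ 'n \<Rightarrow> complex ^ 'n ^ 'n \<Rightarrow> complex fps" where
  "homogeneous_variation X M =
     homogeneous_fps M * Abs_fps (\<lambda>r. if r = 0 then 0 else trace (X ** matrix_power M r))"

text \<open>Newton's identity determines the coefficients recursively from traces of powers. Writing \<open>H' = P H\<close>
  for it, with \<open>Q\<close> for the claimed logarithmic derivative of \<open>H\<close>, the derivative of \<open>P\<close> is \<open>Q'\<close>,
  and \<open>(H Q)' = P (H Q) + Q' H\<close> shows that \<open>H Q\<close> satisfies the differentiated recursion.\<close>

lemma left_derivative_homogeneous:
  "left_derivative (\<lambda>M :: complex ^ 'n ^ 'n. fps_nth (homogeneous_fps M) k)
     (\<lambda>X M. fps_nth (homogeneous_variation X M) k)"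
proof (induction k rule: less_induct)
  case (less k)
  show ?case
  proof (cases k)
    case 0
    then show ?thesis
      using left_derivative_const[of 1] by (simp add: homogeneous_variation_def)
  next
    case (Suc m)
    have "left_derivative
      (\<lambda>M :: complex ^ 'n ^ 'n. (1 / of_nat k) * (\<Sum>i = 0..m. trace (matrix_power M (Suc i)) * fps_nth (homogeneous_fps M) (m - i)))
      (\<lambda>X M. (1 / of_nat k) * (\<Sum>i = 0..m. of_nat (Suc i) * trace (X ** matrix_power M (Suc i)) * fps_nth (homogeneous_fps M) (m - i)
          + trace (matrix_power M (Suc i)) * fps_nth (homogeneous_variation X M) (m - i)))"
      by (intro left_derivative_scale left_derivative_sum left_derivative_mult left_derivative_trace_power less.IH)
        (use Suc in auto)
    then show ?thesis
    proof (rule left_derivative_cong)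
      fix X M :: "complex ^ 'n ^ 'n"
      let ?H = "homogeneous_fps M" and ?P = "power_sum_fps M"
      let ?Q = "Abs_fps (\<lambda>r. if r = 0 then 0 else trace (X ** matrix_power M r))"
      have cancel: "(1 / of_nat k) * s = h" if "of_nat k * h = s" for s h :: complex
        using Suc by (simp add: that[symmetric] del: of_nat_Suc)
      have "of_nat k * fps_nth ?H k = fps_nth (fps_deriv ?H) m"
        by (simp add: Suc)
      also have "\<dots> = (\<Sum>i = 0..m. trace (matrix_power M (Suc i)) * fps_nth ?H (m - i))"
        unfolding fps_deriv_homogeneous fps_mult_nth power_sum_fps_def by simp
      finally show "(1 / of_nat k) * (\<Sum>i = 0..m. trace (matrix_power M (Suc i)) * fps_nth ?H (m - i)) = fps_nth ?H k"
        by (rule cancel)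
      have "of_nat k * fps_nth (homogeneous_variation X M) k = fps_nth (fps_deriv (?H * ?Q)) m"
        by (simp only: Suc homogeneous_variation_def fps_deriv_nth Suc_eq_plus1)
      also have "fps_deriv (?H * ?Q) = fps_deriv ?Q * ?H + ?P * (?H * ?Q)"
        by (simp add: fps_deriv_homogeneous algebra_simps)
      also have "fps_nth \<dots> m =
         (\<Sum>i = 0..m. of_nat (Suc i) * trace (X ** matrix_power M (Suc i)) * fps_nth ?H (m - i)
          + trace (matrix_power M (Suc i)) * fps_nth (homogeneous_variation X M) (m - i))"
        unfolding fps_add_nth fps_mult_nth[of "fps_deriv ?Q"] fps_mult_nth[of ?P] sum.distrib homogeneous_variation_def[symmetric]
        by (simp add: power_sum_fps_def del: matrix_power.simps)
      finally show "(1 / of_nat k) * (\<Sum>i = 0..m. of_nat (Suc i) * trace (X ** matrix_power M (Suc i)) * fps_nth ?H (m - i)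
          + trace (matrix_power M (Suc i)) * fps_nth (homogeneous_variation X M) (m - i)) =
          fps_nth (homogeneous_variation X M) k"
        by (rule cancel)
    qed
  qed
qed

lemma left_derivative_perm_det:
  assumes "\<And>i j. left_derivative (A i j) (DA i j)"
  shows "left_derivative (\<lambda>M. perm_det n (\<lambda>i j. A i j M))
    (\<lambda>X M. perm_det_deriv n (\<lambda>i j. A i j M) (\<lambda>i j. DA i j X M))"
proof (rule left_derivative_cong)
  show "left_derivative (\<lambda>M. \<Sum>p | p permutes {1..n}. of_int (sign p) * (\<Prod>i = 1..n. A i (p i) M))
     (\<lambda>X M. \<Sum>p | p permutes {1..n}. of_int (sign p) *
        (\<Sum>k = 1..n. \<Prod>i = 1..n. if i = k then DA i (p i) X M else A i (p i) M))"
    by (intro left_derivative_sum left_derivative_scale left_derivative_prod assms) simp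
  show "(\<Sum>p | p permutes {1..n}. of_int (sign p) *
        (\<Sum>k = 1..n. \<Prod>i = 1..n. if i = k then DA i (p i) X M else A i (p i) M)) =
      perm_det_deriv n (\<lambda>i j. A i j M) (\<lambda>i j. DA i j X M)" for X M
  proof -
    have upd: "((\<lambda>i j. A i j M)(k := \<lambda>j. DA k j X M)) i j = (if i = k then DA i j X M else A i j M)" for i j k
      by simp
    show ?thesis
      unfolding perm_det_deriv_def perm_det_def upd sum_distrib_left by (rule sum.swap)
  qed
qed (simp add: perm_det_def)

definition homogeneous_variation_int :: "complex ^ 'n ^ 'n \<Rightarrow> complex ^ 'n ^ 'n \<Rightarrow> int \<Rightarrow> complex" where
  "homogeneous_variation_int X M k = (if k < 0 then 0 else fps_nth (homogeneous_variation X M) (nat k))"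

definition schur_variation ::
  "(nat \<Rightarrow> int) \<Rightarrow> complex ^ 'n ^ 'n \<Rightarrow> complex ^ 'n ^ 'n \<Rightarrow> complex" where
  "schur_variation lam X M = jacobi_trudi_deriv CARD('n)
     (complete_homogeneous (eigenvalue_mset M)) (homogeneous_variation_int X M) lam"

lemma schur_eq_jacobi_trudi: "schur n lam E = jacobi_trudi n (complete_homogeneous E) lam"
  by (simp add: schur_def jacobi_trudi_def perm_det_def)

lemma left_derivative_schur:
  "left_derivative (\<lambda>M :: complex ^ 'n ^ 'n. schur_matrix lam M) (schur_variation lam)"
proof -
  have "left_derivative (\<lambda>M :: complex ^ 'n ^ 'n. complete_homogeneous (eigenvalue_mset M) k)
      (\<lambda>X M. homogeneous_variation_int X M k)" for k
    by (cases "k < 0")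
      (simp_all add: complete_homogeneous_eigenvalues homogeneous_variation_int_def
        left_derivative_const left_derivative_homogeneous)
  then show ?thesis
    unfolding schur_eq_jacobi_trudi jacobi_trudi_def schur_variation_def jacobi_trudi_deriv_def
    by (rule left_derivative_perm_det)
qed

lemma left_derivative_det:
  "left_derivative (\<lambda>M :: complex ^ 'n ^ 'n. det (mat 1 + M))
     (\<lambda>X M. \<Sum>k\<in>UNIV. det (\<chi> i. if i = k then (X ** M) $ i else (mat 1 + M) $ i))"
proof (rule left_derivative_cong)
  let ?P = "{p. p permutes (UNIV :: 'n set)}"
  show "left_derivative (\<lambda>M :: complex ^ 'n ^ 'n. \<Sum>p\<in>?P. of_int (sign p) * (\<Prod>i\<in>UNIV. mat 1 $ i $ p i + M $ i $ p i))
     (\<lambda>X M. \<Sum>p\<in>?P. of_int (sign p) *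
        (\<Sum>k\<in>UNIV. \<Prod>i\<in>UNIV. if i = k then 0 + (X ** M) $ i $ p i else mat 1 $ i $ p i + M $ i $ p i))"
    by (intro left_derivative_sum left_derivative_scale left_derivative_prod left_derivative_add
        left_derivative_const left_derivative_entry) simp
  show "(\<Sum>p\<in>?P. of_int (sign p) *
        (\<Sum>k\<in>UNIV. \<Prod>i\<in>UNIV. if i = k then 0 + (X ** M) $ i $ p i else mat 1 $ i $ p i + M $ i $ p i)) =
      (\<Sum>k\<in>UNIV. det (\<chi> i. if i = k then (X ** M) $ i else (mat 1 + M) $ i))" for X M :: "complex ^ 'n ^ 'n"
  proof -
    have row: "(\<chi> i. if i = k then (X ** M) $ i else (mat 1 + M) $ i) $ i $ j =
        (if i = k then 0 + (X ** M) $ i $ j else mat 1 $ i $ j + M $ i $ j)" for k i j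
      by simp
    show ?thesis
      unfolding det_def row sum_distrib_left by (rule sum.swap)
  qed
qed (simp add: det_def)

lemma left_derivative_additive:
  assumes "left_derivative F D" "M \<in> unitary_group"
  shows "D (X + Y) M = D X M + D Y M"
  using left_derivative_linear[OF assms, of "X + Y"] left_derivative_linear[OF assms, of X] left_derivative_linear[OF assms, of Y]
  by (simp only: vector_add_component distrib_right sum.distrib)

text \<open>On unitary matrices \<open>tr (M\<^sup>* M\<^sup>r) = tr (M\<^sup>r\<^sup>-\<^sup>1)\<close> for \<open>r \<ge> 1\<close>, and the trace for \<open>r = 1\<close> is \<open>n\<close>.\<close>

lemma homogeneous_variation_adjoint:
  fixes M :: "complex ^ 'n ^ 'n"
  assumes M: "M \<in> unitary_group"
  shows "homogeneous_variation_int (adjoint_matrix M) M =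
    (\<lambda>k. of_int (k - 1 + int CARD('n)) * complete_homogeneous (eigenvalue_mset M) (k - 1))"
proof
  fix k :: int
  have "trace (adjoint_matrix M ** matrix_power M (Suc r)) = trace (matrix_power M r)" for r
    using M by (simp add: matrix_mul_assoc unitary_group_iff)
  note trace = this
  have Q: "Abs_fps (\<lambda>r. if r = 0 then 0 else trace (adjoint_matrix M ** matrix_power M r)) =
      fps_X * (of_nat CARD('n) + fps_X * power_sum_fps M)"
  proof (rule fps_ext)
    show "fps_nth (Abs_fps (\<lambda>r. if r = 0 then 0 else trace (adjoint_matrix M ** matrix_power M r))) r =
        fps_nth (fps_X * (of_nat CARD('n) + fps_X * power_sum_fps M)) r" for r
    proof (cases r)
      case (Suc m)
      then show ?thesis
        by (cases m) (simp_all add: trace power_sum_fps_def trace_I del: matrix_power.simps(2) flip: fps_of_nat)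
    qed simp
  qed
  have V: "homogeneous_variation (adjoint_matrix M) M =
      fps_X * (of_nat CARD('n) * homogeneous_fps M + fps_X * fps_deriv (homogeneous_fps M))"
    unfolding homogeneous_variation_def Q fps_deriv_homogeneous by (simp add: algebra_simps)
  show "homogeneous_variation_int (adjoint_matrix M) M k =
      of_int (k - 1 + int CARD('n)) * complete_homogeneous (eigenvalue_mset M) (k - 1)"
  proof (cases "k \<le> 0")
    case True
    then show ?thesis
      by (auto simp: homogeneous_variation_int_def complete_homogeneous_eigenvalues V)
  next
    case False
    then obtain m where k: "k = int (Suc m)"
      by (metis not_le zero_less_imp_eq_int gr0_implies_Suc)
    show ?thesis
      by (cases m) (simp_all add: k homogeneous_variation_int_def complete_homogeneous_eigenvalues V nat_add_distrib
          algebra_simps flip: fps_of_nat)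
  qed
qed

lemma homogeneous_variation_identity:
  "homogeneous_variation_int (mat 1) M = (\<lambda>k. of_int k * complete_homogeneous (eigenvalue_mset M) k)"
proof
  fix k :: int
  have "Abs_fps (\<lambda>r. if r = 0 then 0 else trace (mat 1 ** matrix_power M r)) = fps_X * power_sum_fps M"
    by (intro fps_ext) (auto simp: power_sum_fps_def gr0_conv_Suc simp del: matrix_power.simps)
  then have V: "homogeneous_variation (mat 1) M = fps_X * fps_deriv (homogeneous_fps M)"
    by (simp add: homogeneous_variation_def fps_deriv_homogeneous algebra_simps)
  show "homogeneous_variation_int (mat 1) M k = of_int k * complete_homogeneous (eigenvalue_mset M) k"
    by (cases k rule: int_cases) (auto simp: homogeneous_variation_int_def complete_homogeneous_eigenvalues V gr0_conv_Suc)
qed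

lemma homogeneous_variation_self:
  "homogeneous_variation_int M M = (\<lambda>k. of_int (k + 1) * complete_homogeneous (eigenvalue_mset M) (k + 1)
     + coeff (reverse_charpoly M) 1 * complete_homogeneous (eigenvalue_mset M) k)"
proof
  fix k :: int
  have Q: "Abs_fps (\<lambda>r. if r = 0 then 0 else trace (M ** matrix_power M r)) = power_sum_fps M - fps_const (trace M)"
    by (intro fps_ext) (auto simp: power_sum_fps_def)
  have V: "homogeneous_variation M M = fps_deriv (homogeneous_fps M) - fps_const (trace M) * homogeneous_fps M"
    unfolding homogeneous_variation_def Q fps_deriv_homogeneous by (simp add: algebra_simps)
  show "homogeneous_variation_int M M k = of_int (k + 1) * complete_homogeneous (eigenvalue_mset M) (k + 1)
     + coeff (reverse_charpoly M) 1 * complete_homogeneous (eigenvalue_mset M) k"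
  proof (cases "k < 0")
    case True
    then show ?thesis
      by (cases "k = -1") (auto simp: homogeneous_variation_int_def complete_homogeneous_eigenvalues)
  next
    case False
    then obtain m where k: "k = int m"
      by (metis not_less nonneg_int_cases)
    show ?thesis
      by (simp add: k homogeneous_variation_int_def complete_homogeneous_eigenvalues V nat_add_distrib algebra_simps
          reverse_charpoly_traces(1)[unfolded One_nat_def])
  qed
qed

lemma schur_variation_adjoint:
  fixes M :: "complex ^ 'n ^ 'n"
  assumes "M \<in> unitary_group"
  shows "schur_variation lam (adjoint_matrix M) M =
    (\<Sum>i = 1..CARD('n). of_int (lam i - int i + int CARD('n)) * schur_matrix (lam(i := lam i - 1)) M)"
  unfolding schur_variation_def homogeneous_variation_adjoint[OF assms] schur_eq_jacobi_trudi
  by (rule jacobi_trudi_deriv_down)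

lemma schur_variation_identity:
  fixes M :: "complex ^ 'n ^ 'n"
  shows "schur_variation lam (mat 1) M = of_int (tuple_size CARD('n) lam) * schur_matrix lam M"
  unfolding schur_variation_def homogeneous_variation_identity schur_eq_jacobi_trudi
  by (rule jacobi_trudi_deriv_euler)

lemma schur_variation_self:
  fixes M :: "complex ^ 'n ^ 'n"
  assumes "\<And>i. i \<in> {1..CARD('n)} \<Longrightarrow> lam i - int i \<ge> - int CARD('n)"
  shows "schur_variation lam M M =
    (\<Sum>i = 1..CARD('n). of_int (lam i - int i + 1) * schur_matrix (lam(i := lam i + 1)) M)"
  unfolding schur_variation_def homogeneous_variation_self schur_eq_jacobi_trudi
  by (rule jacobi_trudi_deriv_up) (use assms homogeneous_linear_recurrence in auto)

text \<open>Multiplication by the first power sum; the hypothesis on \<open>lam\<close> keeps all terms in the range where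
  the recurrence of the complete homogeneous functions is valid.\<close>

lemma schur_times_trace:
  fixes M :: "complex ^ 'n ^ 'n"
  assumes "\<And>i. i \<in> {1..CARD('n)} \<Longrightarrow> lam i - int i \<ge> - int CARD('n)"
  shows "(\<Sum>i = 1..CARD('n). schur_matrix (lam(i := lam i + 1)) M) = trace M * schur_matrix lam M"
  unfolding schur_eq_jacobi_trudi
  using jacobi_trudi_pieri[OF _ homogeneous_linear_recurrence[of M] assms]
  by (simp add: reverse_charpoly_traces(1)[simplified])

lemma schur_times_trace_square:
  fixes M :: "complex ^ 'n ^ 'n"
  assumes "\<And>i. i \<in> {1..CARD('n)} \<Longrightarrow> lam i - int i \<ge> - int CARD('n)"
  shows "(\<Sum>i = 1..CARD('n). schur_matrix (lam(i := lam i + 2)) M) = trace (M ** M) * schur_matrix lam M"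
  unfolding schur_eq_jacobi_trudi reverse_charpoly_traces(2)[symmetric]
  by (rule jacobi_trudi_power_sum_2) (use assms homogeneous_linear_recurrence reverse_charpoly_traces(3) in auto)

text \<open>Via Newton's identity, because traces of powers commute with conjugation.\<close>

lemma homogeneous_fps_cnj: "fps_nth (homogeneous_fps (cnj_matrix M)) k = cnj (fps_nth (homogeneous_fps M) k)"
proof (induction k rule: less_induct)
  case (less k)
  have mult: "cnj_matrix (A ** B) = cnj_matrix A ** cnj_matrix B" for A B :: "complex ^ 'a ^ 'a"
    by (simp add: vec_eq_iff cnj_matrix_def matrix_matrix_mult_def)
  have one: "cnj_matrix (mat 1) = mat 1"
    by (simp add: vec_eq_iff cnj_matrix_def mat_def)
  have pow: "matrix_power (cnj_matrix M) r = cnj_matrix (matrix_power M r)" for r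
    by (induction r) (simp_all add: mult one)
  have tr: "trace (matrix_power (cnj_matrix M) r) = cnj (trace (matrix_power M r))" for r
    unfolding pow by (simp add: trace_def cnj_matrix_def)
  have newton: "of_nat (Suc m) * fps_nth (homogeneous_fps A) (Suc m) =
      (\<Sum>i = 0..m. trace (matrix_power A (Suc i)) * fps_nth (homogeneous_fps A) (m - i))" for m and A :: "complex ^ 'a ^ 'a"
    using arg_cong[OF fps_deriv_homogeneous[of A], of "\<lambda>F. fps_nth F m"]
    by (simp add: fps_mult_nth power_sum_fps_def del: matrix_power.simps)
  show ?case
  proof (cases k)
    case (Suc m)
    have "of_nat (Suc m) * fps_nth (homogeneous_fps (cnj_matrix M)) (Suc m) =
      (\<Sum>i = 0..m. cnj (trace (matrix_power M (Suc i)) * fps_nth (homogeneous_fps M) (m - i)))"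
      unfolding newton tr by (intro sum.cong) (simp_all add: less.IH Suc del: matrix_power.simps)
    also have "\<dots> = cnj (of_nat (Suc m) * fps_nth (homogeneous_fps M) (Suc m))"
      unfolding newton by simp
    finally show ?thesis
      by (simp add: Suc del: of_nat_Suc)
  qed simp
qed

lemma schur_cnj: "schur n lam (eigenvalue_mset (cnj_matrix M)) = cnj (schur n lam (eigenvalue_mset M))"
proof -
  have "complete_homogeneous (eigenvalue_mset (cnj_matrix M)) k = cnj (complete_homogeneous (eigenvalue_mset M) k)" for k
    by (simp add: complete_homogeneous_eigenvalues homogeneous_fps_cnj)
  then show ?thesis
    by (simp add: schur_def)
qed

lemma trace_cnj: "trace (cnj_matrix M) = cnj (trace M)"
  by (simp add: trace_def cnj_matrix_def)

section \<open>The equations for the Taylor coefficients\<close>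

text \<open>The integrand of the coefficient of \<open>z\<^sup>k / k!\<close>, with the functions of the conjugate matrix written
  as conjugates of functions of \<open>M\<close>.\<close>

definition moment_integrand ::
  "nat \<Rightarrow> nat \<Rightarrow> (nat \<Rightarrow> int) \<Rightarrow> (nat \<Rightarrow> int) \<Rightarrow> complex ^ 'n ^ 'n \<Rightarrow> complex" where
  "moment_integrand q k lam mu M =
     schur_matrix lam M * cnj (schur_matrix mu M) * det (mat 1 + M) ^ q * cnj (trace M) ^ k"

definition moment ::
  "(complex ^ 'n ^ 'n) measure \<Rightarrow> nat \<Rightarrow> nat \<Rightarrow> (nat \<Rightarrow> int) \<Rightarrow> (nat \<Rightarrow> int) \<Rightarrow> complex" where
  "moment H q k lam mu = (LINT M|H. moment_integrand q k lam mu M)"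

definition det_variation :: "complex ^ 'n ^ 'n \<Rightarrow> complex ^ 'n ^ 'n \<Rightarrow> complex" where
  "det_variation X M = (\<Sum>k\<in>UNIV. det (\<chi> i. if i = k then (X ** M) $ i else (mat 1 + M) $ i))"

text \<open>Used with \<open>B = 1\<close> for \<open>X = M\<^sup>-\<^sup>1 + 1\<close>, and with \<open>B = M\<close> for \<open>X = M + 1\<close>.\<close>

lemma det_variation_eq:
  assumes "X ** M = B ** (mat 1 + M)"
  shows "det_variation X M = trace B * det (mat 1 + M)"
  unfolding det_variation_def assms by (rule sum_det_row_mult)

text \<open>The product rule for the integrand of the moments; the conjugated factors move in the direction
  \<open>- X\<^sup>*\<close>.\<close>

definition moment_variation ::
  "nat \<Rightarrow> nat \<Rightarrow> (nat \<Rightarrow> int) \<Rightarrow> (nat \<Rightarrow> int) \<Rightarrow> complex ^ 'n ^ 'n \<Rightarrow> complex ^ 'n ^ 'n \<Rightarrow> complex" where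
  "moment_variation q k lam mu X M =
     ((schur_variation lam X M * cnj (schur_matrix mu M)
        + schur_matrix lam M * - cnj (schur_variation mu (adjoint_matrix X) M)) * det (mat 1 + M) ^ q
      + schur_matrix lam M * cnj (schur_matrix mu M)
        * (of_nat q * det (mat 1 + M) ^ (q - 1) * det_variation X M)) * cnj (trace M) ^ k
     + schur_matrix lam M * cnj (schur_matrix mu M) * det (mat 1 + M) ^ q
        * (of_nat k * cnj (trace M) ^ (k - 1) * - cnj (trace (adjoint_matrix X ** M)))"

lemma left_derivative_moment_integrand:
  "left_derivative (moment_integrand q k lam mu :: complex ^ 'n ^ 'n \<Rightarrow> complex) (moment_variation q k lam mu)"
  unfolding moment_integrand_def[abs_def] moment_variation_def[abs_def] det_variation_def
  by (intro left_derivative_mult left_derivative_power left_derivative_cnj left_derivative_schur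
      left_derivative_trace left_derivative_det left_derivative_cnj[OF left_derivative_schur]
      left_derivative_cnj[OF left_derivative_trace])

lemma moment_integrable:
  assumes "normalized_haar_measure H"
  shows "integrable H (moment_integrand q k lam mu)"
  by (rule haar_integrable[OF assms left_derivative_continuous(1)[OF left_derivative_moment_integrand]])

lemma matrix_mult_add_left: "(A + B) ** C = A ** C + B ** C" for A B C :: "complex ^ 'n ^ 'n"
  by (simp add: vec_eq_iff matrix_matrix_mult_def distrib_right sum.distrib)

lemma adjoint_matrix_add_mat: "adjoint_matrix (M + mat 1) = adjoint_matrix M + mat 1"
  by (simp add: vec_eq_iff adjoint_matrix_nth mat_def)

lemma adjoint_adjoint_matrix [simp]: "adjoint_matrix (adjoint_matrix M) = M"
  by (simp add: vec_eq_iff adjoint_matrix_nth)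

definition in_recurrence_range :: "nat \<Rightarrow> (nat \<Rightarrow> int) \<Rightarrow> bool" where
  "in_recurrence_range n lam \<longleftrightarrow> (\<forall>i\<in>{1..n}. lam i - int i \<ge> - int n)"

text \<open>The divergence of the vector field \<open>M \<mapsto> (M\<^sup>* + 1) M = 1 + M\<close>. The power sums of the inverse matrix
  that it produces are absorbed into the Schur function of \<open>mu\<close>. The tuples on the right need not
  be partitions here: their Schur functions are Jacobi-Trudi determinants.\<close>

lemma moment_down:
  fixes H :: "(complex ^ 'n ^ 'n) measure"
  assumes haar: "normalized_haar_measure H" and n: "n = CARD('n)"
    and mu: "in_recurrence_range n mu"
  shows "(\<Sum>i = 1..n. of_int (lam i - int i + int n) * moment H q k (lam(i := lam i - 1)) mu)
     - (\<Sum>i = 1..n. of_int (mu i - int i + int n + 1) * moment H q k lam (mu(i := mu i + 1)))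
     + of_int (tuple_size n lam - tuple_size n mu + int n * int q) * moment H q k lam mu
     - of_nat k * ((\<Sum>i = 1..n. moment H q (k - 1) lam (mu(i := mu i + 2)))
         + (\<Sum>i = 1..n. moment H q (k - 1) lam (mu(i := mu i + 1)))) = 0"
    (is "?sum = 0")
proof -
  have sp: "space H = unitary_group"
    using haar by (simp add: normalized_haar_measure_def)
  have mu': "\<And>i. i \<in> {1..CARD('n)} \<Longrightarrow> mu i - int i \<ge> - int CARD('n)"
    using mu n by (simp add: in_recurrence_range_def)
  let ?Y = "\<lambda>M :: complex ^ 'n ^ 'n. adjoint_matrix M + mat 1"
  let ?DY = "\<lambda>i j X M :: complex ^ 'n ^ 'n. - cnj ((adjoint_matrix X ** M) $ j $ i) + 0"
  let ?F = "moment_integrand q k lam mu :: complex ^ 'n ^ 'n \<Rightarrow> complex"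
  let ?G = "\<lambda>M. (\<Sum>i = 1..n. of_int (lam i - int i + int n) * moment_integrand q k (lam(i := lam i - 1)) mu M)
     - (\<Sum>i = 1..n. of_int (mu i - int i + int n + 1) * moment_integrand q k lam (mu(i := mu i + 1)) M)
     + of_int (tuple_size n lam - tuple_size n mu + int n * int q) * moment_integrand q k lam mu M
     - of_nat k * ((\<Sum>i = 1..n. moment_integrand q (k - 1) lam (mu(i := mu i + 2)) M)
         + (\<Sum>i = 1..n. moment_integrand q (k - 1) lam (mu(i := mu i + 1)) M))"
  have Y: "left_derivative (\<lambda>M. ?Y M $ i $ j) (?DY i j)" for i j
    unfolding vector_add_component adjoint_matrix_nth
    by (intro left_derivative_add left_derivative_const left_derivative_cnj[OF left_derivative_entry])
  have pointwise: "moment_variation q k lam mu (?Y M) M +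
      ?F M * (\<Sum>i\<in>UNIV. \<Sum>j\<in>UNIV. ?DY i j (matrix_unit i j) M) = ?G M" if M: "M \<in> unitary_group" for M
  proof -
    let ?S = "schur_matrix lam M" and ?S' = "cnj (schur_matrix mu M)"
    let ?\<Delta> = "det (mat 1 + M)" and ?T = "cnj (trace M)"
    have adj: "adjoint_matrix (?Y M) = M + mat 1"
      by (simp add: adjoint_matrix_add_mat)
    have div: "(\<Sum>i\<in>UNIV. \<Sum>j\<in>UNIV. ?DY i j (matrix_unit i j) M) = - (of_nat n * ?T)"
    proof -
      have "(adjoint_matrix (matrix_unit i j) ** M) $ j $ i = M $ i $ i" for i j :: 'n
        by (simp add: matrix_matrix_mult_def adjoint_matrix_nth matrix_unit_def if_distrib[of cnj]
            if_distrib[of "\<lambda>c. c * _"] cong: if_cong)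
      then show ?thesis
        by (simp add: n trace_def sum_negf sum_distrib_left)
    qed
    have det: "det_variation (?Y M) M = of_nat n * ?\<Delta>"
    proof -
      have "?Y M ** M = mat 1 ** (mat 1 + M)"
        using M by (simp add: matrix_mult_add_left unitary_group_iff)
      from det_variation_eq[OF this] show ?thesis
        by (simp add: trace_I n)
    qed
    have tr: "trace ((M + mat 1) ** M) = trace (M ** M) + trace M"
      by (simp add: matrix_mult_add_left trace_add)
    have 1: "schur_variation lam (?Y M) M =
        (\<Sum>i = 1..n. of_int (lam i - int i + int n) * schur_matrix (lam(i := lam i - 1)) M) + of_int (tuple_size n lam) * ?S"
      by (simp only: left_derivative_additive[OF left_derivative_schur M] schur_variation_adjoint[OF M]
          schur_variation_identity n)
    have 2: "cnj (schur_variation mu (M + mat 1) M) =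
        (\<Sum>i = 1..n. of_int (mu i - int i + 1) * cnj (schur_matrix (mu(i := mu i + 1)) M)) + of_int (tuple_size n mu) * ?S'"
    proof -
      have "schur_variation mu M M =
          (\<Sum>i = 1..CARD('n). of_int (mu i - int i + 1) * schur_matrix (mu(i := mu i + 1)) M)"
        by (rule schur_variation_self) (rule mu')
      then show ?thesis
        by (simp only: left_derivative_additive[OF left_derivative_schur M] schur_variation_identity n) simp
    qed
    have 3: "?T * ?S' = (\<Sum>i = 1..n. cnj (schur_matrix (mu(i := mu i + 1)) M))"
      using arg_cong[OF schur_times_trace[OF mu', of M], of cnj] by (simp add: n)
    have 4: "cnj (trace (M ** M)) * ?S' = (\<Sum>i = 1..n. cnj (schur_matrix (mu(i := mu i + 2)) M))"
      using arg_cong[OF schur_times_trace_square[OF mu', of M], of cnj] by (simp add: n)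
    define A where "A = (\<Sum>i = 1..n. of_int (lam i - int i + int n) * schur_matrix (lam(i := lam i - 1)) M)"
    define B where "B = (\<Sum>i = 1..n. of_int (mu i - int i + 1) * cnj (schur_matrix (mu(i := mu i + 1)) M))"
    define P1 where "P1 = (\<Sum>i = 1..n. cnj (schur_matrix (mu(i := mu i + 1)) M))"
    define P2 where "P2 = (\<Sum>i = 1..n. cnj (schur_matrix (mu(i := mu i + 2)) M))"
    have q: "of_nat q * ?\<Delta> ^ (q - 1) * ?\<Delta> = of_nat q * ?\<Delta> ^ q"
      by (cases q) auto
    have B': "(\<Sum>i = 1..n. of_int (mu i - int i + int n + 1) * cnj (schur_matrix (mu(i := mu i + 1)) M)) = B + of_nat n * P1"
      by (simp add: B_def P1_def sum_distrib_left distrib_right sum.distrib algebra_simps sum_subtractf)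
    have G: "?G M = A * ?S' * ?\<Delta> ^ q * ?T ^ k - ?S * (B + of_nat n * P1) * ?\<Delta> ^ q * ?T ^ k
        + of_int (tuple_size n lam - tuple_size n mu + int n * int q) * (?S * ?S' * ?\<Delta> ^ q * ?T ^ k)
        - of_nat k * (?S * P2 * ?\<Delta> ^ q * ?T ^ (k - 1) + ?S * P1 * ?\<Delta> ^ q * ?T ^ (k - 1))"
      unfolding B'[symmetric]
      unfolding A_def P1_def P2_def moment_integrand_def sum_distrib_left sum_distrib_right
      by (simp only: mult_ac)
    have "moment_variation q k lam mu (?Y M) M + ?F M * (- (of_nat n * ?T)) =
      ((A + of_int (tuple_size n lam) * ?S) * ?S' + ?S * - (B + of_int (tuple_size n mu) * ?S')) * ?\<Delta> ^ q * ?T ^ k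
       + ?S * ?S' * (of_nat n * (of_nat q * ?\<Delta> ^ (q - 1) * ?\<Delta>)) * ?T ^ k
       - of_nat k * ?T ^ (k - 1) * ?S * ?\<Delta> ^ q * (cnj (trace (M ** M)) * ?S' + ?T * ?S')
       - of_nat n * ?S * (?T * ?S') * ?\<Delta> ^ q * ?T ^ k"
      unfolding moment_variation_def moment_integrand_def adj 1 2 det tr A_def[symmetric] B_def[symmetric]
      by (simp add: algebra_simps)
    also have "\<dots> = ?G M"
      unfolding G q 3 4 P1_def[symmetric] P2_def[symmetric] by (simp add: algebra_simps)
    finally show ?thesis
      unfolding div .
  qed
  have "0 = (LINT M|H. moment_variation q k lam mu (?Y M) M +
      ?F M * (\<Sum>i\<in>UNIV. \<Sum>j\<in>UNIV. ?DY i j (matrix_unit i j) M))"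
    using haar_divergence[OF haar left_derivative_moment_integrand Y] by (rule sym)
  also have "\<dots> = (LINT M|H. ?G M)"
    using pointwise sp by (intro Bochner_Integration.integral_cong refl) auto
  also have "\<dots> = ?sum"
    using moment_integrable[OF haar] by (simp add: moment_def)
  finally show ?thesis by simp
qed

text \<open>The divergence of the vector field \<open>M \<mapsto> (M + 1) M\<close>. Here the trace of \<open>M\<close>, coming from the
  divergence and from \<open>det (1 + M)\<close>, is absorbed into the Schur function of \<open>lam\<close>.\<close>

lemma moment_up:
  fixes H :: "(complex ^ 'n ^ 'n) measure"
  assumes haar: "normalized_haar_measure H" and n: "n = CARD('n)"
    and lam: "in_recurrence_range n lam" and mu: "in_recurrence_range n mu"
  shows "(\<Sum>i = 1..n. of_int (mu i - int i + int n) * moment H q k lam (mu(i := mu i - 1)))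
     - (\<Sum>i = 1..n. of_int (lam i - int i + int n + int q + 1) * moment H q k (lam(i := lam i + 1)) mu)
     + of_int (tuple_size n mu - tuple_size n lam) * moment H q k lam mu
     + of_nat k * (of_nat n * moment H q (k - 1) lam mu
         + (\<Sum>i = 1..n. moment H q (k - 1) lam (mu(i := mu i + 1)))) = 0"
    (is "?sum = 0")
proof -
  have sp: "space H = unitary_group"
    using haar by (simp add: normalized_haar_measure_def)
  have mu': "\<And>i. i \<in> {1..CARD('n)} \<Longrightarrow> mu i - int i \<ge> - int CARD('n)"
    and lam': "\<And>i. i \<in> {1..CARD('n)} \<Longrightarrow> lam i - int i \<ge> - int CARD('n)"
    using mu lam n by (simp_all add: in_recurrence_range_def)
  let ?Y = "\<lambda>M :: complex ^ 'n ^ 'n. M + mat 1"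
  let ?DY = "\<lambda>i j X M :: complex ^ 'n ^ 'n. (X ** M) $ i $ j + 0"
  let ?F = "moment_integrand q k lam mu :: complex ^ 'n ^ 'n \<Rightarrow> complex"
  let ?G = "\<lambda>M. (\<Sum>i = 1..n. of_int (mu i - int i + int n) * moment_integrand q k lam (mu(i := mu i - 1)) M)
     - (\<Sum>i = 1..n. of_int (lam i - int i + int n + int q + 1) * moment_integrand q k (lam(i := lam i + 1)) mu M)
     + of_int (tuple_size n mu - tuple_size n lam) * moment_integrand q k lam mu M
     + of_nat k * (of_nat n * moment_integrand q (k - 1) lam mu M
         + (\<Sum>i = 1..n. moment_integrand q (k - 1) lam (mu(i := mu i + 1)) M))"
  have Y: "left_derivative (\<lambda>M. ?Y M $ i $ j) (?DY i j)" for i j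
    unfolding vector_add_component
    by (intro left_derivative_add left_derivative_const left_derivative_entry)
  have pointwise: "moment_variation q k lam mu (?Y M) M +
      ?F M * (\<Sum>i\<in>UNIV. \<Sum>j\<in>UNIV. ?DY i j (matrix_unit i j) M) = - ?G M" if M: "M \<in> unitary_group" for M
  proof -
    let ?S = "schur_matrix lam M" and ?S' = "cnj (schur_matrix mu M)"
    let ?\<Delta> = "det (mat 1 + M)" and ?T = "cnj (trace M)"
    have div: "(\<Sum>i\<in>UNIV. \<Sum>j\<in>UNIV. ?DY i j (matrix_unit i j) M) = of_nat n * trace M"
    proof -
      have "(matrix_unit i j ** M) $ i $ j = M $ j $ j" for i j :: 'n
        by (simp add: matrix_matrix_mult_def matrix_unit_def if_distrib[of "\<lambda>c. c * _"] cong: if_cong)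
      then show ?thesis
        by (simp add: n trace_def)
    qed
    have det: "det_variation (?Y M) M = trace M * ?\<Delta>"
      by (rule det_variation_eq) (simp add: matrix_mult_add_left matrix_add_ldistrib add.commute)
    have tr: "trace ((adjoint_matrix M + mat 1) ** M) = of_nat n + trace M"
      using M by (simp add: matrix_mult_add_left trace_add unitary_group_iff trace_I n)
    have 1: "schur_variation lam (?Y M) M =
        (\<Sum>i = 1..n. of_int (lam i - int i + 1) * schur_matrix (lam(i := lam i + 1)) M) + of_int (tuple_size n lam) * ?S"
      by (simp only: left_derivative_additive[OF left_derivative_schur M] schur_variation_self[OF lam']
          schur_variation_identity n)
    have 2: "cnj (schur_variation mu (adjoint_matrix M + mat 1) M) =
        (\<Sum>i = 1..n. of_int (mu i - int i + int n) * cnj (schur_matrix (mu(i := mu i - 1)) M)) + of_int (tuple_size n mu) * ?S'"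
      by (simp add: left_derivative_additive[OF left_derivative_schur M] schur_variation_adjoint[OF M]
          schur_variation_identity n)
    have 3: "?T * ?S' = (\<Sum>i = 1..n. cnj (schur_matrix (mu(i := mu i + 1)) M))"
      using arg_cong[OF schur_times_trace[OF mu', of M], of cnj] by (simp add: n)
    have 4: "trace M * ?S = (\<Sum>i = 1..n. schur_matrix (lam(i := lam i + 1)) M)"
      using schur_times_trace[OF lam', of M] by (simp add: n)
    define A where "A = (\<Sum>i = 1..n. of_int (mu i - int i + int n) * cnj (schur_matrix (mu(i := mu i - 1)) M))"
    define B where "B = (\<Sum>i = 1..n. of_int (lam i - int i + 1) * schur_matrix (lam(i := lam i + 1)) M)"
    define P where "P = (\<Sum>i = 1..n. schur_matrix (lam(i := lam i + 1)) M)"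
    define P' where "P' = (\<Sum>i = 1..n. cnj (schur_matrix (mu(i := mu i + 1)) M))"
    have q: "of_nat q * ?\<Delta> ^ (q - 1) * ?\<Delta> = of_nat q * ?\<Delta> ^ q"
      by (cases q) auto
    have B': "(\<Sum>i = 1..n. of_int (lam i - int i + int n + int q + 1) * schur_matrix (lam(i := lam i + 1)) M) =
        B + of_nat n * P + of_nat q * P"
      by (simp add: B_def P_def sum_distrib_left distrib_right sum.distrib algebra_simps sum_subtractf)
    have G: "?G M = ?S * A * ?\<Delta> ^ q * ?T ^ k - (B + of_nat n * P + of_nat q * P) * ?S' * ?\<Delta> ^ q * ?T ^ k
        + of_int (tuple_size n mu - tuple_size n lam) * (?S * ?S' * ?\<Delta> ^ q * ?T ^ k)
        + of_nat k * (of_nat n * (?S * ?S' * ?\<Delta> ^ q * ?T ^ (k - 1)) + ?S * P' * ?\<Delta> ^ q * ?T ^ (k - 1))"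
      unfolding B'[symmetric]
      unfolding A_def P'_def moment_integrand_def sum_distrib_left sum_distrib_right
      by (simp only: mult_ac)
    have "moment_variation q k lam mu (?Y M) M + ?F M * (of_nat n * trace M) =
      ((B + of_int (tuple_size n lam) * ?S) * ?S' + ?S * - (A + of_int (tuple_size n mu) * ?S')) * ?\<Delta> ^ q * ?T ^ k
       + (trace M * ?S) * ?S' * (of_nat q * ?\<Delta> ^ (q - 1) * ?\<Delta>) * ?T ^ k
       - of_nat k * ?T ^ (k - 1) * ?S * ?\<Delta> ^ q * (of_nat n * ?S' + ?T * ?S')
       + of_nat n * (trace M * ?S) * ?S' * ?\<Delta> ^ q * ?T ^ k"
      unfolding moment_variation_def moment_integrand_def adjoint_matrix_add_mat 1 2 det tr
        A_def[symmetric] B_def[symmetric]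
      by (simp add: algebra_simps)
    also have "\<dots> = - ?G M"
      unfolding G q 3 4 P_def[symmetric] P'_def[symmetric] by (simp add: algebra_simps)
    finally show ?thesis
      unfolding div .
  qed
  have "0 = (LINT M|H. moment_variation q k lam mu (?Y M) M +
      ?F M * (\<Sum>i\<in>UNIV. \<Sum>j\<in>UNIV. ?DY i j (matrix_unit i j) M))"
    using haar_divergence[OF haar left_derivative_moment_integrand Y] by (rule sym)
  also have "\<dots> = (LINT M|H. - ?G M)"
    using pointwise sp by (intro Bochner_Integration.integral_cong refl) auto
  also have "\<dots> = - ?sum"
    using moment_integrable[OF haar] by (simp add: moment_def)
  finally have "- ?sum = 0"
    by (rule sym)
  then show ?thesis
    by (simp only: neg_equal_0_iff_equal)
qed

section \<open>Partitions, strict tuples and power series\<close>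

text \<open>The part of the antisymmetry of \<open>lam i - i\<close> under exchange of neighbouring rows that is needed to
  replace tuples that are not partitions.\<close>

definition alternating_on_rows :: "nat \<Rightarrow> ((nat \<Rightarrow> int) \<Rightarrow> complex) \<Rightarrow> bool" where
  "alternating_on_rows n f \<longleftrightarrow>
     (\<forall>lam. \<forall>i\<in>{1..<n}. lam (Suc i) = lam i + 1 \<longrightarrow> f lam = 0) \<and>
     (\<forall>lam. \<forall>i\<in>{1..<n}. lam i = lam (Suc i) \<longrightarrow>
        f (lam(Suc i := lam (Suc i) + 2)) = - f (lam(i := lam i + 1, Suc i := lam (Suc i) + 1)))"

definition restrict_partition :: "nat \<Rightarrow> ((nat \<Rightarrow> int) \<Rightarrow> complex) \<Rightarrow> (nat \<Rightarrow> int) \<Rightarrow> complex" where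
  "restrict_partition n f lam = (if is_partition n lam then f lam else 0)"

lemma is_partition_nonneg: "is_partition n lam \<Longrightarrow> i \<in> {1..n} \<Longrightarrow> 0 \<le> lam i"
  by (simp add: is_partition_def)

lemma is_partition_step: "is_partition n lam \<Longrightarrow> i \<in> {1..<n} \<Longrightarrow> lam (Suc i) \<le> lam i"
  by (simp add: is_partition_def)

lemma in_recurrence_range_partition: "is_partition n lam \<Longrightarrow> in_recurrence_range n lam"
  unfolding in_recurrence_range_def using is_partition_nonneg by fastforce

lemma alternating_vanish:
  "alternating_on_rows n f \<Longrightarrow> i \<in> {1..<n} \<Longrightarrow> lam (Suc i) = lam i + 1 \<Longrightarrow> f lam = 0"
  unfolding alternating_on_rows_def by blast

text \<open>If lowering row \<open>i\<close> leaves the partitions, then either two rows coincide in the determinant, or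
  \<open>i = n\<close> and \<open>lam n = 0\<close>, where the coefficient vanishes.\<close>

lemma restrict_partition_down:
  assumes f: "alternating_on_rows n f" and lam: "is_partition n lam" and i: "i \<in> {1..n}"
  shows "of_int (lam i - int i + int n) * f (lam(i := lam i - 1)) =
    of_int (lam i - int i + int n) * restrict_partition n f (lam(i := lam i - 1))"
proof -
  consider (flat) "i < n" "lam (Suc i) = lam i" | (zero) "i = n" "lam n = 0"
    | (ok) "i < n \<longrightarrow> lam (Suc i) < lam i" "i = n \<longrightarrow> 0 < lam n"
    using i is_partition_nonneg[OF lam, of n] is_partition_step[OF lam, of i] by fastforce
  then show ?thesis
  proof cases
    case flat
    then have "f (lam(i := lam i - 1)) = 0"
      using i by (intro alternating_vanish[OF f, of i]) auto
    then show ?thesis by (simp add: restrict_partition_def)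
  next
    case zero
    then show ?thesis by simp
  next
    case ok
    have "is_partition n (lam(i := lam i - 1))"
      unfolding is_partition_def
    proof (intro conjI ballI)
      fix j assume j: "j \<in> {1..n}"
      have "0 \<le> lam i - 1"
        using ok i is_partition_nonneg[OF lam, of "Suc i"] by (cases "i = n") auto
      then show "0 \<le> (lam(i := lam i - 1)) j"
        using is_partition_nonneg[OF lam j] by auto
    next
      fix j assume j: "j \<in> {1..<n}"
      then show "(lam(i := lam i - 1)) (Suc j) \<le> (lam(i := lam i - 1)) j"
        using is_partition_step[OF lam j] ok by auto
    qed
    then show ?thesis by (simp add: restrict_partition_def)
  qed
qed

lemma is_partition_raise:
  assumes lam: "is_partition n lam" and i: "i \<in> {1..n}" and c: "0 \<le> c"
    and room: "\<And>j. i = Suc j \<Longrightarrow> 1 \<le> j \<Longrightarrow> lam i + c \<le> lam j"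
  shows "is_partition n (lam(i := lam i + c))"
  unfolding is_partition_def
proof (intro conjI ballI)
  fix j assume "j \<in> {1..n}"
  then show "0 \<le> (lam(i := lam i + c)) j"
    using is_partition_nonneg[OF lam] c by auto
next
  fix j assume j: "j \<in> {1..<n}"
  then show "(lam(i := lam i + c)) (Suc j) \<le> (lam(i := lam i + c)) j"
    using is_partition_step[OF lam j] c room[of j] by auto
qed

lemma restrict_partition_up:
  assumes f: "alternating_on_rows n f" and lam: "is_partition n lam" and i: "i \<in> {1..n}"
  shows "f (lam(i := lam i + 1)) = restrict_partition n f (lam(i := lam i + 1))"
proof (cases "\<exists>j\<ge>1. i = Suc j \<and> lam j = lam i")
  case True
  then obtain j where j: "j \<ge> 1" "i = Suc j" "lam j = lam i" by blast
  then have "f (lam(i := lam i + 1)) = 0"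
    using i by (intro alternating_vanish[OF f, of j]) auto
  then show ?thesis by (simp add: restrict_partition_def)
next
  case False
  have "is_partition n (lam(i := lam i + 1))"
  proof (rule is_partition_raise[OF lam i])
    fix j assume "i = Suc j" "1 \<le> j"
    then show "lam i + 1 \<le> lam j"
      using False is_partition_step[OF lam, of j] i by fastforce
  qed simp
  then show ?thesis by (simp add: restrict_partition_def)
qed

text \<open>Raising row \<open>i\<close> by two leaves the partitions if the row above is longer by at most one. If it is
  longer by one, the determinant has equal rows; if both rows have the same length, exchanging them
  gives the correction term.\<close>

lemma restrict_partition_double:
  assumes f: "alternating_on_rows n f" and lam: "is_partition n lam" and i: "i \<in> {1..n}"
  shows "f (lam(i := lam i + 2)) = restrict_partition n f (lam(i := lam i + 2))
    - (if 2 \<le> i \<and> lam (i - 1) = lam i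
       then restrict_partition n f (lam(i - 1 := lam (i - 1) + 1, i := lam i + 1)) else 0)"
proof (cases "2 \<le> i \<and> lam (i - 1) = lam i")
  case True
  define j where "j = i - 1"
  have j: "i = Suc j" "j \<ge> 1" "j \<in> {1..<n}" "lam j = lam i"
    using True i by (auto simp: j_def)
  let ?nu = "lam(j := lam j + 1, i := lam i + 1)"
  have "\<not> is_partition n (lam(i := lam i + 2))"
    using j by (auto simp: is_partition_def intro!: bexI[of _ j])
  moreover have "f (lam(i := lam i + 2)) = - f ?nu"
    using f j unfolding alternating_on_rows_def by blast
  moreover have "f ?nu = restrict_partition n f ?nu"
  proof (cases "\<exists>l\<ge>1. j = Suc l \<and> lam l = lam j")
    case True
    then obtain l where l: "l \<ge> 1" "j = Suc l" "lam l = lam j" by blast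
    then have "f ?nu = 0"
      using j by (intro alternating_vanish[OF f, of l]) auto
    then show ?thesis by (simp add: restrict_partition_def)
  next
    case False
    have 1: "is_partition n (lam(j := lam j + 1))"
    proof (rule is_partition_raise[OF lam])
      fix l assume "j = Suc l" "1 \<le> l"
      then show "lam j + 1 \<le> lam l"
        using False is_partition_step[OF lam, of l] j by fastforce
    qed (use j in auto)
    have "is_partition n ((lam(j := lam j + 1))(i := (lam(j := lam j + 1)) i + 1))"
      by (rule is_partition_raise[OF 1 i]) (use j in auto)
    then show ?thesis
      using j by (simp add: restrict_partition_def)
  qed
  ultimately have "f (lam(i := lam i + 2)) = - restrict_partition n f ?nu"
    "restrict_partition n f (lam(i := lam i + 2)) = 0"
    by (simp_all add: restrict_partition_def)
  then show ?thesis
    unfolding if_P[OF True]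
    unfolding j_def[symmetric] by simp
next
  case False
  have "f (lam(i := lam i + 2)) = restrict_partition n f (lam(i := lam i + 2))"
  proof (cases "2 \<le> i \<and> lam (i - 1) = lam i + 1")
    case True
    then have "f (lam(i := lam i + 2)) = 0"
      using i by (intro alternating_vanish[OF f, of "i - 1"]) auto
    then show ?thesis by (simp add: restrict_partition_def)
  next
    case neq: False
    have "is_partition n (lam(i := lam i + 2))"
    proof (rule is_partition_raise[OF lam i])
      fix j assume "i = Suc j" "1 \<le> j"
      then show "lam i + 2 \<le> lam j"
        using False neq is_partition_step[OF lam, of j] i by fastforce
    qed simp
    then show ?thesis by (simp add: restrict_partition_def)
  qed
  then show ?thesis
    unfolding if_not_P[OF False] by simp
qed

lemma sum_restrict_partition_double:
  assumes f: "alternating_on_rows n f" and lam: "is_partition n lam"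
  shows "(\<Sum>i = 1..n. f (lam(i := lam i + 2))) =
    (\<Sum>i = 1..n. restrict_partition n f (lam(i := lam i + 2)))
    - (\<Sum>i | i \<in> {1..n - 1} \<and> lam i = lam (i + 1).
         restrict_partition n f (lam(i := lam i + 1, i + 1 := lam (i + 1) + 1)))"
proof -
  let ?r = "\<lambda>i. restrict_partition n f (lam(i - 1 := lam (i - 1) + 1, i := lam i + 1))"
  have "(\<Sum>i = 1..n. if 2 \<le> i \<and> lam (i - 1) = lam i then ?r i else 0) =
      (\<Sum>i | i \<in> {1..n} \<and> 2 \<le> i \<and> lam (i - 1) = lam i. ?r i)"
    by (subst sum.inter_filter[symmetric]) auto
  also have "\<dots> = (\<Sum>i | i \<in> {1..n - 1} \<and> lam i = lam (i + 1).
         restrict_partition n f (lam(i := lam i + 1, i + 1 := lam (i + 1) + 1)))"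
    by (rule sum.reindex_bij_witness[of _ "\<lambda>i. i + 1" "\<lambda>i. i - 1"]) auto
  finally show ?thesis
    by (simp only: restrict_partition_double[OF f lam] sum_subtractf cong: sum.cong)
qed

lemma alternating_schur: "alternating_on_rows n (\<lambda>lam. schur n lam E)"
  unfolding alternating_on_rows_def schur_eq_jacobi_trudi
  using jacobi_trudi_repeated jacobi_trudi_straighten by blast

lemma alternating_moment:
  fixes H :: "(complex ^ 'n ^ 'n) measure"
  shows "alternating_on_rows CARD('n) (\<lambda>lam. moment H q k lam mu)"
    and "alternating_on_rows CARD('n) (\<lambda>mu. moment H q k lam mu)"
  using alternating_schur[of "CARD('n)"]
  unfolding alternating_on_rows_def moment_def moment_integrand_def by auto

definition partition_moment ::
  "(complex ^ 'n ^ 'n) measure \<Rightarrow> nat \<Rightarrow> nat \<Rightarrow> (nat \<Rightarrow> int) \<Rightarrow> (nat \<Rightarrow> int) \<Rightarrow> complex" where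
  "partition_moment H q k lam mu =
     (if is_partition CARD('n) lam \<and> is_partition CARD('n) mu then moment H q k lam mu else 0)"

lemma partition_moment_first:
  fixes H :: "(complex ^ 'n ^ 'n) measure"
  assumes haar: "normalized_haar_measure H" and n: "n = CARD('n)"
    and lam: "is_partition n lam" and mu: "is_partition n mu"
  shows "(\<Sum>i = 1..n. of_int (lam i - int i + int n) * partition_moment H q k (lam(i := lam i - 1)) mu)
     - (\<Sum>i = 1..n. of_int (mu i - int i + int n + 1) * partition_moment H q k lam (mu(i := mu i + 1)))
     + of_int (tuple_size n lam - tuple_size n mu + int n * int q) * partition_moment H q k lam mu
     + of_nat k * (- (\<Sum>i = 1..n. partition_moment H q (k - 1) lam (mu(i := mu i + 1)) +
           partition_moment H q (k - 1) lam (mu(i := mu i + 2)))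
         + (\<Sum>i | i \<in> {1..n - 1} \<and> mu i = mu (i + 1).
              partition_moment H q (k - 1) lam (mu(i := mu i + 1, i + 1 := mu (i + 1) + 1)))) = 0"
proof -
  have P: "partition_moment H q l lam nu = restrict_partition n (\<lambda>mu. moment H q l lam mu) nu"
    "partition_moment H q l nu mu = restrict_partition n (\<lambda>lam. moment H q l lam mu) nu" for l nu
    using lam mu n by (simp_all add: partition_moment_def restrict_partition_def)
  note a1 = alternating_moment(1)[of H q _ mu, folded n] and a2 = alternating_moment(2)[of H q _ lam, folded n]
  have id: "partition_moment H q k lam mu = moment H q k lam mu"
    using lam mu n by (simp add: partition_moment_def)
  have 1: "(\<Sum>i = 1..n. of_int (lam i - int i + int n) * partition_moment H q k (lam(i := lam i - 1)) mu) =
      (\<Sum>i = 1..n. of_int (lam i - int i + int n) * moment H q k (lam(i := lam i - 1)) mu)"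
    unfolding P(2) by (rule sum.cong[OF refl restrict_partition_down[OF a1 lam, symmetric]])
  have up: "(\<Sum>i = 1..n. w i * partition_moment H q l lam (mu(i := mu i + 1))) =
      (\<Sum>i = 1..n. w i * moment H q l lam (mu(i := mu i + 1)))" for w l
    unfolding P(1) by (intro sum.cong refl arg_cong2[where f = "(*)"] restrict_partition_up[OF a2 mu, symmetric])
  note up_1 = up[of "\<lambda>_. 1", unfolded mult_1]
  have 3: "(\<Sum>i = 1..n. partition_moment H q l lam (mu(i := mu i + 2))) =
      (\<Sum>i = 1..n. moment H q l lam (mu(i := mu i + 2))) +
      (\<Sum>i | i \<in> {1..n - 1} \<and> mu i = mu (i + 1).
         partition_moment H q l lam (mu(i := mu i + 1, i + 1 := mu (i + 1) + 1)))" for l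
    unfolding P(1) using sum_restrict_partition_double[OF a2 mu] by simp
  show ?thesis
    using moment_down[OF haar n in_recurrence_range_partition[OF mu], of lam q k]
    unfolding sum.distrib 1 up up_1 3 id by (simp add: right_diff_distrib distrib_left)
qed

lemma partition_moment_second:
  fixes H :: "(complex ^ 'n ^ 'n) measure"
  assumes haar: "normalized_haar_measure H" and n: "n = CARD('n)"
    and lam: "is_partition n lam" and mu: "is_partition n mu"
  shows "(\<Sum>i = 1..n. of_int (mu i - int i + int n) * partition_moment H q k lam (mu(i := mu i - 1)))
     - (\<Sum>i = 1..n. of_int (lam i - int i + int n + int q + 1) * partition_moment H q k (lam(i := lam i + 1)) mu)
     + of_int (tuple_size n mu - tuple_size n lam) * partition_moment H q k lam mu
     + of_nat k * (\<Sum>i = 1..n. partition_moment H q (k - 1) lam mu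
         + partition_moment H q (k - 1) lam (mu(i := mu i + 1))) = 0"
proof -
  have P: "partition_moment H q l lam nu = restrict_partition n (\<lambda>mu. moment H q l lam mu) nu"
    "partition_moment H q l nu mu = restrict_partition n (\<lambda>lam. moment H q l lam mu) nu" for l nu
    using lam mu n by (simp_all add: partition_moment_def restrict_partition_def)
  note a1 = alternating_moment(1)[of H q _ mu, folded n] and a2 = alternating_moment(2)[of H q _ lam, folded n]
  have id: "partition_moment H q l lam mu = moment H q l lam mu" for l
    using lam mu n by (simp add: partition_moment_def)
  have 1: "(\<Sum>i = 1..n. of_int (mu i - int i + int n) * partition_moment H q k lam (mu(i := mu i - 1))) =
      (\<Sum>i = 1..n. of_int (mu i - int i + int n) * moment H q k lam (mu(i := mu i - 1)))"
    unfolding P(1) by (rule sum.cong[OF refl restrict_partition_down[OF a2 mu, symmetric]])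
  have up: "(\<Sum>i = 1..n. w i * partition_moment H q l lam (mu(i := mu i + 1))) =
      (\<Sum>i = 1..n. w i * moment H q l lam (mu(i := mu i + 1)))" for w l
    unfolding P(1) by (intro sum.cong refl arg_cong2[where f = "(*)"] restrict_partition_up[OF a2 mu, symmetric])
  note up_1 = up[of "\<lambda>_. 1", unfolded mult_1]
  have 3: "(\<Sum>i = 1..n. w i * partition_moment H q k (lam(i := lam i + 1)) mu) =
      (\<Sum>i = 1..n. w i * moment H q k (lam(i := lam i + 1)) mu)" for w
    unfolding P(2) by (intro sum.cong refl arg_cong2[where f = "(*)"] restrict_partition_up[OF a1 lam, symmetric])
  show ?thesis
    using moment_up[OF haar n in_recurrence_range_partition[OF lam] in_recurrence_range_partition[OF mu], of q k]
    unfolding sum.distrib 1 up_1 3 id by simp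
qed

lemma sums_powser_shift:
  fixes g :: "nat \<Rightarrow> complex"
  assumes "(\<lambda>k. g k * z ^ k / fact k) sums s"
  shows "(\<lambda>k. of_nat k * g (k - 1) * z ^ k / fact k) sums (z * s)"
proof (rule sums_Suc_imp)
  have "(\<lambda>k. z * (g k * z ^ k / fact k)) sums (z * s)"
    by (rule sums_mult[OF assms])
  moreover have "z * (g k * z ^ k / fact k) = of_nat (Suc k) * g (Suc k - 1) * z ^ Suc k / fact (Suc k)" for k
    by (simp add: divide_simps del: of_nat_Suc)
  ultimately show "(\<lambda>k. of_nat (Suc k) * g (Suc k - 1) * z ^ Suc k / fact (Suc k)) sums (z * s)"
    by simp
qed simp

lemma powser_coefficients_unique:
  fixes b c :: "nat \<Rightarrow> complex"
  assumes b: "\<And>z. (\<lambda>k. b k * z ^ k / fact k) sums f z" and c: "\<And>z. (\<lambda>k. c k * z ^ k / fact k) sums f z"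
  shows "b = c"
proof
  fix m
  define d where "d = (\<lambda>k. (b k - c k) / fact k)"
  have d: "(\<lambda>k. d k * z ^ k) sums 0" for z
    using sums_diff[OF b c, of z z] by (simp add: d_def diff_divide_distrib left_diff_distrib)
  have "d m = 0"
  proof (rule ccontr)
    assume "d m \<noteq> 0"
    show False
    proof (cases "m = 0")
      case True
      then show ?thesis
        using d[of 0] \<open>d m \<noteq> 0\<close> by simp
    next
      case False
      show False
      proof (rule powser_0_nonzero[of 1 "0::complex" d "\<lambda>_. 0" m])
        fix s :: real assume "0 < s" and nonzero: "\<And>z::complex. z \<in> cball 0 s - {0} \<Longrightarrow> (0::complex) \<noteq> 0"
        from nonzero[of "of_real s"] \<open>0 < s\<close> show False by simp
      qed (use d \<open>d m \<noteq> 0\<close> False in auto)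
    qed
  qed
  then show "b m = c m" by (simp add: d_def)
qed

text \<open>The exponential series is integrated term by term; the trace and the remaining factors are bounded
  on the compact unitary group.\<close>

lemma partition_moment_sums:
  fixes H :: "(complex ^ 'n ^ 'n) measure"
  assumes haar: "normalized_haar_measure H"
  shows "(\<lambda>k. partition_moment H q k lam mu * z ^ k / fact k) sums unitary_integral H q lam mu z"
proof (cases "is_partition CARD('n) lam \<and> is_partition CARD('n) mu")
  case False
  then show ?thesis
    unfolding partition_moment_def unitary_integral_def if_not_P[OF False] by simp
next
  case True
  interpret prob_space H
    using haar by (simp add: normalized_haar_measure_def)
  have sp: "space H = unitary_group"
    using haar by (simp add: normalized_haar_measure_def)
  let ?G = "moment_integrand q 0 lam mu :: complex ^ 'n ^ 'n \<Rightarrow> complex"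
  let ?f = "\<lambda>k (M :: complex ^ 'n ^ 'n). moment_integrand q k lam mu M * z ^ k / fact k :: complex"
  have f: "?f k M = ?G M * ((z * cnj (trace M)) ^ k / fact k)" for k M
    by (simp add: moment_integrand_def power_mult_distrib)
  obtain B where B: "B \<ge> 0" "\<And>M. M \<in> unitary_group \<Longrightarrow> cmod (?G M) \<le> B"
    using unitary_group_continuous_bounded[OF left_derivative_continuous(1)[OF left_derivative_moment_integrand]] by metis
  obtain C where C: "C \<ge> 0" "\<And>M :: complex ^ 'n ^ 'n. M \<in> unitary_group \<Longrightarrow> cmod (trace M) \<le> C"
    using unitary_group_continuous_bounded[OF left_derivative_continuous(1)[OF left_derivative_trace]] by metis
  define R where "R = cmod z * C"
  have bound: "cmod (?f k M) \<le> B * (R ^ k / fact k)" if "M \<in> unitary_group" for k M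
    unfolding f
    unfolding norm_mult norm_divide norm_power R_def using B C that
    by (intro mult_mono divide_right_mono power_mono) (auto intro!: divide_right_mono power_mono mult_left_mono mult_nonneg_nonneg)
  have summable: "summable (\<lambda>k. B * (R ^ k / fact k))"
    using summable_mult[OF summable_exp[of R], of B] by (simp add: divide_inverse mult.commute)
  have int: "integrable H (?f k)" for k
    using moment_integrable[OF haar, of q k lam mu] by simp
  have "(\<lambda>k. LINT M|H. ?f k M) sums (LINT M|H. (\<Sum>k. ?f k M))"
  proof (rule sums_integral[OF int])
    show "AE M in H. summable (\<lambda>k. cmod (?f k M))"
      using bound sp by (intro AE_I2 summable_comparison_test'[OF summable]) auto
    show "summable (\<lambda>k. LINT M|H. cmod (?f k M))"
    proof (rule summable_comparison_test'[OF summable])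
      fix k
      have "(LINT M|H. cmod (?f k M)) \<le> B * (R ^ k / fact k)"
        using bound sp int by (intro integral_le_const AE_I2 integrable_norm) auto
      then show "norm (LINT M|H. cmod (?f k M)) \<le> B * (R ^ k / fact k)"
        by simp
    qed
  qed
  moreover have "(\<Sum>k. ?f k M) = ?G M * exp (z * cnj (trace M))" for M
  proof -
    have "(\<lambda>k. (z * cnj (trace M)) ^ k / fact k) sums exp (z * cnj (trace M))"
      using exp_converges[of "z * cnj (trace M)"] by (simp add: scaleR_conv_of_real divide_inverse mult.commute)
    from sums_unique[OF sums_mult[OF this]] show ?thesis
      unfolding f by (rule sym)
  qed
  ultimately have "(\<lambda>k. moment H q k lam mu * z ^ k / fact k) sums (LINT M|H. ?G M * exp (z * cnj (trace M)))"
    by (simp add: moment_def)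
  then show ?thesis
    using True by (simp add: partition_moment_def unitary_integral_def moment_integrand_def schur_cnj trace_cnj)
qed

lemma is_strict_tuple_iff_partition: "is_strict_tuple n x \<longleftrightarrow> is_partition n (partition_of_tuple n x)"
proof
  assume x: "is_strict_tuple n x"
  have ge: "int i - 1 \<le> x i" if "1 \<le> i" "i \<le> n" for i
    using that
  proof (induction i rule: dec_induct)
    case base
    then show ?case using x by (simp add: is_strict_tuple_def)
  next
    case (step i)
    then have "x i < x (Suc i)"
      using x by (simp add: is_strict_tuple_def)
    with step show ?case by simp
  qed
  show "is_partition n (partition_of_tuple n x)"
    unfolding is_partition_def
  proof (intro conjI ballI)
    fix i assume "i \<in> {1..n}"
    then show "0 \<le> partition_of_tuple n x i"
      using ge[of "n + 1 - i"] by (auto simp: partition_of_tuple_def of_nat_diff)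
  next
    fix i assume i: "i \<in> {1..<n}"
    then have "n - i \<in> {1..<n}"
      by auto
    then have "x (n - i) < x (Suc (n - i))"
      using x unfolding is_strict_tuple_def by blast
    then show "partition_of_tuple n x (Suc i) \<le> partition_of_tuple n x i"
      using i by (auto simp: partition_of_tuple_def of_nat_diff Suc_diff_le)
  qed
next
  assume p: "is_partition n (partition_of_tuple n x)"
  have x: "x i = partition_of_tuple n x (n + 1 - i) + int (i - 1)" if "i \<in> {1..n}" for i
    using that by (auto simp: partition_of_tuple_def)
  show "is_strict_tuple n x"
    unfolding is_strict_tuple_def
  proof (intro conjI ballI)
    fix i assume i: "i \<in> {1..n}"
    then have "n + 1 - i \<in> {1..n}"
      by auto
    then show "0 \<le> x i"
      using is_partition_nonneg[OF p, of "n + 1 - i"] x[OF i] by simp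
  next
    fix i assume i: "i \<in> {1..<n}"
    have "partition_of_tuple n x (Suc (n - i)) \<le> partition_of_tuple n x (n - i)"
      using i by (intro is_partition_step[OF p]) auto
    then show "x i < x (Suc i)"
      using i x[of i] x[of "Suc i"] by (auto simp: Suc_diff_le)
  qed
qed

lemma partition_of_tuple_update:
  assumes "i \<in> {1..n}"
  shows "partition_of_tuple n (x(i := x i + c)) =
    (partition_of_tuple n x)(n + 1 - i := partition_of_tuple n x (n + 1 - i) + c)"
  using assms by (auto simp: fun_eq_iff partition_of_tuple_def)

text \<open>The power series determines its coefficients, so the definite description picks out the moments.\<close>

lemma integral_coeff_eq:
  fixes H :: "(complex ^ 'n ^ 'n) measure"
  assumes haar: "normalized_haar_measure H" and n: "n = CARD('n)"
  shows "integral_coeff H q k x y = partition_moment H q k (partition_of_tuple n x) (partition_of_tuple n y)"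
proof (cases "is_strict_tuple n x \<and> is_strict_tuple n y")
  case True
  let ?c = "\<lambda>k. partition_moment H q k (partition_of_tuple n x) (partition_of_tuple n y)"
  have "(THE b. \<forall>z. (\<lambda>k. b k * z ^ k / fact k) sums
      unitary_integral H q (partition_of_tuple n x) (partition_of_tuple n y) z) = ?c"
  proof (rule the_equality)
    show "\<forall>z. (\<lambda>k. ?c k * z ^ k / fact k) sums
        unitary_integral H q (partition_of_tuple n x) (partition_of_tuple n y) z"
      using partition_moment_sums[OF haar] by blast
    then show "b = ?c" if "\<forall>z. (\<lambda>k. b k * z ^ k / fact k) sums
        unitary_integral H q (partition_of_tuple n x) (partition_of_tuple n y) z" for b
      using that by (intro powser_coefficients_unique) auto
  qed
  then show ?thesis
    using True n by (simp add: integral_coeff_def)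
next
  case False
  then show ?thesis
    using n by (auto simp: integral_coeff_def partition_moment_def is_strict_tuple_iff_partition)
qed

lemma sum_partition_of_tuple:
  "(\<Sum>i = 1..n. h (x i) * g (partition_of_tuple n (x(i := x i + c)))) =
   (\<Sum>j = 1..n. h (partition_of_tuple n x j - int j + int n)
      * g ((partition_of_tuple n x)(j := partition_of_tuple n x j + c)))"
  for h g :: "_ \<Rightarrow> complex"
proof (rule sum.reindex_bij_witness[of _ "\<lambda>i. n + 1 - i" "\<lambda>i. n + 1 - i"])
  fix i assume i: "i \<in> {1..n}"
  have "partition_of_tuple n x (n + 1 - i) - int (n + 1 - i) + int n = x i"
    using i by (auto simp: partition_of_tuple_def of_nat_diff)
  then show "h (partition_of_tuple n x (n + 1 - i) - int (n + 1 - i) + int n) *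
      g ((partition_of_tuple n x)(n + 1 - i := partition_of_tuple n x (n + 1 - i) + c)) =
      h (x i) * g (partition_of_tuple n (x(i := x i + c)))"
    by (simp only: partition_of_tuple_update[OF i])
qed auto

lemma sum_partition_of_tuple_adjacent:
  "(\<Sum>i | i \<in> {1..n - 1} \<and> y (i + 1) - y i = 1.
      g (partition_of_tuple n (y(i := y i + 1, i + 1 := y (i + 1) + 1)))) =
   (\<Sum>j | j \<in> {1..n - 1} \<and> partition_of_tuple n y j = partition_of_tuple n y (j + 1).
      g ((partition_of_tuple n y)(j := partition_of_tuple n y j + 1, j + 1 := partition_of_tuple n y (j + 1) + 1)))"
  for g :: "_ \<Rightarrow> complex"
proof (rule sum.reindex_bij_witness[of _ "\<lambda>i. n - i" "\<lambda>i. n - i"])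
  let ?P = "partition_of_tuple n"
  have adjacent: "?P y (n - i) = y (i + 1) - int i" "?P y (n - i + 1) = y i - int (i - 1)"
    if "i \<in> {1..n - 1}" for i
    using that by (auto simp: partition_of_tuple_def Suc_diff_Suc of_nat_diff intro!: arg_cong[where f = y])
  show "n - i \<in> {j \<in> {1..n - 1}. ?P y j = ?P y (j + 1)}" "n - (n - i) = i"
    if "i \<in> {i \<in> {1..n - 1}. y (i + 1) - y i = 1}" for i
    using that adjacent[of i] by auto
  show "n - j \<in> {i \<in> {1..n - 1}. y (i + 1) - y i = 1}" "n - (n - j) = j"
    if "j \<in> {j \<in> {1..n - 1}. ?P y j = ?P y (j + 1)}" for j
  proof -
    have "n - j \<in> {1..n - 1}" "n - (n - j) = j" "int (n - j - 1) = int (n - j) - 1"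
      using that by auto
    then show "n - j \<in> {i \<in> {1..n - 1}. y (i + 1) - y i = 1}" "n - (n - j) = j"
      using that adjacent[of "n - j"] by (auto simp: of_nat_diff)
  qed
  show "g ((?P y)(n - i := ?P y (n - i) + 1, n - i + 1 := ?P y (n - i + 1) + 1)) =
      g (?P (y(i := y i + 1, i + 1 := y (i + 1) + 1)))"
    if "i \<in> {i \<in> {1..n - 1}. y (i + 1) - y i = 1}" for i
  proof -
    have i: "i \<in> {1..n}" "i + 1 \<in> {1..n}" "n + 1 - i = n - i + 1" "n + 1 - (i + 1) = n - i"
      using that by auto
    have "?P ((y(i := y i + 1))(i + 1 := (y(i := y i + 1)) (i + 1) + 1)) =
        (?P (y(i := y i + 1)))(n - i := ?P (y(i := y i + 1)) (n - i) + 1)"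
      using partition_of_tuple_update[OF i(2), of "y(i := y i + 1)" 1] unfolding i(4) .
    also have "\<dots> = (?P y)(n - i + 1 := ?P y (n - i + 1) + 1, n - i := ?P y (n - i) + 1)"
      using partition_of_tuple_update[OF i(1), of y 1] unfolding i(3) by simp
    also have "\<dots> = (?P y)(n - i := ?P y (n - i) + 1, n - i + 1 := ?P y (n - i + 1) + 1)"
      by (rule fun_upd_twist) simp
    finally show ?thesis by simp
  qed
qed

lemma tuple_size_partition_of_tuple:
  "tuple_size n (partition_of_tuple n x) = (\<Sum>i = 1..n. x i - int (i - 1))"
  unfolding tuple_size_def partition_of_tuple_def
  by (rule sum.reindex_bij_witness[of _ "\<lambda>i. n + 1 - i" "\<lambda>i. n + 1 - i"]) (auto simp: of_nat_diff)

lemma tuple_size_difference: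
  "tuple_size n (partition_of_tuple n x) - tuple_size n (partition_of_tuple n y) = (\<Sum>i = 1..n. x i - y i)"
  by (simp add: tuple_size_partition_of_tuple flip: sum_subtractf)

text \<open>Sequences and their exponential generating functions at the fixed point \<open>z\<close>. Multiplication by \<open>z\<close>
  corresponds to \<open>g \<mapsto> (\<lambda>k. k * g (k - 1))\<close>, which turns the equations for the coefficients into those
  for the integrals.\<close>

definition exponential_series :: "complex \<Rightarrow> (nat \<Rightarrow> complex) \<Rightarrow> complex \<Rightarrow> bool" where
  "exponential_series z g s \<longleftrightarrow> (\<lambda>k. g k * z ^ k / fact k) sums s"

lemma exponential_series_add:
  assumes "exponential_series z g s" "exponential_series z h t"
  shows "exponential_series z (\<lambda>k. g k + h k) (s + t)"
  using sums_add[OF assms[unfolded exponential_series_def]]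
  by (simp add: exponential_series_def distrib_right add_divide_distrib)

lemma exponential_series_scale:
  assumes "exponential_series z g s"
  shows "exponential_series z (\<lambda>k. c * g k) (c * s)"
  using sums_mult[OF assms[unfolded exponential_series_def], of c]
  by (simp add: exponential_series_def mult.assoc)

lemma exponential_series_minus:
  assumes "exponential_series z g s"
  shows "exponential_series z (\<lambda>k. - g k) (- s)"
  using exponential_series_scale[OF assms, of "-1"] by simp

lemma exponential_series_diff:
  assumes "exponential_series z g s" "exponential_series z h t"
  shows "exponential_series z (\<lambda>k. g k - h k) (s - t)"
  using exponential_series_add[OF assms(1) exponential_series_minus[OF assms(2)]] by simp

lemma exponential_series_sum:
  assumes "\<And>i. i \<in> I \<Longrightarrow> exponential_series z (g i) (s i)"
  shows "exponential_series z (\<lambda>k. \<Sum>i\<in>I. g i k) (\<Sum>i\<in>I. s i)"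
  using sums_sum[of I "\<lambda>i k. g i k * z ^ k / fact k" s] assms
  by (simp add: exponential_series_def sum_distrib_right sum_divide_distrib)

lemma exponential_series_shift:
  assumes "exponential_series z g s"
  shows "exponential_series z (\<lambda>k. of_nat k * g (k - 1)) (z * s)"
  using sums_powser_shift[of g z s] assms by (simp add: exponential_series_def)

lemma exponential_series_zero:
  assumes "exponential_series z g s" "\<And>k. g k = 0"
  shows "s = 0"
  using assms sums_unique2[OF _ sums_zero] by (simp add: exponential_series_def)

theorem mainTheorem8:
  fixes H :: "(complex ^ 'n ^ 'n) measure"
    and q n :: nat
    and a :: "(nat \<Rightarrow> int) \<Rightarrow> (nat \<Rightarrow> int) \<Rightarrow> complex \<Rightarrow> complex"
    and b :: "nat \<Rightarrow> (nat \<Rightarrow> int) \<Rightarrow> (nat \<Rightarrow> int) \<Rightarrow> complex"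
  assumes haar: "normalized_haar_measure H"
    and n: "n = CARD('n)"
    and a: "a = unitary_integral H q"
    and b: "b = integral_coeff H q"
  shows
    "(\<forall>lam mu z. is_partition n lam \<and> is_partition n mu \<longrightarrow>
       (\<Sum>i = 1..n. of_int (lam i - int i + int n) * a (lam(i := lam i - 1)) mu z)
       - (\<Sum>i = 1..n. (of_int (mu i - int i + int n) + z + 1) * a lam (mu(i := mu i + 1)) z)
       + of_int (tuple_size n lam - tuple_size n mu + int n * int q) * a lam mu z
       - z * ((\<Sum>i = 1..n. a lam (mu(i := mu i + 2)) z)
              - (\<Sum>i | i \<in> {1..n - 1} \<and> mu i = mu (i + 1).
                   a lam (mu(i := mu i + 1, i + 1 := mu (i + 1) + 1)) z)) = 0) \<and>
     (\<forall>lam mu z. is_partition n lam \<and> is_partition n mu \<longrightarrow>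
       (\<Sum>i = 1..n. of_int (mu i - int i + int n) * a lam (mu(i := mu i - 1)) z)
       - (\<Sum>i = 1..n. of_int (lam i - int i + int n + int q + 1) * a (lam(i := lam i + 1)) mu z)
       + (of_int (tuple_size n mu - tuple_size n lam) + of_nat n * z) * a lam mu z
       + z * (\<Sum>i = 1..n. a lam (mu(i := mu i + 1)) z) = 0) \<and>
     (\<forall>x y. is_strict_tuple n x \<and> is_strict_tuple n y \<longrightarrow>
       (\<forall>z. (\<lambda>k. b k x y * z ^ k / fact k) sums
              a (partition_of_tuple n x) (partition_of_tuple n y) z)) \<and>
     (\<forall>k x y. is_strict_tuple n x \<and> is_strict_tuple n y \<longrightarrow>
       (\<Sum>i = 1..n. of_int (x i) * b k (x(i := x i - 1)) y
          - of_int (y i + 1) * b k x (y(i := y i + 1))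
          + of_int (x i - y i + int q) * b k x y)
       + of_nat k *
         (- (\<Sum>i = 1..n. b (k - 1) x (y(i := y i + 1)) + b (k - 1) x (y(i := y i + 2)))
          + (\<Sum>i | i \<in> {1..n - 1} \<and> y (i + 1) - y i = 1.
               b (k - 1) x (y(i := y i + 1, i + 1 := y (i + 1) + 1)))) = 0) \<and>
     (\<forall>k x y. is_strict_tuple n x \<and> is_strict_tuple n y \<longrightarrow>
       (\<Sum>i = 1..n. of_int (y i) * b k x (y(i := y i - 1))
          - of_int (x i + 1 + int q) * b k (x(i := x i + 1)) y
          + of_int (y i - x i) * b k x y)
       + of_nat k * (\<Sum>i = 1..n. b (k - 1) x y + b (k - 1) x (y(i := y i + 1))) = 0)"
proof (intro conjI allI impI; (elim conjE)?)
  let ?c = "partition_moment H q" and ?P = "partition_of_tuple n"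
  have series: "exponential_series z (\<lambda>k. ?c k lam mu) (a lam mu z)" for lam mu z
    using partition_moment_sums[OF haar] by (simp add: exponential_series_def a)
  have b_eq: "b k x y = ?c k (?P x) (?P y)" for k x y
    by (simp only: b integral_coeff_eq[OF haar n])
  show "(\<Sum>i = 1..n. of_int (lam i - int i + int n) * a (lam(i := lam i - 1)) mu z)
       - (\<Sum>i = 1..n. (of_int (mu i - int i + int n) + z + 1) * a lam (mu(i := mu i + 1)) z)
       + of_int (tuple_size n lam - tuple_size n mu + int n * int q) * a lam mu z
       - z * ((\<Sum>i = 1..n. a lam (mu(i := mu i + 2)) z)
              - (\<Sum>i | i \<in> {1..n - 1} \<and> mu i = mu (i + 1).
                   a lam (mu(i := mu i + 1, i + 1 := mu (i + 1) + 1)) z)) = 0"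
    if lam: "is_partition n lam" and mu: "is_partition n mu" for lam mu z
  proof -
    have down: "exponential_series z
        (\<lambda>k. \<Sum>i = 1..n. of_int (lam i - int i + int n) * ?c k (lam(i := lam i - 1)) mu)
        (\<Sum>i = 1..n. of_int (lam i - int i + int n) * a (lam(i := lam i - 1)) mu z)"
      by (intro exponential_series_sum exponential_series_scale series)
    have up: "exponential_series z
        (\<lambda>k. \<Sum>i = 1..n. of_int (mu i - int i + int n + 1) * ?c k lam (mu(i := mu i + 1)))
        (\<Sum>i = 1..n. of_int (mu i - int i + int n + 1) * a lam (mu(i := mu i + 1)) z)"
      by (intro exponential_series_sum exponential_series_scale series)
    have up2: "exponential_series z
        (\<lambda>k. - (\<Sum>i = 1..n. ?c k lam (mu(i := mu i + 1)) + ?c k lam (mu(i := mu i + 2)))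
          + (\<Sum>i | i \<in> {1..n - 1} \<and> mu i = mu (i + 1).
               ?c k lam (mu(i := mu i + 1, i + 1 := mu (i + 1) + 1))))
        (- (\<Sum>i = 1..n. a lam (mu(i := mu i + 1)) z + a lam (mu(i := mu i + 2)) z)
          + (\<Sum>i | i \<in> {1..n - 1} \<and> mu i = mu (i + 1).
               a lam (mu(i := mu i + 1, i + 1 := mu (i + 1) + 1)) z))"
      by (intro exponential_series_add exponential_series_minus exponential_series_sum series)
    note combined = exponential_series_add[OF exponential_series_add[OF exponential_series_diff[OF down up]
        exponential_series_scale[OF series]] exponential_series_shift[OF up2]]
    have "(\<Sum>i = 1..n. of_int (lam i - int i + int n) * a (lam(i := lam i - 1)) mu z)
       - (\<Sum>i = 1..n. of_int (mu i - int i + int n + 1) * a lam (mu(i := mu i + 1)) z)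
       + of_int (tuple_size n lam - tuple_size n mu + int n * int q) * a lam mu z
       + z * (- (\<Sum>i = 1..n. a lam (mu(i := mu i + 1)) z + a lam (mu(i := mu i + 2)) z)
              + (\<Sum>i | i \<in> {1..n - 1} \<and> mu i = mu (i + 1).
                   a lam (mu(i := mu i + 1, i + 1 := mu (i + 1) + 1)) z)) = 0"
      by (rule exponential_series_zero[OF combined]) (rule partition_moment_first[OF haar n lam mu])
    note series_sum = this
    have eq: "(\<Sum>i = 1..n. (of_int (mu i - int i + int n) + z + 1) * a lam (mu(i := mu i + 1)) z) =
        (\<Sum>i = 1..n. of_int (mu i - int i + int n + 1) * a lam (mu(i := mu i + 1)) z)
        + z * (\<Sum>i = 1..n. a lam (mu(i := mu i + 1)) z)"
      unfolding sum_distrib_left sum.distrib[symmetric] by (intro sum.cong refl) (simp add: algebra_simps)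
    have regroup: "A - (U + z * V) + C - z * (W - Y) = 0" if "A - U + C + z * (- (V + W) + Y) = 0" for A U V W Y C
      using that by (simp add: algebra_simps)
    show ?thesis
      unfolding eq by (rule regroup) (rule series_sum[unfolded sum.distrib])
  qed
  show "(\<Sum>i = 1..n. of_int (mu i - int i + int n) * a lam (mu(i := mu i - 1)) z)
       - (\<Sum>i = 1..n. of_int (lam i - int i + int n + int q + 1) * a (lam(i := lam i + 1)) mu z)
       + (of_int (tuple_size n mu - tuple_size n lam) + of_nat n * z) * a lam mu z
       + z * (\<Sum>i = 1..n. a lam (mu(i := mu i + 1)) z) = 0"
    if lam: "is_partition n lam" and mu: "is_partition n mu" for lam mu z
  proof -
    have down: "exponential_series z
        (\<lambda>k. \<Sum>i = 1..n. of_int (mu i - int i + int n) * ?c k lam (mu(i := mu i - 1)))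
        (\<Sum>i = 1..n. of_int (mu i - int i + int n) * a lam (mu(i := mu i - 1)) z)"
      by (intro exponential_series_sum exponential_series_scale series)
    have up: "exponential_series z
        (\<lambda>k. \<Sum>i = 1..n. of_int (lam i - int i + int n + int q + 1) * ?c k (lam(i := lam i + 1)) mu)
        (\<Sum>i = 1..n. of_int (lam i - int i + int n + int q + 1) * a (lam(i := lam i + 1)) mu z)"
      by (intro exponential_series_sum exponential_series_scale series)
    have up1: "exponential_series z (\<lambda>k. \<Sum>i = 1..n. ?c k lam mu + ?c k lam (mu(i := mu i + 1)))
        (\<Sum>i = 1..n. a lam mu z + a lam (mu(i := mu i + 1)) z)"
      by (intro exponential_series_add exponential_series_sum series)
    note combined = exponential_series_add[OF exponential_series_add[OF exponential_series_diff[OF down up]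
        exponential_series_scale[OF series]] exponential_series_shift[OF up1]]
    have "(\<Sum>i = 1..n. of_int (mu i - int i + int n) * a lam (mu(i := mu i - 1)) z)
       - (\<Sum>i = 1..n. of_int (lam i - int i + int n + int q + 1) * a (lam(i := lam i + 1)) mu z)
       + of_int (tuple_size n mu - tuple_size n lam) * a lam mu z
       + z * (\<Sum>i = 1..n. a lam mu z + a lam (mu(i := mu i + 1)) z) = 0"
      by (rule exponential_series_zero[OF combined]) (rule partition_moment_second[OF haar n lam mu])
    note series_sum = this
    have regroup: "A - B + (C + of_nat n * z) * D + z * V = 0" if "A - B + C * D + z * (of_nat n * D + V) = 0"
      for A B C D V
      using that by (simp add: algebra_simps)
    show ?thesis
      by (rule regroup) (use series_sum in \<open>simp add: sum.distrib\<close>)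
  qed
  show "(\<lambda>k. b k x y * z ^ k / fact k) sums a (?P x) (?P y) z" for x y z
    using series[of z "?P x" "?P y"] by (simp add: exponential_series_def b_eq)
  show "(\<Sum>i = 1..n. of_int (x i) * b k (x(i := x i - 1)) y
          - of_int (y i + 1) * b k x (y(i := y i + 1))
          + of_int (x i - y i + int q) * b k x y)
       + of_nat k *
         (- (\<Sum>i = 1..n. b (k - 1) x (y(i := y i + 1)) + b (k - 1) x (y(i := y i + 2)))
          + (\<Sum>i | i \<in> {1..n - 1} \<and> y (i + 1) - y i = 1.
               b (k - 1) x (y(i := y i + 1, i + 1 := y (i + 1) + 1)))) = 0"
    if x: "is_strict_tuple n x" and y: "is_strict_tuple n y" for k x y
  proof -
    have parts: "is_partition n (?P x)" "is_partition n (?P y)"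
      using x y by (simp_all add: is_strict_tuple_iff_partition)
    have 1: "(\<Sum>i = 1..n. of_int (x i) * b k (x(i := x i - 1)) y) =
        (\<Sum>i = 1..n. of_int (?P x i - int i + int n) * ?c k ((?P x)(i := ?P x i - 1)) (?P y))"
      using sum_partition_of_tuple[where h = of_int and c = "-1" and g = "\<lambda>l. ?c k l (?P y)" and n = n and x = x]
      by (simp add: b_eq)
    have 2: "(\<Sum>i = 1..n. of_int (y i + 1) * b k x (y(i := y i + 1))) =
        (\<Sum>i = 1..n. of_int (?P y i - int i + int n + 1) * ?c k (?P x) ((?P y)(i := ?P y i + 1)))"
      using sum_partition_of_tuple[where h = "\<lambda>t. of_int (t + 1)" and c = 1 and g = "?c k (?P x)" and n = n and x = y]
      by (simp only: b_eq)
    have 3: "(\<Sum>i = 1..n. of_int (x i - y i + int q) * b k x y) =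
        of_int (tuple_size n (?P x) - tuple_size n (?P y) + int n * int q) * ?c k (?P x) (?P y)"
      unfolding tuple_size_difference b_eq by (simp add: sum.distrib flip: sum_distrib_right)
    have 4: "(\<Sum>i = 1..n. b (k - 1) x (y(i := y i + c))) =
        (\<Sum>i = 1..n. ?c (k - 1) (?P x) ((?P y)(i := ?P y i + c)))" for c
      using sum_partition_of_tuple[where h = "\<lambda>_. 1" and c = c and g = "?c (k - 1) (?P x)" and n = n and x = y]
      by (simp only: b_eq mult_1)
    have 5: "(\<Sum>i | i \<in> {1..n - 1} \<and> y (i + 1) - y i = 1.
          b (k - 1) x (y(i := y i + 1, i + 1 := y (i + 1) + 1))) =
        (\<Sum>i | i \<in> {1..n - 1} \<and> ?P y i = ?P y (i + 1).
          ?c (k - 1) (?P x) ((?P y)(i := ?P y i + 1, i + 1 := ?P y (i + 1) + 1)))"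
      unfolding b_eq by (rule sum_partition_of_tuple_adjacent)
    show ?thesis
      using partition_moment_first[OF haar n parts, of q k]
      unfolding sum.distrib sum_subtractf 1 2 3 4 5 .
  qed
  show "(\<Sum>i = 1..n. of_int (y i) * b k x (y(i := y i - 1))
          - of_int (x i + 1 + int q) * b k (x(i := x i + 1)) y
          + of_int (y i - x i) * b k x y)
       + of_nat k * (\<Sum>i = 1..n. b (k - 1) x y + b (k - 1) x (y(i := y i + 1))) = 0"
    if x: "is_strict_tuple n x" and y: "is_strict_tuple n y" for k x y
  proof -
    have parts: "is_partition n (?P x)" "is_partition n (?P y)"
      using x y by (simp_all add: is_strict_tuple_iff_partition)
    have 1: "(\<Sum>i = 1..n. of_int (y i) * b k x (y(i := y i - 1))) =
        (\<Sum>i = 1..n. of_int (?P y i - int i + int n) * ?c k (?P x) ((?P y)(i := ?P y i - 1)))"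
      using sum_partition_of_tuple[where h = of_int and c = "-1" and g = "?c k (?P x)" and n = n and x = y]
      by (simp add: b_eq)
    have 2: "(\<Sum>i = 1..n. of_int (x i + 1 + int q) * b k (x(i := x i + 1)) y) =
        (\<Sum>i = 1..n. of_int (?P x i - int i + int n + int q + 1) * ?c k ((?P x)(i := ?P x i + 1)) (?P y))"
      using sum_partition_of_tuple[where h = "\<lambda>t. of_int (t + 1 + int q)" and c = 1 and g = "\<lambda>l. ?c k l (?P y)" and n = n and x = x]
      by (simp only: b_eq add_ac)
    have 3: "(\<Sum>i = 1..n. of_int (y i - x i) * b k x y) =
        of_int (tuple_size n (?P y) - tuple_size n (?P x)) * ?c k (?P x) (?P y)"
      unfolding tuple_size_difference b_eq by (simp flip: sum_distrib_right)
    have 4: "(\<Sum>i = 1..n. b (k - 1) x (y(i := y i + 1))) =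
        (\<Sum>i = 1..n. ?c (k - 1) (?P x) ((?P y)(i := ?P y i + 1)))"
      using sum_partition_of_tuple[where h = "\<lambda>_. 1" and c = 1 and g = "?c (k - 1) (?P x)" and n = n and x = y]
      by (simp only: b_eq mult_1)
    show ?thesis
      using partition_moment_second[OF haar n parts, of q k]
      unfolding sum.distrib sum_subtractf 1 2 3 4
      unfolding b_eq .
  qed
qed

end
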